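(* Fix $\alpha>0$. Let $\mathrm{q}_0$ be a nonnegative, compactly supported, bounded Radon measure on $\mathbb{R}^2$, and let $R_0>0$ be the radius of a disk centered at the origin which contains the support of $\mathrm{q}_0$. Let $\mathrm{q}=\mathrm{q}(\mathbf{x},t)$, with $\mathrm{q}\in L^\infty(0,T;\mathcal{BM}_{+,c}(\mathbb{R}^2))$ for every $T>0$, be the unique global weak solution of the two-dimensional Euler-$\alpha$ equations in vorticity form $$\partial_t \mathrm{q}+\mathbf{u}\cdot\nabla \mathrm{q}=0,\qquad \operatorname{div}\mathbf{u}=0,\qquad \operatorname{curl}\mathbf{u}=(\mathbb{I}-\alpha^2\Delta)^{-1}\mathrm{q}\qquad\text{in }\mathbb{R}^2\times\mathbb{R}_+,$$ with $\mathrm{q}(\cdot,0)=\mathrm{q}_0$. Then there exists a constant $C>0$, depending (for the fixed $\alpha$) on $R_0$ and on the mass $\int d\mathrm{q}_0$, the center of mass $\int \mathbf{x}\,d\mathrm{q}_0(\mathbf{x})$ and the moment of inertia $\int|\mathbf{x}|^2\,d\mathrm{q}_0(\mathbf{x})$ of $\mathrm{q}_0$, such that, for every $t\ge 0$, the support of $\mathrm{q}(\cdot,t)$ is contained in the disk centered at the origin with radius $$R(t)=8R_0+C\,[\,t\log(2+t)\,]^{1/4}.$$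
   Context: $\mathcal{BM}(\mathbb{R}^2)$ denotes the space of bounded (finite) Radon measures on $\mathbb{R}^2$; the subscripts $+$ and $c$ denote nonnegative and compactly supported measures, respectively. The number $\alpha>0$ is fixed throughout. The measure $\mathrm{q}$ is called the unfiltered vorticity and $\omega=(\mathbb{I}-\alpha^2\Delta)^{-1}\mathrm{q}=\operatorname{curl}\mathbf{u}$ the filtered vorticity. For $\mathbf{x}=(a,b)$ write $\mathbf{x}^\perp=(-b,a)$. Let $K(\mathbf{x})=\mathbf{x}^\perp/(2\pi|\mathbf{x}|^2)$ be the Biot-Savart kernel, let $G_\alpha$ be the convolution kernel of $(\mathbb{I}-\alpha^2\Delta)^{-1}$ on $\mathbb{R}^2$ (radially symmetric, positive, with unit integral), and let $K_\alpha=K*G_\alpha$ (a bounded continuous vector field). The velocity is recovered from the unfiltered vorticity by $\mathbf{u}(\cdot,t)=K_\alpha*\mathrm{q}(\cdot,t)$, i.e. $\mathbf{u}(\mathbf{x},t)=\int K_\alpha(\mathbf{x}-\mathbf{y})\,d\mathrm{q}(\mathbf{y},t)$. A weak solution with initial data $\mathrm{q}_0$ is understood in the standard distributional sense: with $\mathbf{u}=K_\alpha*\mathrm{q}$, for every $\varphi\in C_c^\infty(\mathbb{R}^2\times[0,\infty))$, $$\int_0^\infty\!\!\int_{\mathbb{R}^2}\big(\partial_t\varphi+\mathbf{u}\cdot\nabla\varphi\big)\,d\mathrm{q}(\mathbf{x},t)\,dt+\int_{\mathbb{R}^2}\varphi(\mathbf{x},0)\,d\mathrm{q}_0(\mathbf{x})=0,$$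 where $t\mapsto \mathrm{q}(\cdot,t)$ is taken to be its weak-$*$ continuous representative. Global existence and uniqueness of the weak solution for $\mathrm{q}_0\in\mathcal{BM}(\mathbb{R}^2)$ is a known result of Oliver and Shkoller. *)

theory Defs
  imports "HOL-Analysis.Analysis"
begin

text \<open>
  \<open>C_diff k f\<close>: \<open>f\<close> is of class \<open>C\<^sup>k\<close> on the whole space, via iterated directional derivatives.
\<close>

primrec C_diff :: "nat \<Rightarrow> ('a::euclidean_space \<Rightarrow> real) \<Rightarrow> bool" where
  "C_diff 0 f \<longleftrightarrow> continuous_on UNIV f"
| "C_diff (Suc k) f \<longleftrightarrow> (\<forall>x. f differentiable (at x)) \<and>
     (\<forall>v. C_diff k (\<lambda>x. frechet_derivative f (at x) v))"

definition test_function :: "('a::euclidean_space \<Rightarrow> real) \<Rightarrow> bool" where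
  "test_function f \<longleftrightarrow> (\<forall>k. C_diff k f) \<and> compact (closure {x. f x \<noteq> 0})"

definition laplacian :: "('a::euclidean_space \<Rightarrow> real) \<Rightarrow> 'a \<Rightarrow> real" where
  "laplacian f x =
     (\<Sum>b\<in>Basis. frechet_derivative (\<lambda>y. frechet_derivative f (at y) b) (at x) b)"

definition conv ::
  "('a::euclidean_space \<Rightarrow> 'b::euclidean_space) \<Rightarrow> ('a \<Rightarrow> real) \<Rightarrow> 'a \<Rightarrow> 'b" where
  "conv k g x = (LINT y|lborel. g y *\<^sub>R k (x - y))"

text \<open>
  \<open>helmholtz_kernel \<alpha> G\<close>: \<open>G\<close> is the convolution kernel of the inverse of \<open>I - \<alpha>\<^sup>2 \<Delta>\<close> on the plane.
  The last clause determines an integrable \<open>G\<close> up to a null set, which does not affect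
  convolutions with \<open>G\<close>; the other clauses record that the kernel is integrable with integral
  one, radially symmetric and positive.  The kernel has a logarithmic singularity at the
  origin, so no condition is put on the value \<open>G 0\<close>.
\<close>

definition helmholtz_kernel :: "real \<Rightarrow> (real^2 \<Rightarrow> real) \<Rightarrow> bool" where
  "helmholtz_kernel \<alpha> G \<longleftrightarrow>
     integrable lborel G \<and> (LINT x|lborel. G x) = 1 \<and>
     (\<forall>x y. norm x = norm y \<longrightarrow> G x = G y) \<and>
     (\<forall>x. x \<noteq> 0 \<longrightarrow> G x > 0) \<and>
     (\<forall>\<psi>. test_function \<psi> \<longrightarrow> conv G (\<lambda>x. \<psi> x - \<alpha>\<^sup>2 * laplacian \<psi> x) = \<psi>)"

definition perp :: "real^2 \<Rightarrow> real^2" where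
  "perp x = vector [- (x $ 2), x $ 1]"

definition biot_savart :: "real^2 \<Rightarrow> real^2" where
  "biot_savart x = perp x /\<^sub>R (2 * pi * (norm x)\<^sup>2)"

text \<open>The filtered Biot-Savart kernel \<open>K\<^sub>\<alpha> = K * G\<^sub>\<alpha>\<close>.\<close>

definition filtered_kernel :: "(real^2 \<Rightarrow> real) \<Rightarrow> real^2 \<Rightarrow> real^2" where
  "filtered_kernel G = conv biot_savart G"

text \<open>
  Nonnegative bounded Radon measures.  A finite Borel measure on a Euclidean space is
  automatically Radon, so no regularity clause is needed.
\<close>

definition bounded_radon_measure :: "'a::euclidean_space measure \<Rightarrow> bool" where
  "bounded_radon_measure \<mu> \<longleftrightarrow> sets \<mu> = sets borel \<and> finite_measure \<mu>"

definition measure_support :: "'a::topological_space measure \<Rightarrow> 'a set" where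
  "measure_support \<mu> = {x. \<forall>U. open U \<and> x \<in> U \<longrightarrow> emeasure \<mu> U \<noteq> 0}"

definition mass :: "(real^2) measure \<Rightarrow> real" where
  "mass \<mu> = measure \<mu> UNIV"

definition velocity :: "(real^2 \<Rightarrow> real) \<Rightarrow> (real \<Rightarrow> (real^2) measure) \<Rightarrow> real \<Rightarrow> real^2 \<Rightarrow> real^2" where
  "velocity G q t x = (LINT y|q t. filtered_kernel G (x - y))"

text \<open>
  The space of finite signed measures is the dual of the continuous functions vanishing at
  infinity, so these are the test functions for weak-* continuity.
\<close>

definition weak_star_continuous :: "(real \<Rightarrow> (real^2) measure) \<Rightarrow> bool" where
  "weak_star_continuous q \<longleftrightarrow>
     (\<forall>f :: real^2 \<Rightarrow> real. continuous_on UNIV f \<and> (f \<longlongrightarrow> 0) at_infinity \<longrightarrow>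
        continuous_on {0..} (\<lambda>t. LINT x|q t. f x))"

text \<open>
  \<open>q \<in> L\<^sup>\<infinity>(0,T; BM\<^sub>+\<^sub>,\<^sub>c)\<close> for every \<open>T > 0\<close>: the mass is essentially bounded on \<open>[0,T]\<close> and the
  support is compact for almost every time, with no uniformity of the supports in time.
\<close>

definition locally_bounded_compactly_supported :: "(real \<Rightarrow> (real^2) measure) \<Rightarrow> bool" where
  "locally_bounded_compactly_supported q \<longleftrightarrow>
     (\<forall>T>0. \<exists>B. AE t in lborel. 0 \<le> t \<and> t \<le> T \<longrightarrow>
        compact (measure_support (q t)) \<and> mass (q t) \<le> B)"

text \<open>
  Test functions on the closed half space \<open>R\<^sup>2 \<times> [0,\<infinity>)\<close> are the restrictions of test functions
  on \<open>R\<^sup>2 \<times> R\<close>.  The vectors \<open>(0, 1)\<close> and \<open>(u, 0)\<close> give \<open>\<partial>\<^sub>t \<phi>\<close> and \<open>u \<bullet> \<nabla>\<phi>\<close> respectively.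
\<close>

definition weak_solution ::
  "(real^2 \<Rightarrow> real) \<Rightarrow> (real^2) measure \<Rightarrow> (real \<Rightarrow> (real^2) measure) \<Rightarrow> bool" where
  "weak_solution G q0 q \<longleftrightarrow>
     (\<forall>t\<ge>0. bounded_radon_measure (q t)) \<and>
     locally_bounded_compactly_supported q \<and>
     weak_star_continuous q \<and>
     q 0 = q0 \<and>
     (\<forall>\<phi> :: (real^2) \<times> real \<Rightarrow> real. test_function \<phi> \<longrightarrow>
        (LINT t:{0..}|lborel. (LINT x|q t.
            frechet_derivative \<phi> (at (x, t)) (0, 1)
          + frechet_derivative \<phi> (at (x, t)) (velocity G q t x, 0)))
        + (LINT x|q0. \<phi> (x, 0)) = 0)"

definition first_moment :: "(real^2) measure \<Rightarrow> real^2" where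
  "first_moment \<mu> = (LINT x|\<mu>. x)"

definition moment_of_inertia :: "(real^2) measure \<Rightarrow> real" where
  "moment_of_inertia \<mu> = (LINT x|\<mu>. (norm x)\<^sup>2)"

end

theory Submission
  imports Defs "HOL-Complex_Analysis.Complex_Analysis"
begin

text \<open>
  The proof is Eulerian. No flow map is constructed: the measures are tested against functions
  of space, and the support is controlled through the mass \<open>tail c r\<close> that lies outside the disc
  of radius \<open>r\<close> around the centre of mass \<open>c\<close>.

  \<^emph>\<open>The kernel.\<close> Since \<open>G\<close> is radial, Newton's theorem (\<open>filtered_kernel_newton\<close>) gives
  \<open>K\<^sub>\<alpha> z = k \<bar>z\<bar> perp z\<close>, where \<open>2\<pi> r\<^sup>2 k r\<close> is the mass of \<open>G\<close> inside the disc of radius \<open>r\<close>. The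
  dynamics sees \<open>K\<^sub>\<alpha>\<close> through three facts, collected in the locale \<open>vortex_kernel\<close>: \<open>K\<^sub>\<alpha>\<close> is
  bounded, \<open>\<bar>z\<bar> \<bar>K\<^sub>\<alpha> z\<bar>\<close> is bounded, and \<open>r\<^sup>2 k r\<close> tends to \<open>1 / 2\<pi>\<close> at the rate \<open>1 / r\<close>. The
  quantitative input comes from the identity that defines \<open>G\<close>, without Bessel functions. Tested
  against a truncation of \<open>- sqrt (\<bar>y\<bar>\<^sup>2 + e)\<close>, whose Laplacian stays below
  \<open>- 1 / sqrt (\<bar>y\<bar>\<^sup>2 + e)\<close> near the origin, it bounds \<open>\<integral> G y / \<bar>x - y\<bar> dy\<close> uniformly in \<open>x\<close>;
  tested against a cutoff at scale \<open>r\<close>, it bounds the mass of \<open>G\<close> outside that disc by \<open>D / r\<^sup>2\<close>.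

  \<^emph>\<open>The dynamics.\<close> For a test function \<open>f\<close> of space, \<open>\<integral> f dq\<close> changes at the rate
  \<open>flux (grad f) q\<close> (\<open>integral_test_function_evolution\<close>). Because \<open>K\<^sub>\<alpha>\<close> is odd, this rate equals
  \<open>1/2 \<integral>\<integral> (grad f x - grad f y) \<bullet> K\<^sub>\<alpha> (x - y) dq dq\<close>, and the difference of gradients compensates
  the slow decay of \<open>K\<^sub>\<alpha>\<close>. Cutoffs of \<open>1\<close>, \<open>x\<close> and \<open>\<bar>x - c\<bar>\<^sup>2\<close> at growing scales then show that
  mass and centre of mass are conserved and that the moment of inertia about \<open>c\<close> stays below its
  initial bound, although no uniform bound on the supports is available beforehand.

  \<^emph>\<open>Confinement.\<close> At a distance \<open>r\<close> from \<open>c\<close>, the vorticity inside radius \<open>r/2\<close> produces an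
  outward velocity of order \<open>1 / r ^ 3\<close> only (\<open>far_field_radial\<close>): the leading term of the
  expansion of the kernel integrates to zero because \<open>c\<close> is the centre of mass. Cut the annulus
  between \<open>r\<close> and \<open>5r/4\<close> into \<open>n\<close> thin annuli. Each is crossed at a rate at most \<open>\<beta>\<close> times the
  mass outside its inner circle, so \<open>n\<close> successive integrations in time leave at most
  \<open>(\<beta> t)\<^sup>n / n!\<close> of the mass outside \<open>5r/4\<close>. This is used twice. First, the interactions beyond
  \<open>r/2\<close> are estimated by symmetrization and Chebyshev's inequality; then \<open>\<beta>\<close> is of order
  \<open>n\<^sup>2 / r\<^sup>4\<close>, and \<open>n\<close> of order \<open>r\<^sup>4 / t\<close> yields a tail of order \<open>exp (- r\<^sup>4 / (a t))\<close>, hence of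
  order \<open>1 / r ^ 3\<close> as soon as \<open>r\<^sup>4 \<ge> 2 a t ln (2 + t)\<close>. With this knowledge the velocity
  produced by those interactions is of order \<open>1 / r ^ 3\<close> as well, so \<open>\<beta>\<close> is of order \<open>n / r\<^sup>4\<close>,
  and as \<open>n\<close> tends to infinity the bound \<open>(const t / r\<^sup>4)\<^sup>n\<close> tends to zero: no mass is left
  outside \<open>5r/4\<close>.

  The disc of radius \<open>2 R0\<close> around \<open>c\<close> contains the initial support. The two steps of ratio
  \<open>5/4\<close>, the ratio \<open>2\<close> between them and the shift by \<open>\<bar>c\<bar> \<le> R0\<close> turn this into the radius
  \<open>2 * 5/4 * 2 * 5/4 R0 + R0 = 29/4 R0 \<le> 8 R0\<close> at time zero.
\<close>

section \<open>Smooth functions and a smooth step\<close>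

definition smooth :: "('a::euclidean_space \<Rightarrow> real) \<Rightarrow> bool" where
  "smooth f \<longleftrightarrow> (\<forall>k. C_diff k f)"

lemma C_diff_Suc_imp: "C_diff (Suc k) f \<Longrightarrow> C_diff k f"
proof (induction k arbitrary: f)
  case 0
  then show ?case
    by (simp add: differentiable_imp_continuous_within continuous_at_imp_continuous_on)
next
  case (Suc k)
  then show ?case by (metis C_diff.simps(2))
qed

lemma C_diff_SucI:
  assumes "\<And>x. (f has_derivative D x) (at x)" "\<And>v. C_diff k (\<lambda>x. D x v)"
  shows "C_diff (Suc k) f"
proof -
  have "frechet_derivative f (at x) = D x" for x
    using assms(1) frechet_derivative_at by metis
  then show ?thesis
    using assms by (auto simp: differentiable_def)
qed

lemma C_diff_SucD:
  assumes "C_diff (Suc k) f"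
  shows "(f has_derivative frechet_derivative f (at x)) (at x)"
    and "C_diff k (\<lambda>x. frechet_derivative f (at x) v)"
  using assms by (auto simp: frechet_derivative_works)

lemma C_diff_const: "C_diff k (\<lambda>x. c)"
proof (induction k arbitrary: c)
  case (Suc k)
  show ?case
    by (rule C_diff_SucI[where D = "\<lambda>x v. 0"]) (auto simp: Suc)
qed auto

lemma C_diff_bounded_linear:
  assumes "bounded_linear f" shows "C_diff k f"
proof (cases k)
  case (Suc n)
  show ?thesis unfolding Suc
    by (rule C_diff_SucI[where D = "\<lambda>x. f"])
       (auto simp: C_diff_const bounded_linear_imp_has_derivative[OF assms])
qed (use assms in \<open>auto simp: linear_continuous_on\<close>)

lemma C_diff_add:
  assumes "C_diff k f" "C_diff k g" shows "C_diff k (\<lambda>x. f x + g x)"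
  using assms
proof (induction k arbitrary: f g)
  case (Suc k)
  note d = C_diff_SucD[OF Suc.prems(1)] C_diff_SucD[OF Suc.prems(2)]
  show ?case
    by (rule C_diff_SucI[OF has_derivative_add[OF d(1,3)]]) (intro Suc.IH d(2,4))
qed (auto intro: continuous_intros)

lemma C_diff_mult:
  assumes "C_diff k f" "C_diff k g" shows "C_diff k (\<lambda>x. f x * g x)"
  using assms
proof (induction k arbitrary: f g)
  case (Suc k)
  note d = C_diff_SucD[OF Suc.prems(1)] C_diff_SucD[OF Suc.prems(2)]
  show ?case
    by (rule C_diff_SucI[OF has_derivative_mult[OF d(1,3)]])
       (intro C_diff_add Suc.IH d(2,4) C_diff_Suc_imp[OF Suc.prems(1)] C_diff_Suc_imp[OF Suc.prems(2)])
qed (auto intro: continuous_intros)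

lemma C_diff_affine:
  assumes "C_diff k f" "bounded_linear L" shows "C_diff k (\<lambda>x. f (L x + b))"
  using assms(1)
proof (induction k arbitrary: f)
  case 0
  have "continuous_on UNIV (f \<circ> (\<lambda>x. L x + b))"
    by (rule continuous_on_compose[OF continuous_on_add[OF linear_continuous_on[OF assms(2)] continuous_on_const]])
       (use 0 in \<open>auto intro: continuous_on_subset\<close>)
  then show ?case by (simp add: o_def)
next
  case (Suc k)
  note d = C_diff_SucD[OF Suc.prems(1)]
  have "((\<lambda>x. f (L x + b)) has_derivative (\<lambda>v. frechet_derivative f (at (L x + b)) (L v))) (at x)" for x
    by (rule has_derivative_compose[OF _ d(1)])
       (auto intro!: derivative_eq_intros bounded_linear_imp_has_derivative[OF assms(2)])
  then show ?case
    by (rule C_diff_SucI) (intro Suc.IH d(2))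
qed

text \<open>
  Iterated derivatives of a composition are sums of products that contain all derivatives of the
  outer function.  A family closed under differentiation makes the induction go through without
  naming them; powers, flat exponentials and the smooth functions themselves are such families.
\<close>

lemma C_diff_compose_family:
  assumes closed: "\<And>h. h \<in> H \<Longrightarrow> \<exists>h'\<in>H. \<forall>s\<in>U. (h has_real_derivative h' s) (at s)"
    and "h \<in> H" "C_diff k f" "\<And>x. f x \<in> U"
  shows "C_diff k (\<lambda>x. h (f x))"
  using assms(2-4)
proof (induction k arbitrary: h)
  case 0
  obtain h' where h': "\<forall>s\<in>U. (h has_real_derivative h' s) (at s)"
    using closed[OF 0(1)] by blast
  have "continuous_on UNIV (\<lambda>x. h (f x))"
  proof (intro continuous_at_imp_continuous_on ballI)
    fix x
    have "isCont h (f x)"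
      using h' 0(3) DERIV_isCont by blast
    moreover have "isCont f x"
      using 0(2) by (simp add: continuous_on_eq_continuous_at)
    ultimately show "isCont (\<lambda>x. h (f x)) x"
      by (rule isCont_o2[rotated])
  qed
  then show ?case by simp
next
  case (Suc k)
  obtain h' where h': "h' \<in> H" "\<forall>s\<in>U. (h has_real_derivative h' s) (at s)"
    using closed[OF Suc(2)] by blast
  note d = C_diff_SucD[OF Suc.prems(2)]
  have "((\<lambda>x. h (f x)) has_derivative (\<lambda>v. h' (f x) * frechet_derivative f (at x) v)) (at x)" for x
    using has_derivative_compose[OF d(1) h'(2)[rule_format, OF Suc.prems(3), unfolded has_field_derivative_def]]
    by simp
  then show ?case
    by (rule C_diff_SucI)
       (intro C_diff_mult Suc.IH[OF h'(1)] d(2) C_diff_Suc_imp[OF Suc.prems(2)] Suc.prems(3))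
qed

lemma smooth_const: "smooth (\<lambda>x. c)"
  and smooth_bounded_linear: "bounded_linear L \<Longrightarrow> smooth L"
  and smooth_add: "smooth f \<Longrightarrow> smooth g \<Longrightarrow> smooth (\<lambda>x. f x + g x)"
  and smooth_mult: "smooth f \<Longrightarrow> smooth g \<Longrightarrow> smooth (\<lambda>x. f x * g x)"
  and smooth_affine: "smooth f \<Longrightarrow> bounded_linear M \<Longrightarrow> smooth (\<lambda>x. f (M x + b))"
  by (auto simp: smooth_def C_diff_const C_diff_bounded_linear C_diff_add C_diff_mult C_diff_affine)

lemma smooth_minus: "smooth f \<Longrightarrow> smooth (\<lambda>x. - f x)"
  using smooth_mult[of "\<lambda>x. - 1" f] by (simp add: smooth_const)

lemma smooth_diff: "smooth f \<Longrightarrow> smooth g \<Longrightarrow> smooth (\<lambda>x. f x - g x)"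
  using smooth_add[of f "\<lambda>x. - g x"] by (simp add: smooth_minus)

lemma smooth_has_derivative: "smooth f \<Longrightarrow> (f has_derivative frechet_derivative f (at x)) (at x)"
  and smooth_derivative: "smooth f \<Longrightarrow> smooth (\<lambda>x. frechet_derivative f (at x) v)"
  and smooth_continuous: "smooth f \<Longrightarrow> continuous_on S f"
proof -
  show "(f has_derivative frechet_derivative f (at x)) (at x)" if "smooth f"
    using that C_diff_SucD(1)[of 0 f] by (simp only: smooth_def)
  show "smooth (\<lambda>x. frechet_derivative f (at x) v)" if "smooth f"
    using that C_diff_SucD(2)[of _ f] by (simp only: smooth_def) blast
  show "continuous_on S f" if "smooth f"
    using that C_diff.simps(1)[of f] continuous_on_subset[of UNIV f S] by (simp only: smooth_def subset_UNIV)
qed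

lemma smooth_real_derivative:
  fixes h :: "real \<Rightarrow> real"
  assumes "smooth h"
  shows "(h has_real_derivative frechet_derivative h (at s) 1) (at s)"
proof -
  have "frechet_derivative h (at s) v = frechet_derivative h (at s) 1 * v" for v
    using linear_cmul[OF has_derivative_linear[OF smooth_has_derivative[OF assms]], of s v 1]
    by (simp only: mult.commute[of v] mult_1_right real_scaleR_def)
  then have "(*) (frechet_derivative h (at s) 1) = frechet_derivative h (at s)"
    by (intro ext) (rule sym)
  then show ?thesis
    unfolding has_field_derivative_def using smooth_has_derivative[OF assms] by simp
qed

lemma smooth_compose_real:
  fixes h :: "real \<Rightarrow> real"
  assumes "smooth h" "smooth f"
  shows "smooth (\<lambda>x. h (f x))"
  unfolding smooth_def
proof
  fix k
  show "C_diff k (\<lambda>x. h (f x))"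
  proof (rule C_diff_compose_family[where H = "Collect smooth" and U = UNIV and f = f])
    fix g :: "real \<Rightarrow> real"
    assume "g \<in> Collect smooth"
    then show "\<exists>h'\<in>Collect smooth. \<forall>s\<in>UNIV. (g has_real_derivative h' s) (at s)"
      by (intro bexI[of _ "\<lambda>s. frechet_derivative g (at s) 1"])
         (auto intro: smooth_real_derivative smooth_derivative)
  next
    show "h \<in> Collect smooth" "C_diff k f"
      using assms by (simp_all add: smooth_def)
  qed simp
qed

lemma smooth_powr:
  assumes "smooth f" "\<And>x. f x > 0"
  shows "smooth (\<lambda>x. f x powr a)"
proof -
  let ?H = "{\<lambda>s::real. c * s powr b | c b. True}"
  have "C_diff k (\<lambda>x. (\<lambda>s. 1 * s powr a) (f x))" for k
  proof (rule C_diff_compose_family[where H = ?H and U = "{0<..}" and f = f])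
    fix g assume "g \<in> ?H"
    then obtain c b where g: "g = (\<lambda>s. c * s powr b)" by auto
    have "\<forall>s\<in>{0<..}. (g has_real_derivative (c * b) * s powr (b - 1)) (at s)"
      unfolding g by (auto intro!: derivative_eq_intros)
    then show "\<exists>h'\<in>?H. \<forall>s\<in>{0<..}. (g has_real_derivative h' s) (at s)"
      by (intro bexI[of _ "\<lambda>s. (c * b) * s powr (b - 1)"]) auto
  next
    show "(\<lambda>s. 1 * s powr a) \<in> ?H" by blast
  qed (use assms in \<open>auto simp: smooth_def\<close>)
  then show ?thesis by (simp add: smooth_def)
qed

lemma smooth_norm_square: "smooth (\<lambda>x::'a::euclidean_space. (norm x)\<^sup>2)"
  unfolding smooth_def
proof
  fix k
  have "C_diff (Suc k) (\<lambda>x::'a. (norm x)\<^sup>2)"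
  proof (rule C_diff_SucI)
    show "((\<lambda>x. (norm x)\<^sup>2) has_derivative (\<lambda>v. 2 * (x \<bullet> v))) (at x)" for x :: 'a
      unfolding power2_norm_eq_inner
      by (auto intro!: derivative_eq_intros simp: inner_commute)
    show "C_diff k (\<lambda>x. 2 * (x \<bullet> v))" for v :: 'a
      by (intro C_diff_bounded_linear bounded_linear_const_mult bounded_linear_inner_left)
  qed
  then show "C_diff k (\<lambda>x::'a. (norm x)\<^sup>2)"
    by (rule C_diff_Suc_imp)
qed

text \<open>
  The functions \<open>p (1/s) exp (-1/s)\<close>, extended by zero. Differentiation only changes the
  polynomial, so they form a closed family for the chain rule above.
\<close>

definition flat_exp :: "real poly \<Rightarrow> real \<Rightarrow> real" where
  "flat_exp p s = (if s > 0 then poly p (1 / s) * exp (- (1 / s)) else 0)"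

lemma poly_times_exp_tendsto: "((\<lambda>u. poly p u * exp (- u)) \<longlongrightarrow> 0) (at_top :: real filter)"
proof -
  have "((\<lambda>u::real. \<Sum>i\<le>degree p. coeff p i * (u ^ i / exp u)) \<longlongrightarrow> (\<Sum>i\<le>degree p. coeff p i * 0)) at_top"
    by (intro tendsto_intros tendsto_power_div_exp_0)
  then show ?thesis
    by (simp add: poly_altdef exp_minus sum_divide_distrib divide_inverse[symmetric])
qed

lemma flat_exp_has_derivative:
  "(flat_exp p has_real_derivative flat_exp ((p - pderiv p) * [:0, 0, 1:]) s) (at s)"
proof (cases "s = 0")
  case False
  show ?thesis
  proof (cases "s > 0")
    case True
    have "((\<lambda>s. poly p (1 / s) * exp (- (1 / s))) has_real_derivative
            flat_exp ((p - pderiv p) * [:0, 0, 1:]) s) (at s)"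
      using True
      by (auto intro!: derivative_eq_intros DERIV_chain2[OF poly_DERIV] simp: flat_exp_def field_simps power2_eq_square)
    moreover have "\<forall>\<^sub>F x in nhds s. flat_exp p x = poly p (1 / x) * exp (- (1 / x))"
      using eventually_nhds_in_open[of "{0<..}" s] True
      by (auto simp: flat_exp_def elim!: eventually_mono)
    ultimately show ?thesis
      by (subst DERIV_cong_ev[OF refl _ refl]) auto
  next
    case neg: False
    have "\<forall>\<^sub>F x in nhds s. flat_exp p x = 0"
      using eventually_nhds_in_open[of "{..<0}" s] neg \<open>s \<noteq> 0\<close>
      by (auto simp: flat_exp_def elim!: eventually_mono)
    moreover have "flat_exp ((p - pderiv p) * [:0, 0, 1:]) s = 0"
      using neg by (simp add: flat_exp_def)
    ultimately show ?thesis
      by (subst DERIV_cong_ev[OF refl _ refl, where g = "\<lambda>_. 0"]) auto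
  qed
next
  case True
  have "((\<lambda>h. flat_exp p h / h) \<longlongrightarrow> 0) (at 0)"
  proof (subst filterlim_at_split, intro conjI)
    have "\<forall>\<^sub>F h in at_left 0. flat_exp p h / h = 0"
      by (auto simp: flat_exp_def eventually_at_filter)
    then show "((\<lambda>h. flat_exp p h / h) \<longlongrightarrow> 0) (at_left 0)"
      by (rule tendsto_eventually)
    have "((\<lambda>h. poly (p * [:0, 1:]) (inverse h) * exp (- inverse h)) \<longlongrightarrow> 0) (at_right 0)"
      by (rule filterlim_compose[OF poly_times_exp_tendsto filterlim_inverse_at_top_right])
    moreover have "\<forall>\<^sub>F h in at_right 0. poly (p * [:0, 1:]) (inverse h) * exp (- inverse h) = flat_exp p h / h"
      by (auto simp: flat_exp_def eventually_at_filter field_simps)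
    ultimately show "((\<lambda>h. flat_exp p h / h) \<longlongrightarrow> 0) (at_right 0)"
      using Lim_transform_eventually by fast
  qed
  then show ?thesis
    using True by (simp add: DERIV_def flat_exp_def)
qed

lemma smooth_flat_exp: "smooth (flat_exp p)"
proof -
  have "C_diff k (\<lambda>s. flat_exp p s)" for k
  proof (rule C_diff_compose_family[where H = "range flat_exp" and U = UNIV and f = "\<lambda>s. s"])
    fix g assume "g \<in> range flat_exp"
    then show "\<exists>h'\<in>range flat_exp. \<forall>s\<in>UNIV. (g has_real_derivative h' s) (at s)"
      using flat_exp_has_derivative by blast
  qed (auto intro: C_diff_bounded_linear)
  then show ?thesis by (simp add: smooth_def)
qed

definition step :: "real \<Rightarrow> real" where
  "step s = flat_exp 1 s * (flat_exp 1 s + flat_exp 1 (1 - s)) powr (-1)"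

lemma step_denominator_pos: "flat_exp 1 s + flat_exp 1 (1 - s) > 0"
  by (cases "s > 0") (auto simp: flat_exp_def add_pos_nonneg add_nonneg_pos)

lemma smooth_step: "smooth step"
proof -
  have "smooth (\<lambda>s::real. flat_exp 1 (- s + 1))"
    by (rule smooth_affine[OF smooth_flat_exp]) (rule bounded_linear_minus[OF bounded_linear_ident])
  then have "smooth (\<lambda>s. flat_exp 1 s + flat_exp 1 (1 - s))"
    by (intro smooth_add smooth_flat_exp) simp
  then show ?thesis
    unfolding step_def[abs_def]
    by (intro smooth_mult smooth_flat_exp smooth_powr step_denominator_pos)
qed

lemma step_eq_0 [simp]: "s \<le> 0 \<Longrightarrow> step s = 0"
  and step_eq_1 [simp]: "s \<ge> 1 \<Longrightarrow> step s = 1"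
  and step_nonneg [simp]: "0 \<le> step s"
  and step_le_1 [simp]: "step s \<le> 1"
proof -
  have d: "step s = flat_exp 1 s / (flat_exp 1 s + flat_exp 1 (1 - s))"
    using step_denominator_pos[of s] by (simp add: step_def powr_minus field_simps)
  show "s \<le> 0 \<Longrightarrow> step s = 0" by (simp add: step_def flat_exp_def)
  show "s \<ge> 1 \<Longrightarrow> step s = 1" using step_denominator_pos[of s] by (simp add: d) (simp add: flat_exp_def)
  show "0 \<le> step s" by (simp add: step_def flat_exp_def)
  show "step s \<le> 1" using step_denominator_pos[of s] by (simp add: d) (simp add: flat_exp_def)
qed

definition step' :: "real \<Rightarrow> real" where
  "step' s = frechet_derivative step (at s) 1"

lemma DERIV_step: "(step has_real_derivative step' s) (at s)"
  unfolding step'_def by (rule smooth_real_derivative[OF smooth_step])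

lemma smooth_step': "smooth step'"
  unfolding step'_def[abs_def] by (rule smooth_derivative[OF smooth_step])

text \<open>
  Also at the two end points, where the derivative vanishes by continuity.
\<close>

lemma step'_eq_0:
  assumes "s \<le> 0 \<or> s \<ge> 1" shows "step' s = 0"
proof -
  have *: "step' s = 0" if "s < 0 \<or> s > 1" for s
  proof -
    obtain c where "\<forall>\<^sub>F x in nhds s. step x = c"
    proof (cases "s < 0")
      case True
      show ?thesis
        by (rule that[of 0]) (use True eventually_nhds_in_open[of "{..<0}" s] in \<open>auto elim!: eventually_mono\<close>)
    next
      case False
      show ?thesis
        by (rule that[of 1])
           (use False \<open>s < 0 \<or> s > 1\<close> eventually_nhds_in_open[of "{1<..}" s] in \<open>auto elim!: eventually_mono\<close>)
    qed
    then have "(step has_real_derivative 0) (at s)"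
      by (subst DERIV_cong_ev[OF refl _ refl, where g = "\<lambda>_. c"]) auto
    then show ?thesis using DERIV_step DERIV_unique by blast
  qed
  have cont: "isCont step' s" for s
    using smooth_continuous[OF smooth_step', of UNIV] continuous_on_eq_continuous_at[of UNIV step'] by blast
  consider "s < 0 \<or> s > 1" | "s = 0" | "s = 1" using assms by linarith
  then show ?thesis
  proof cases
    case 2
    have "(step' \<longlongrightarrow> step' 0) (at_left 0)"
      using cont[of 0] by (simp add: isCont_def filterlim_at_split)
    moreover have "\<forall>\<^sub>F x in at_left 0. step' x = 0"
      using * by (auto simp: eventually_at_filter)
    ultimately have "step' 0 = 0"
      by (intro tendsto_unique[OF trivial_limit_at_left_real _ tendsto_eventually])
    then show ?thesis using 2 by simp
  next
    case 3
    have "(step' \<longlongrightarrow> step' 1) (at_right 1)"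
      using cont[of 1] by (simp add: isCont_def filterlim_at_split)
    moreover have "\<forall>\<^sub>F x in at_right 1. step' x = 0"
      using * by (auto simp: eventually_at_filter)
    ultimately have "step' 1 = 0"
      by (intro tendsto_unique[OF trivial_limit_at_right_real _ tendsto_eventually])
    then show ?thesis using 3 by simp
  qed (use * in auto)
qed


lemma continuous_bounded_if_zero_outside:
  fixes f :: "real \<Rightarrow> real"
  assumes "continuous_on UNIV f" "\<And>s. s < a \<or> s > b \<Longrightarrow> f s = 0"
  obtains B where "B > 0" "\<And>s. \<bar>f s\<bar> \<le> B"
proof -
  have "compact (f ` {a..b})"
    using assms(1) by (intro compact_continuous_image) (auto intro: continuous_on_subset)
  then obtain B where B: "B > 0" "\<And>s. s \<in> {a..b} \<Longrightarrow> \<bar>f s\<bar> \<le> B"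
    using compact_imp_bounded bounded_pos by (metis image_eqI real_norm_def)
  then have "\<bar>f s\<bar> \<le> B" for s
    using assms(2)[of s] by (cases "s \<in> {a..b}") auto
  with B(1) show ?thesis by (rule that)
qed

definition step'' :: "real \<Rightarrow> real" where
  "step'' s = frechet_derivative step' (at s) 1"

lemma DERIV_step': "(step' has_real_derivative step'' s) (at s)"
  unfolding step''_def by (rule smooth_real_derivative[OF smooth_step'])

lemma step''_eq_0:
  assumes "s < 0 \<or> s > 1" shows "step'' s = 0"
proof -
  have "\<forall>\<^sub>F x in nhds s. step' x = 0"
    using assms eventually_nhds_in_open[of "{..<0}" s] eventually_nhds_in_open[of "{1<..}" s]
    by (auto elim!: eventually_mono intro!: step'_eq_0)
  then have "(step' has_real_derivative 0) (at s)"
    by (subst DERIV_cong_ev[OF refl _ refl, where g = "\<lambda>_. 0"]) auto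
  then show ?thesis using DERIV_step' DERIV_unique by blast
qed

text \<open>
  A single constant for all bounds, so that estimates downstream carry one parameter \<open>b\<close>.
\<close>

lemma step_derivative_bounds:
  obtains B where "B > 0" "\<And>s. \<bar>step' s\<bar> \<le> B" "\<And>s. \<bar>step'' s\<bar> \<le> B"
    "\<And>s s'. \<bar>step' s - step' s'\<bar> \<le> B * \<bar>s - s'\<bar>"
proof -
  obtain B1 where B1: "B1 > 0" "\<And>s. \<bar>step'' s\<bar> \<le> B1"
    using continuous_bounded_if_zero_outside[of step'' 0 1] step''_eq_0
      smooth_continuous[OF smooth_derivative[OF smooth_step'], of UNIV 1] unfolding step''_def[abs_def] by blast
  obtain B2 where B2: "B2 > 0" "\<And>s. \<bar>step' s\<bar> \<le> B2"
    using continuous_bounded_if_zero_outside[of step' 0 1] smooth_continuous[OF smooth_step'] step'_eq_0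
    by (metis less_eq_real_def)
  have lip: "\<bar>step' s - step' s'\<bar> \<le> B1 * \<bar>s - s'\<bar>" for s s'
    using field_differentiable_bound[of UNIV step' step'' B1 s s'] DERIV_step' B1 by simp
  show ?thesis
  proof (rule that[of "max B1 B2"])
    show "\<bar>step' s - step' s'\<bar> \<le> max B1 B2 * \<bar>s - s'\<bar>" for s s'
      using lip[of s s'] mult_right_mono[of B1 "max B1 B2" "\<bar>s - s'\<bar>"] by simp
  qed (use B1 B2 in \<open>auto simp: max.coboundedI1 max.coboundedI2\<close>)
qed

section \<open>Test functions and radial functions\<close>

lemma test_functionI:
  assumes "smooth f" "\<And>x. norm x > R \<Longrightarrow> f x = 0"
  shows "test_function f"
proof -
  have "{x. f x \<noteq> 0} \<subseteq> cball 0 R"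
    using assms(2) by force
  then have "closure {x. f x \<noteq> 0} \<subseteq> cball 0 R"
    by (rule closure_minimal) simp
  then have "compact (closure {x. f x \<noteq> 0})"
    by (meson bounded_cball bounded_subset compact_eq_bounded_closed closed_closure)
  then show ?thesis
    using assms(1) by (simp add: test_function_def smooth_def)
qed

lemma test_functionD:
  assumes "test_function f"
  shows "smooth f" and "\<exists>R>0. \<forall>x. norm x > R \<longrightarrow> f x = 0"
proof -
  show "smooth f" using assms by (simp add: test_function_def smooth_def)
  have "bounded (closure {x. f x \<noteq> 0})"
    using assms by (simp add: test_function_def compact_imp_bounded)
  then obtain R where R: "R > 0" "\<And>x. x \<in> closure {x. f x \<noteq> 0} \<Longrightarrow> norm x \<le> R"
    by (metis bounded_pos)
  have "f x = 0" if "norm x > R" for x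
    using R(2)[of x] closure_subset[of "{x. f x \<noteq> 0}"] that by force
  with R(1) show "\<exists>R>0. \<forall>x. norm x > R \<longrightarrow> f x = 0" by blast
qed

definition grad :: "('a::euclidean_space \<Rightarrow> real) \<Rightarrow> 'a \<Rightarrow> 'a" where
  "grad f x = (\<Sum>b\<in>Basis. frechet_derivative f (at x) b *\<^sub>R b)"

lemma grad_unique:
  assumes "(f has_derivative (\<lambda>v. g \<bullet> v)) (at x)"
  shows "grad f x = g"
proof -
  have "frechet_derivative f (at x) = (\<lambda>v. g \<bullet> v)"
    using frechet_derivative_at[OF assms] by simp
  then show ?thesis
    unfolding grad_def by (simp add: euclidean_representation)
qed

lemma frechet_derivative_eq_grad:
  assumes "smooth f" shows "frechet_derivative f (at x) v = grad f x \<bullet> v"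
proof -
  interpret linear "frechet_derivative f (at x)"
    by (rule has_derivative_linear[OF smooth_has_derivative[OF assms]])
  have "frechet_derivative f (at x) v = frechet_derivative f (at x) (\<Sum>b\<in>Basis. (v \<bullet> b) *\<^sub>R b)"
    by (simp add: euclidean_representation)
  also have "\<dots> = grad f x \<bullet> v"
    by (simp add: sum scale grad_def inner_sum_left) (simp add: inner_commute mult.commute)
  finally show ?thesis .
qed

lemma continuous_on_grad:
  assumes "smooth f" shows "continuous_on S (grad f)"
  unfolding grad_def[abs_def]
  by (intro continuous_intros smooth_continuous smooth_derivative assms)

lemma derivative_eq_0_outside:
  assumes "\<And>x. norm x > R \<Longrightarrow> f x = 0" "norm x > R"
  shows "frechet_derivative f (at x) v = 0"
proof -
  have "open {y. norm y > R}"
    by (intro open_Collect_less continuous_intros)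
  then have "(f has_derivative (\<lambda>v. 0)) (at x)"
    by (rule has_derivative_transform_within_open[OF has_derivative_const[of 0]]) (use assms in auto)
  from frechet_derivative_at[OF this, symmetric] show ?thesis by simp
qed

lemma test_function_derivative:
  assumes "test_function f" shows "test_function (\<lambda>x. frechet_derivative f (at x) v)"
proof -
  obtain R where R: "\<And>x. norm x > R \<Longrightarrow> f x = 0" using test_functionD(2)[OF assms] by blast
  show ?thesis
    by (rule test_functionI[where R = R])
       (use R derivative_eq_0_outside[of R f] test_functionD(1)[OF assms] smooth_derivative in blast)+
qed

lemma test_function_bounded:
  assumes "test_function f" obtains B where "B > 0" "\<And>x. \<bar>f x\<bar> \<le> B"
proof -
  obtain R where R: "\<And>x. norm x > R \<Longrightarrow> f x = 0" using test_functionD(2)[OF assms] by blast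
  have "compact (f ` cball 0 R)"
    using smooth_continuous[OF test_functionD(1)[OF assms]] by (intro compact_continuous_image) auto
  then obtain B where B: "B > 0" "\<And>x. x \<in> cball 0 R \<Longrightarrow> \<bar>f x\<bar> \<le> B"
    using compact_imp_bounded bounded_pos by (metis image_eqI real_norm_def)
  then have "\<bar>f x\<bar> \<le> B" for x
    using R[of x] by (cases "x \<in> cball 0 R") (auto simp: not_le)
  with B(1) show ?thesis by (rule that)
qed

lemma test_function_lipschitz:
  assumes "test_function f"
  obtains L where "L > 0" "\<And>x y. \<bar>f x - f y\<bar> \<le> L * norm (x - y)"
proof -
  have "\<exists>B. B > 0 \<and> (\<forall>x. \<bar>frechet_derivative f (at x) b\<bar> \<le> B)" for b
    using test_function_bounded[OF test_function_derivative[OF assms]] by metis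
  then obtain B where B: "\<And>b. B b > 0" "\<And>b x. \<bar>frechet_derivative f (at x) b\<bar> \<le> B b"
    by metis
  define L where "L = (\<Sum>b\<in>Basis. B b)"
  have g: "norm (grad f x) \<le> L" for x
    unfolding grad_def L_def by (rule sum_norm_le) (simp add: B)
  have "\<bar>f x - f y\<bar> \<le> L * norm (x - y)" for x y
  proof -
    have "onorm (frechet_derivative f (at z)) \<le> L" for z
      by (rule onorm_le)
         (simp add: frechet_derivative_eq_grad[OF test_functionD(1)[OF assms]] order_trans[OF Cauchy_Schwarz_ineq2]
           mult_right_mono g)
    then show ?thesis
      using differentiable_bound[of UNIV f "\<lambda>z. frechet_derivative f (at z)" L x y]
        smooth_has_derivative[OF test_functionD(1)[OF assms]] by simp
  qed
  moreover have "L > 0" unfolding L_def using B(1) by (intro sum_pos) auto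
  ultimately show ?thesis using that by blast
qed

lemma test_function_grad_bounds:
  assumes "test_function f"
  obtains L where "L > 0" "\<And>x. norm (grad f x) \<le> L" "\<And>x y. norm (grad f x - grad f y) \<le> L * norm (x - y)"
proof -
  have "\<exists>B. B > 0 \<and> (\<forall>x. \<bar>frechet_derivative f (at x) b\<bar> \<le> B)" for b
    using test_function_bounded[OF test_function_derivative[OF assms]] by metis
  then obtain B where B: "\<And>b. B b > 0" "\<And>b x. \<bar>frechet_derivative f (at x) b\<bar> \<le> B b"
    by metis
  have "\<exists>L. L > 0 \<and> (\<forall>x y. \<bar>frechet_derivative f (at x) b - frechet_derivative f (at y) b\<bar> \<le> L * norm (x - y))" for b
    using test_function_lipschitz[OF test_function_derivative[OF assms]] by metis
  then obtain L where L: "\<And>b. L b > 0"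
    "\<And>b x y. \<bar>frechet_derivative f (at x) b - frechet_derivative f (at y) b\<bar> \<le> L b * norm (x - y)"
    by metis
  show ?thesis
  proof (rule that[of "\<Sum>b\<in>Basis. B b + L b"])
    show "(\<Sum>b\<in>(Basis::'a set). B b + L b) > 0"
      using B(1) L(1) by (intro sum_pos) (auto simp: add_pos_pos)
    show "norm (grad f x) \<le> (\<Sum>b\<in>Basis. B b + L b)" for x
      unfolding grad_def by (rule sum_norm_le) (simp add: add_increasing2 B less_imp_le[OF L(1)])
    have "norm (grad f x - grad f y) \<le> (\<Sum>b\<in>Basis. L b * norm (x - y))" for x y
      unfolding grad_def sum_subtractf[symmetric] scaleR_diff_left[symmetric]
      by (rule sum_norm_le) (simp add: L)
    also have "\<dots> x y \<le> (\<Sum>b\<in>Basis. B b + L b) * norm (x - y)" for x y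
      unfolding sum_distrib_right
      by (intro sum_mono mult_right_mono) (auto simp: less_imp_le[OF B(1)])
    finally show "norm (grad f x - grad f y) \<le> (\<Sum>b\<in>Basis. B b + L b) * norm (x - y)" for x y .
  qed
qed

lemma test_function_affine:
  fixes f :: "'a::euclidean_space \<Rightarrow> real" and c x :: 'a
  assumes "test_function f" "R \<noteq> 0"
  shows "test_function (\<lambda>x. f ((x - c) /\<^sub>R R))"
    and "grad (\<lambda>x. f ((x - c) /\<^sub>R R)) x = grad f ((x - c) /\<^sub>R R) /\<^sub>R R"
proof -
  obtain r where r: "\<And>x. norm x > r \<Longrightarrow> f x = 0" using test_functionD(2)[OF assms(1)] by blast
  note sm = test_functionD(1)[OF assms(1)]
  have "smooth (\<lambda>x. f (x /\<^sub>R R + (- c /\<^sub>R R)))"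
    by (rule smooth_affine[OF sm bounded_linear_scaleR_right])
  then have "smooth (\<lambda>x. f ((x - c) /\<^sub>R R))"
    by (simp add: scaleR_diff_right)
  then show "test_function (\<lambda>x. f ((x - c) /\<^sub>R R))"
  proof (rule test_functionI[where R = "\<bar>R\<bar> * \<bar>r\<bar> + norm c"])
    fix x :: 'a assume "norm x > \<bar>R\<bar> * \<bar>r\<bar> + norm c"
    then have "norm (x - c) > \<bar>R\<bar> * \<bar>r\<bar>"
      using norm_triangle_ineq2[of x c] by linarith
    then have "\<bar>r\<bar> < norm (x - c) / \<bar>R\<bar>"
      using assms(2) by (simp add: pos_less_divide_eq mult.commute)
    also have "\<dots> = norm ((x - c) /\<^sub>R R)"
      by (simp add: divide_inverse_commute)
    finally have "norm ((x - c) /\<^sub>R R) > r" by simp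
    then show "f ((x - c) /\<^sub>R R) = 0" by (rule r)
  qed
  have "((\<lambda>x. f ((x - c) /\<^sub>R R)) has_derivative (\<lambda>v. frechet_derivative f (at ((x - c) /\<^sub>R R)) (v /\<^sub>R R))) (at x)"
    by (rule has_derivative_compose[OF _ smooth_has_derivative[OF sm]]) (auto intro!: derivative_eq_intros)
  then show "grad (\<lambda>x. f ((x - c) /\<^sub>R R)) x = grad f ((x - c) /\<^sub>R R) /\<^sub>R R"
    by (intro grad_unique) (simp add: frechet_derivative_eq_grad[OF sm])
qed

text \<open>
  Products of a function of space and a function of time are the only space-time test functions
  that the argument inserts into the weak formulation.
\<close>

lemma test_function_prod:
  fixes f :: "'a::euclidean_space \<Rightarrow> real" and \<theta> :: "real \<Rightarrow> real"
  assumes "test_function f" "test_function \<theta>"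
  shows "test_function (\<lambda>p. f (fst p) * \<theta> (snd p))"
    and "frechet_derivative (\<lambda>p. f (fst p) * \<theta> (snd p)) (at (x, t)) (v, s) =
           \<theta> t * (grad f x \<bullet> v) + f x * (grad \<theta> t * s)"
proof -
  note sf = test_functionD(1)[OF assms(1)] and st = test_functionD(1)[OF assms(2)]
  obtain r where r: "\<And>x. norm x > r \<Longrightarrow> f x = 0" using test_functionD(2)[OF assms(1)] by blast
  obtain r' where r': "\<And>x. norm x > r' \<Longrightarrow> \<theta> x = 0" using test_functionD(2)[OF assms(2)] by blast
  have "smooth (\<lambda>p. f (fst p) * \<theta> (snd p))"
    using smooth_mult[OF smooth_affine[OF sf bounded_linear_fst, of 0] smooth_affine[OF st bounded_linear_snd, of 0]]
    by simp
  then show "test_function (\<lambda>p. f (fst p) * \<theta> (snd p))"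
  proof (rule test_functionI[where R = "\<bar>r\<bar> + \<bar>r'\<bar>"])
    fix p :: "'a \<times> real" assume "norm p > \<bar>r\<bar> + \<bar>r'\<bar>"
    then have "norm (fst p) + norm (snd p) > \<bar>r\<bar> + \<bar>r'\<bar>"
      using norm_Pair_le[of "fst p" "snd p"] by simp
    then have "norm (fst p) > r \<or> norm (snd p) > r'" by linarith
    then show "f (fst p) * \<theta> (snd p) = 0" using r r' by auto
  qed
  have 1: "((\<lambda>p. f (fst p)) has_derivative (\<lambda>w. frechet_derivative f (at x) (fst w))) (at (x, t))"
    by (rule has_derivative_compose[of fst]) (use smooth_has_derivative[OF sf] in \<open>auto intro!: derivative_eq_intros\<close>)
  have 2: "((\<lambda>p. \<theta> (snd p)) has_derivative (\<lambda>w. frechet_derivative \<theta> (at t) (snd w))) (at (x, t))"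
    by (rule has_derivative_compose[of snd]) (use smooth_has_derivative[OF st] in \<open>auto intro!: derivative_eq_intros\<close>)
  have "frechet_derivative (\<lambda>p. f (fst p) * \<theta> (snd p)) (at (x, t)) =
      (\<lambda>w. f x * frechet_derivative \<theta> (at t) (snd w) + frechet_derivative f (at x) (fst w) * \<theta> t)"
    using frechet_derivative_at[OF has_derivative_mult[OF 1 2]] by simp
  then show "frechet_derivative (\<lambda>p. f (fst p) * \<theta> (snd p)) (at (x, t)) (v, s) =
           \<theta> t * (grad f x \<bullet> v) + f x * (grad \<theta> t * s)"
    by (simp add: frechet_derivative_eq_grad[OF sf] frechet_derivative_eq_grad[OF st])
qed

lemma radial_derivative:
  fixes x :: "'a::euclidean_space"
  assumes "(p has_real_derivative p') (at ((norm (x - c))\<^sup>2))"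
  shows "((\<lambda>x. p ((norm (x - c))\<^sup>2)) has_derivative (\<lambda>v. (2 * p') *\<^sub>R (x - c) \<bullet> v)) (at x)"
proof -
  have "((\<lambda>x. (norm (x - c))\<^sup>2) has_derivative (\<lambda>v. 2 * ((x - c) \<bullet> v))) (at x)"
    unfolding power2_norm_eq_inner
    by (auto intro!: derivative_eq_intros simp: inner_commute)
  from has_derivative_compose[OF this assms[unfolded has_field_derivative_def]]
  show ?thesis by (simp add: algebra_simps)
qed

lemma radial_laplacian:
  fixes x :: "'a::euclidean_space" and p p' p'' :: "real \<Rightarrow> real"
  assumes p: "\<And>y::'a. (p has_real_derivative p' ((norm y)\<^sup>2)) (at ((norm y)\<^sup>2))"
    and p': "\<And>y::'a. (p' has_real_derivative p'' ((norm y)\<^sup>2)) (at ((norm y)\<^sup>2))"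
  shows "laplacian (\<lambda>x. p ((norm x)\<^sup>2)) x =
    2 * real DIM('a) * p' ((norm x)\<^sup>2) + 4 * (norm x)\<^sup>2 * p'' ((norm x)\<^sup>2)"
proof -
  have 1: "frechet_derivative (\<lambda>x. p ((norm x)\<^sup>2)) (at y) b = p' ((norm y)\<^sup>2) * (2 * (y \<bullet> b))" for y b :: 'a
    using frechet_derivative_at[OF radial_derivative[of p "p' ((norm y)\<^sup>2)" y 0], symmetric] p[of y]
    by simp
  have 2: "frechet_derivative (\<lambda>y. p' ((norm y)\<^sup>2) * (2 * (y \<bullet> b))) (at x) b =
      2 * p' ((norm x)\<^sup>2) + 4 * p'' ((norm x)\<^sup>2) * (x \<bullet> b)\<^sup>2" if "b \<in> Basis" for b
  proof -
    have "((\<lambda>y. p' ((norm y)\<^sup>2) * (2 * (y \<bullet> b))) has_derivative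
       (\<lambda>v. p' ((norm x)\<^sup>2) * (2 * (v \<bullet> b)) + ((2 * p'' ((norm x)\<^sup>2)) *\<^sub>R x \<bullet> v) * (2 * (x \<bullet> b)))) (at x)"
      using has_derivative_mult[OF radial_derivative[of p' _ x 0], of _ "\<lambda>y. 2 * (y \<bullet> b)" "\<lambda>v. 2 * (v \<bullet> b)"] p'[of x]
      by (simp add: bounded_linear_imp_has_derivative bounded_linear_const_mult bounded_linear_inner_left)
    from frechet_derivative_at[OF this, symmetric] show ?thesis
      using that by (simp add: inner_same_Basis power2_eq_square)
  qed
  have "laplacian (\<lambda>x. p ((norm x)\<^sup>2)) x =
      (\<Sum>b\<in>Basis. 2 * p' ((norm x)\<^sup>2) + 4 * p'' ((norm x)\<^sup>2) * (x \<bullet> b)\<^sup>2)"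
    unfolding laplacian_def 1 by (rule sum.cong) (auto simp: 2)
  also have "\<dots> = 2 * real DIM('a) * p' ((norm x)\<^sup>2) + 4 * p'' ((norm x)\<^sup>2) * (\<Sum>b\<in>Basis. (x \<bullet> b)\<^sup>2)"
    by (simp add: sum.distrib sum_distrib_left)
  also have "(\<Sum>b\<in>Basis. (x \<bullet> b)\<^sup>2) = (norm x)\<^sup>2"
    unfolding power2_norm_eq_inner by (subst euclidean_inner) (simp add: power2_eq_square)
  finally show ?thesis by simp
qed

section \<open>The circle average of the Biot-Savart kernel\<close>

lemma distr_lborel_reflection:
  fixes x :: "'a::euclidean_space"
  shows "distr lborel borel (\<lambda>y. x - y) = lborel"
  using lborel_affine[of "-1" x] by (simp add: density_1)

text \<open>
  Orthogonal maps preserve the volume of measurable sets; here this becomes a statement about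
  the measure, as needed for a change of variables under the integral.
\<close>

lemma distr_lborel_orthogonal:
  fixes T :: "real^'n::{finite,wellorder} \<Rightarrow> real^'n::_"
  assumes "orthogonal_transformation T"
  shows "distr lborel borel T = lborel"
proof -
  define U where "U = inv T"
  have bij: "bij T" and U: "orthogonal_transformation U"
    using assms by (auto simp: U_def orthogonal_transformation_bij orthogonal_transformation_inv)
  have [measurable]: "T \<in> borel \<rightarrow>\<^sub>M borel"
    using assms by (intro borel_measurable_continuous_onI linear_continuous_on linear_conv_bounded_linear[THEN iffD1]
        orthogonal_transformation_linear)
  show ?thesis
  proof (rule sym, rule lborel_eqI)
    fix l u :: "real^'n::_" assume le: "\<And>b. b \<in> Basis \<Longrightarrow> l \<bullet> b \<le> u \<bullet> b"
    have eq: "T -` box l u = U ` box l u"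
      unfolding U_def using bij by (simp add: bij_vimage_eq_inv_image)
    have 1: "T -` box l u \<in> sets borel"
      using measurable_sets[of T borel borel "box l u"] by simp
    have "emeasure (distr lborel borel T) (box l u) = emeasure lborel (T -` box l u)"
      by (simp add: emeasure_distr)
    also have "\<dots> = emeasure lebesgue (T -` box l u)"
      using 1 by (simp add: emeasure_completion)
    also have "\<dots> = ennreal (measure lebesgue (U ` box l u))"
      unfolding eq using measurable_orthogonal_image[OF U, of "box l u"]
      by (intro emeasure_eq_measure2) (auto simp: lmeasurable_box)
    also have "\<dots> = ennreal (measure lebesgue (box l u))"
      using measure_orthogonal_image[OF U, of "box l u"] by simp
    also have "\<dots> = (\<Prod>b\<in>Basis. (u - l) \<bullet> b)"
      using le by (simp add: measure_lborel_box_eq)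
    finally show "emeasure (distr lborel borel T) (box l u) = (\<Prod>b\<in>Basis. (u - l) \<bullet> b)" .
  qed simp
qed

lemma perp_component [simp]: "perp x $ 1 = - (x $ 2)" "perp x $ 2 = x $ 1"
  by (simp_all add: perp_def)

lemma linear_perp: "linear perp"
  by (rule linearI) (simp_all add: vec_eq_iff forall_2)

lemma bounded_linear_perp: "bounded_linear perp"
  using linear_perp by (simp add: linear_conv_bounded_linear)

lemma perp_diff: "perp (x - y) = perp x - perp y"
  and perp_add: "perp (x + y) = perp x + perp y"
  and perp_scaleR: "perp (c *\<^sub>R x) = c *\<^sub>R perp x"
  and perp_minus: "perp (- x) = - perp x"
  and perp_zero [simp]: "perp 0 = 0"
  by (simp_all add: vec_eq_iff forall_2)

lemma inner_2: "x \<bullet> y = x $ 1 * y $ 1 + x $ 2 * y $ 2" for x y :: "real^2"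
  by (simp add: inner_vec_def sum_2)

lemma perp_inner_self [simp]: "perp x \<bullet> x = 0" "x \<bullet> perp x = 0"
  by (simp_all add: inner_2)

lemma perp_inner_perp: "perp x \<bullet> perp y = x \<bullet> y"
  by (simp add: inner_2)

lemma norm_perp [simp]: "norm (perp x) = norm x"
  by (simp add: norm_eq_sqrt_inner perp_inner_perp)

definition rot :: "real \<Rightarrow> real^2 \<Rightarrow> real^2" where
  "rot \<theta> y = cos \<theta> *\<^sub>R y + sin \<theta> *\<^sub>R perp y"

lemma orthogonal_rot: "orthogonal_transformation (rot \<theta>)"
proof -
  have "linear (rot \<theta>)"
    unfolding rot_def[abs_def] by (rule linearI) (simp_all add: perp_add perp_scaleR algebra_simps)
  moreover have "norm (rot \<theta> y) = norm y" for y
  proof -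
    have "(c *\<^sub>R y + s *\<^sub>R perp y) \<bullet> (c *\<^sub>R y + s *\<^sub>R perp y) = (c\<^sup>2 + s\<^sup>2) * (y \<bullet> y)" for c s
      by (simp add: inner_2 power2_eq_square algebra_simps)
    from this[of "cos \<theta>" "sin \<theta>"] show ?thesis by (simp add: norm_eq_sqrt_inner rot_def)
  qed
  ultimately show ?thesis by (simp add: orthogonal_transformation)
qed

lemma norm_rot [simp]: "norm (rot \<theta> y) = norm y"
  using orthogonal_rot by (simp add: orthogonal_transformation)

lemma norm_biot_savart: "norm (biot_savart x) = 1 / (2 * pi * norm x)"
  by (cases "x = 0") (simp_all add: biot_savart_def power2_eq_square field_simps)

lemma biot_savart_measurable [measurable]: "biot_savart \<in> borel_measurable borel"
proof -
  have [measurable]: "perp \<in> borel_measurable borel"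
    by (intro borel_measurable_continuous_onI linear_continuous_on bounded_linear_perp)
  show ?thesis unfolding biot_savart_def[abs_def] by measurable
qed

definition to_complex :: "real^2 \<Rightarrow> complex" where
  "to_complex x = Complex (x $ 1) (x $ 2)"

lemma to_complex_diff: "to_complex (x - y) = to_complex x - to_complex y"
  by (simp add: to_complex_def complex_eq_iff)

lemma to_complex_rot: "to_complex (rot \<theta> y) = exp (\<i> * of_real \<theta>) * to_complex y"
  by (simp add: to_complex_def rot_def complex_eq_iff Re_exp Im_exp algebra_simps)

lemma norm_to_complex: "norm (to_complex x) = norm x"
  by (simp add: to_complex_def norm_eq_sqrt_inner[of x] inner_2 power2_eq_square cmod_def)

text \<open>
  The real-linear map that turns \<open>1 / z\<close> into the velocity field of a point vortex.
\<close>

definition swap_vector :: "complex \<Rightarrow> real^2" where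
  "swap_vector w = (1 / (2 * pi)) *\<^sub>R vector [Im w, Re w]"

lemma bounded_linear_swap_vector: "bounded_linear swap_vector"
proof -
  have "linear swap_vector"
    unfolding swap_vector_def[abs_def] by (rule linearI) (simp_all add: vec_eq_iff forall_2 algebra_simps add_divide_distrib)
  then show ?thesis by (simp add: linear_conv_bounded_linear)
qed

lemma biot_savart_complex: "biot_savart x = swap_vector (1 / to_complex x)"
proof -
  have n: "(norm x)\<^sup>2 = (x $ 1)\<^sup>2 + (x $ 2)\<^sup>2"
    unfolding power2_norm_eq_inner by (simp only: inner_2 power2_eq_square)
  have "biot_savart x $ 1 = - (x $ 2) / (2 * pi * ((x $ 1)\<^sup>2 + (x $ 2)\<^sup>2))"
    and "biot_savart x $ 2 = x $ 1 / (2 * pi * ((x $ 1)\<^sup>2 + (x $ 2)\<^sup>2))"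
    unfolding biot_savart_def n by (simp_all only: vector_scaleR_component perp_component real_scaleR_def divide_inverse mult.commute)
  moreover have "Im (1 / to_complex x) = - (x $ 2) / ((x $ 1)\<^sup>2 + (x $ 2)\<^sup>2)"
    and "Re (1 / to_complex x) = x $ 1 / ((x $ 1)\<^sup>2 + (x $ 2)\<^sup>2)"
    unfolding to_complex_def by (simp_all add: Re_divide Im_divide)
  ultimately show ?thesis
    by (simp only: vec_eq_iff forall_2 swap_vector_def vector_scaleR_component vector_2 real_scaleR_def) simp
qed

text \<open>
  The function \<open>z \<mapsto> 1 / (X - z Y)\<close> is averaged over the unit circle. If \<open>\<bar>Y\<bar> < \<bar>X\<bar>\<close> it is
  holomorphic in the disc and Cauchy's formula evaluates it at \<open>0\<close>. If \<open>\<bar>Y\<bar> > \<bar>X\<bar>\<close>, then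
  \<open>1 / (z (X - z Y))\<close> is, by partial fractions, a difference of two Cauchy kernels with poles
  \<open>0\<close> and \<open>X / Y\<close> inside the circle, whose integrals cancel.
\<close>

lemma circle_average_inverse:
  fixes X Y :: complex
  assumes "X \<noteq> 0" "norm Y \<noteq> norm X"
  shows "((\<lambda>t. 1 / (X - exp (\<i> * of_real (2 * pi * t)) * Y)) has_integral
           (if norm Y < norm X then 1 / X else 0)) {0..1}"
proof -
  define f where "f z = 1 / (X - z * Y)" for z
  have ci: "((\<lambda>t. f (exp (2 * of_real pi * \<i> * of_real t))) has_integral w) {0..1}"
    if "((\<lambda>z. f z / z) has_contour_integral (2 * of_real pi * \<i> * w)) (circlepath 0 1)" for w
  proof -
    have "((\<lambda>t. f (circlepath 0 1 t) / circlepath 0 1 t * vector_derivative (circlepath 0 1) (at t within {0..1}))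
            has_integral (2 * of_real pi * \<i> * w)) {0..1}"
      using that by (simp add: has_contour_integral_def)
    then have "((\<lambda>t. (2 * of_real pi * \<i>) * f (exp (2 * of_real pi * \<i> * of_real t)))
            has_integral (2 * of_real pi * \<i> * w)) {0..1}"
      by (rule has_integral_eq[rotated]) (simp add: vector_derivative_circlepath01, simp add: circlepath)
    then have "((\<lambda>t. inverse (2 * of_real pi * \<i>) * ((2 * of_real pi * \<i>) * f (exp (2 * of_real pi * \<i> * of_real t))))
            has_integral (inverse (2 * of_real pi * \<i>) * (2 * of_real pi * \<i> * w))) {0..1}"
      by (rule has_integral_mult_right)
    then show ?thesis
      by (simp add: field_simps)
  qed
  have "((\<lambda>z. f z / z) has_contour_integral (2 * of_real pi * \<i> * (if norm Y < norm X then 1 / X else 0))) (circlepath 0 1)"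
  proof (cases "norm Y < norm X")
    case True
    have nz: "X - z * Y \<noteq> 0" if "z \<in> cball 0 1" for z
    proof
      assume "X - z * Y = 0"
      then have "norm X = norm z * norm Y" by (simp add: norm_mult)
      also have "\<dots> \<le> 1 * norm Y" using that by (intro mult_right_mono) auto
      finally show False using True by simp
    qed
    have "f holomorphic_on cball 0 1"
      unfolding f_def[abs_def] by (intro holomorphic_intros) (use nz in auto)
    from Cauchy_integral_circlepath_simple[OF this, of 0]
    show ?thesis using True by (simp add: f_def)
  next
    case False
    then have "norm Y > norm X" using assms(2) by simp
    then have Y: "Y \<noteq> 0" by auto
    have XY: "norm (X / Y) < 1" using \<open>norm Y > norm X\<close> Y by (simp add: norm_divide)
    have hol: "(\<lambda>z. 1) holomorphic_on cball (0::complex) 1" by simp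
    have "((\<lambda>u. 1 / X * (1 / (u - 0) - 1 / (u - X / Y))) has_contour_integral
        1 / X * (2 * of_real pi * \<i> * 1 - 2 * of_real pi * \<i> * 1)) (circlepath 0 1)"
      by (intro has_contour_integral_lmul has_contour_integral_diff
          Cauchy_integral_circlepath_simple[OF hol]) (use XY in auto)
    then have "((\<lambda>z. f z / z) has_contour_integral 1 / X * (2 * of_real pi * \<i> * 1 - 2 * of_real pi * \<i> * 1)) (circlepath 0 1)"
    proof (rule has_contour_integral_eq)
      fix z assume "z \<in> path_image (circlepath (0::complex) 1)"
      then have z: "norm z = 1" by simp
      then have "z \<noteq> 0" by auto
      moreover have "z \<noteq> X / Y" using z XY by auto
      ultimately show "1 / X * (1 / (z - 0) - 1 / (z - X / Y)) = f z / z"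
        using assms(1) Y by (simp add: f_def field_simps)
    qed
    then show ?thesis using False by simp
  qed
  from ci[OF this] show ?thesis
    by (simp add: f_def mult_ac)
qed

text \<open>
  In complex notation the Biot-Savart field is \<open>\<i> / (2\<pi>)\<close> times the conjugate of \<open>1 / z\<close>, so
  vorticity spread uniformly over a circle acts outside the circle as a point vortex at its
  centre, and does not act inside.
\<close>

lemma circle_average_biot_savart:
  assumes "x \<noteq> 0" "norm y \<noteq> norm x"
  shows "integrable lborel (\<lambda>t. indicator {0..1} t *\<^sub>R biot_savart (x - rot (2 * pi * t) y))" (is ?A)
    and "(LINT t|lborel. indicator {0..1} t *\<^sub>R biot_savart (x - rot (2 * pi * t) y)) =
      (if norm y < norm x then biot_savart x else 0)" (is ?B)
proof -
  let ?f = "\<lambda>t. biot_savart (x - rot (2 * pi * t) y)"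
  have X: "to_complex x \<noteq> 0" using assms(1) norm_to_complex[of x] by auto
  have nz: "x - rot \<theta> y \<noteq> 0" for \<theta>
    using norm_rot[of \<theta> y] assms(2) by auto
  have "continuous_on {0..1} ?f"
    unfolding biot_savart_def rot_def using nz[unfolded rot_def]
    by (intro continuous_intros bounded_linear.continuous_on[OF bounded_linear_perp]) auto
  then show ?A
    using borel_integrable_atLeastAtMost'[of 0 1 ?f] by (simp add: set_integrable_def)
  have "(?f has_integral (swap_vector (if norm y < norm x then 1 / to_complex x else 0))) {0..1}"
    using has_integral_linear[OF circle_average_inverse[OF X, of "to_complex y"] bounded_linear_swap_vector]
      assms(2) by (simp add: norm_to_complex o_def biot_savart_complex to_complex_diff to_complex_rot)
  also have "swap_vector (if norm y < norm x then 1 / to_complex x else 0) =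
      (if norm y < norm x then biot_savart x else 0)"
    using linear_0[OF bounded_linear.linear[OF bounded_linear_swap_vector]] by (simp add: biot_savart_complex)
  finally have "integral {0..1} ?f = (if norm y < norm x then biot_savart x else 0)"
    by (rule integral_unique)
  moreover have "set_integrable lborel {0..1} ?f"
    using \<open>?A\<close> by (simp add: set_integrable_def)
  ultimately show ?B
    using set_borel_integral_eq_integral(2)[of "{0..1}" ?f] by (simp add: set_lebesgue_integral_def)
qed

section \<open>Potential estimates for the Helmholtz kernel\<close>

definition cutoff :: "real \<Rightarrow> real" where "cutoff s = 1 - step (s - 1)"

lemma smooth_cutoff: "smooth cutoff"
  using smooth_diff[OF smooth_const smooth_affine[OF smooth_step bounded_linear_ident, of "-1"], of 1]
  by (simp add: cutoff_def[abs_def])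

lemma DERIV_cutoff: "(cutoff has_real_derivative - step' (s - 1)) (at s)"
  unfolding cutoff_def[abs_def]
  by (auto intro!: derivative_eq_intros DERIV_chain2[OF DERIV_step])

lemma DERIV_cutoff': "((\<lambda>s. - step' (s - 1)) has_real_derivative - step'' (s - 1)) (at s)"
  by (auto intro!: derivative_eq_intros DERIV_chain2[OF DERIV_step'])

lemma cutoff_simps [simp]: "s \<le> 1 \<Longrightarrow> cutoff s = 1" "s \<ge> 2 \<Longrightarrow> cutoff s = 0" "0 \<le> cutoff s" "cutoff s \<le> 1"
  by (simp_all add: cutoff_def)

locale helmholtz =
  fixes \<alpha> :: real and G :: "real^2 \<Rightarrow> real"
  assumes alpha_pos: "\<alpha> > 0" and helmholtz_kernel: "helmholtz_kernel \<alpha> G"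
begin

lemma G_integrable: "integrable lborel G"
  and G_integral: "(LINT x|lborel. G x) = 1"
  and G_radial: "norm x = norm y \<Longrightarrow> G x = G y"
  and G_pos: "x \<noteq> 0 \<Longrightarrow> G x > 0"
  and G_conv: "test_function \<psi> \<Longrightarrow> conv G (\<lambda>x. \<psi> x - \<alpha>\<^sup>2 * laplacian \<psi> x) = \<psi>"
  using helmholtz_kernel unfolding helmholtz_kernel_def by blast+

lemma G_measurable [measurable]: "G \<in> borel_measurable borel"
  using borel_measurable_integrable[OF G_integrable] by simp

lemma AE_G_nonneg: "AE y in lborel. 0 \<le> G y"
  using AE_lborel_singleton[of 0] by eventually_elim (use G_pos less_imp_le in blast)

lemma G_test:
  assumes "test_function \<psi>"
  shows "(LINT y|lborel. (\<psi> y - \<alpha>\<^sup>2 * laplacian \<psi> y) * G (x - y)) = \<psi> x"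
  using fun_cong[OF G_conv[OF assms], of x] by (simp add: conv_def)

lemma G_shift:
  shows "integrable lborel (\<lambda>y. G (x - y))" "(LINT y|lborel. G (x - y)) = 1"
    and "AE y in lborel. 0 \<le> G (x - y)"
proof -
  have m: "(\<lambda>y. x - y) \<in> lborel \<rightarrow>\<^sub>M borel" by measurable
  show "integrable lborel (\<lambda>y. G (x - y))"
    using integrable_distr_eq[OF m, of G] G_integrable distr_lborel_reflection[of x] by simp
  show "(LINT y|lborel. G (x - y)) = 1"
    using integral_distr[OF m, of G] G_integral distr_lborel_reflection[of x] by simp
  show "AE y in lborel. 0 \<le> G (x - y)"
    using AE_lborel_singleton[of x]
  proof eventually_elim
    case (elim y)
    then show ?case using G_pos[of "x - y"] by simp
  qed
qed

lemma continuous_laplacian: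
  assumes "smooth \<psi>" shows "continuous_on UNIV (laplacian \<psi>)"
  unfolding laplacian_def[abs_def]
  by (intro continuous_intros smooth_continuous smooth_derivative assms)

lemma laplacian_bounded:
  fixes \<psi> :: "'a::euclidean_space \<Rightarrow> real"
  assumes "test_function \<psi>" obtains B where "\<And>y. \<bar>laplacian \<psi> y\<bar> \<le> B"
proof -
  have "\<exists>B. \<forall>y. \<bar>frechet_derivative (\<lambda>y. frechet_derivative \<psi> (at y) b) (at y) b\<bar> \<le> B" for b
    using test_function_bounded[OF test_function_derivative[OF test_function_derivative[OF assms]], of b b] by metis
  then obtain B where B: "\<And>b y. \<bar>frechet_derivative (\<lambda>y. frechet_derivative \<psi> (at y) b) (at y) b\<bar> \<le> B b"
    by metis
  have "\<bar>laplacian \<psi> y\<bar> \<le> (\<Sum>b\<in>Basis. B b)" for y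
    unfolding laplacian_def by (rule order_trans[OF sum_abs sum_mono]) (rule B)
  then show ?thesis by (rule that)
qed

lemma G_test_integrable:
  fixes w :: "real^2 \<Rightarrow> real"
  assumes "w \<in> borel_measurable borel" "\<And>y. \<bar>w y\<bar> \<le> B"
  shows "integrable lborel (\<lambda>y. w y * G (x - y))"
proof (rule Bochner_Integration.integrable_bound)
  show "integrable lborel (\<lambda>y. B * G (x - y))"
    using G_shift(1)[of x] by simp
  show "(\<lambda>y. w y * G (x - y)) \<in> borel_measurable lborel" using assms(1) by measurable
  have "\<bar>w y\<bar> * \<bar>G (x - y)\<bar> \<le> \<bar>B\<bar> * \<bar>G (x - y)\<bar>" for y
    using assms(2)[of y] by (intro mult_right_mono) auto
  then show "AE y in lborel. norm (w y * G (x - y)) \<le> norm (B * G (x - y))"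
    by (simp add: abs_mult)
qed

text \<open>
  The identity \<open>G * (\<psi> - \<alpha>\<^sup>2 \<Delta>\<psi>) = \<psi>\<close> is evaluated at the origin for a cutoff \<open>\<psi>\<close> supported in
  the disc of radius \<open>r\<close>: since \<open>\<psi> 0 = 1\<close> and \<open>\<Delta>\<psi>\<close> is of order \<open>1 / r\<^sup>2\<close>, that disc carries all
  but a fraction \<open>O(1 / r\<^sup>2)\<close> of the total mass of \<open>G\<close>.
\<close>

lemma kernel_tail:
  "\<exists>D>0. \<forall>r>0. 1 - (LINT y:{y. norm y < r}|lborel. G y) \<le> D / r\<^sup>2"
proof -
  obtain B where B: "B > 0" "\<And>s. \<bar>step' s\<bar> \<le> B" "\<And>s. \<bar>step'' s\<bar> \<le> B"
    using step_derivative_bounds by metis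
  have "1 - (LINT y:{y. norm y < r}|lborel. G y) \<le> (\<alpha>\<^sup>2 * 24 * B) / r\<^sup>2" if "r > 0" for r
  proof -
    define R where "R = r\<^sup>2 / 2"
    have R: "R > 0" using that by (simp add: R_def)
    define \<psi> :: "real^2 \<Rightarrow> real" where "\<psi> y = cutoff ((norm y)\<^sup>2 / R)" for y
    have sm: "smooth \<psi>"
      using smooth_compose_real[OF smooth_cutoff smooth_mult[OF smooth_norm_square smooth_const], of "1 / R"]
      by (simp add: \<psi>_def[abs_def])
    have zero: "\<psi> y = 0" if "norm y \<ge> r" for y
    proof -
      have "(norm y)\<^sup>2 \<ge> 2 * R" using that \<open>r > 0\<close> by (simp add: R_def power_mono)
      then show ?thesis using R by (simp add: \<psi>_def pos_le_divide_eq)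
    qed
    have test: "test_function \<psi>"
      by (rule test_functionI[OF sm, of r]) (use zero in auto)
    have d0: "((\<lambda>s. s / R) has_real_derivative 1 / R) (at s)" for s
      using R by (auto intro!: derivative_eq_intros)
    have d1: "((\<lambda>s. cutoff (s / R)) has_real_derivative - step' (s / R - 1) / R) (at s)" for s
      using DERIV_chain2[OF DERIV_cutoff d0, of s] by simp
    have d2: "((\<lambda>s. - step' (s / R - 1) / R) has_real_derivative - step'' (s / R - 1) / R\<^sup>2) (at s)" for s
      using DERIV_cdivide[OF DERIV_chain2[OF DERIV_cutoff' d0, of s], of R] by (simp add: power2_eq_square)
    have lap: "laplacian \<psi> y = 4 * (- step' ((norm y)\<^sup>2 / R - 1) / R)
        + 4 * (norm y)\<^sup>2 * (- step'' ((norm y)\<^sup>2 / R - 1) / R\<^sup>2)" for y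
      unfolding \<psi>_def[abs_def] by (subst radial_laplacian[OF d1 d2]) simp
    have lapb: "\<bar>laplacian \<psi> y\<bar> \<le> 12 * B / R" for y
    proof (cases "(norm y)\<^sup>2 \<le> 2 * R")
      case True
      have "\<bar>laplacian \<psi> y\<bar> \<le> 4 * (\<bar>step' ((norm y)\<^sup>2 / R - 1)\<bar> / R) + 4 * (norm y)\<^sup>2 * (\<bar>step'' ((norm y)\<^sup>2 / R - 1)\<bar> / R\<^sup>2)"
        unfolding lap by (rule order_trans[OF abs_triangle_ineq]) (use R in \<open>simp add: abs_mult\<close>)
      also have "\<dots> \<le> 4 * (B / R) + 4 * (2 * R) * (B / R\<^sup>2)"
        using True R B by (intro add_mono mult_mono divide_right_mono) auto
      also have "\<dots> = 12 * B / R" using R by (simp add: power2_eq_square field_simps)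
      finally show ?thesis .
    next
      case False
      then have "(norm y)\<^sup>2 / R - 1 > 1" using R by (simp add: pos_less_divide_eq)
      then show ?thesis using B(1) R unfolding lap by (simp add: step'_eq_0 step''_eq_0)
    qed
    have psi01: "0 \<le> \<psi> y" "\<psi> y \<le> 1" for y by (simp_all add: \<psi>_def)
    have [measurable]: "\<psi> \<in> borel_measurable borel" "laplacian \<psi> \<in> borel_measurable borel"
      by (auto intro!: borel_measurable_continuous_onI smooth_continuous[OF sm] continuous_laplacian[OF sm])
    have i1: "integrable lborel (\<lambda>y. \<psi> y * G (0 - y))"
      by (rule G_test_integrable[where B = 1]) (use psi01 in auto)
    have i2: "integrable lborel (\<lambda>y. laplacian \<psi> y * G (0 - y))"
      by (rule G_test_integrable[where B = "12 * B / R"]) (use lapb in auto)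
    have "1 = \<psi> 0" using R by (simp add: \<psi>_def)
    also have "\<dots> = (LINT y|lborel. (\<psi> y - \<alpha>\<^sup>2 * laplacian \<psi> y) * G (0 - y))"
      by (rule G_test[OF test, symmetric])
    also have "\<dots> = (LINT y|lborel. \<psi> y * G (0 - y)) - \<alpha>\<^sup>2 * (LINT y|lborel. laplacian \<psi> y * G (0 - y))"
      using i1 i2 by (simp add: left_diff_distrib mult.assoc)
    also have "\<dots> \<le> (LINT y|lborel. indicator {y. norm y < r} y * G y) + \<alpha>\<^sup>2 * (12 * B / R)"
    proof -
      have "(LINT y|lborel. \<psi> y * G (0 - y)) \<le> (LINT y|lborel. indicator {y. norm y < r} y * G y)"
      proof (rule integral_mono_AE[OF i1])
        show "integrable lborel (\<lambda>y. indicator {y. norm y < r} y * G y)"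
          using integrable_mult_indicator[of "{y. norm y < r}" lborel G] G_integrable by simp
        show "AE y in lborel. \<psi> y * G (0 - y) \<le> indicator {y. norm y < r} y * G y"
          using AE_G_nonneg
        proof eventually_elim
          case (elim y)
          have "G (0 - y) = G y" by (rule G_radial) simp
          then show ?case
            using zero[of y] psi01[of y] elim by (auto simp: indicator_def intro: mult_left_le_one_le)
        qed
      qed
      moreover have "- (LINT y|lborel. laplacian \<psi> y * G (0 - y)) \<le> 12 * B / R"
      proof -
        have "(LINT y|lborel. - (laplacian \<psi> y * G (0 - y))) \<le> (LINT y|lborel. 12 * B / R * G (0 - y))"
        proof (rule integral_mono_AE)
          show "integrable lborel (\<lambda>y. 12 * B / R * G (0 - y))" using G_shift(1)[of 0] by simp
          show "AE y in lborel. - (laplacian \<psi> y * G (0 - y)) \<le> 12 * B / R * G (0 - y)"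
            using G_shift(3)[of 0]
          proof eventually_elim
            case (elim y)
            then show ?case
              using mult_right_mono[of "- laplacian \<psi> y" "12 * B / R" "G (0 - y)"] lapb[of y] by simp
          qed
        qed (use i2 in simp)
        also have "\<dots> = 12 * B / R" using G_shift(2)[of 0] by simp
        finally show ?thesis by simp
      qed
      ultimately show ?thesis
        using mult_left_mono[of "- (LINT y|lborel. laplacian \<psi> y * G (0 - y))" "12 * B / R" "\<alpha>\<^sup>2"] by simp
    qed
    finally show ?thesis
      using R by (simp add: set_lebesgue_integral_def R_def)
  qed
  moreover have "\<alpha>\<^sup>2 * 24 * B > 0" using alpha_pos B by simp
  ultimately show ?thesis by blast
qed


text \<open>
  Near the origin, \<open>sqrt (\<bar>y\<bar>\<^sup>2 + e)\<close> has a Laplacian above \<open>1 / sqrt (\<bar>y\<bar>\<^sup>2 + e)\<close>. For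
  \<open>\<psi> = - cutoff * sqrt (\<bar>y\<bar>\<^sup>2 + e)\<close> this makes \<open>\<psi> - \<alpha>\<^sup>2 \<Delta>\<psi>\<close> dominate \<open>\<alpha>\<^sup>2 / sqrt (\<bar>y\<bar>\<^sup>2 + e)\<close>, up to
  a bounded error that does not depend on \<open>e\<close>, whereas its convolution with \<open>G\<close> is \<open>\<psi> \<le> 0\<close>.
  Letting \<open>e\<close> tend to zero bounds the singular integral at every point \<open>x\<close>; it will be needed
  wherever the convolution \<open>K * G\<close> must converge absolutely, not merely almost everywhere.
\<close>

lemma kernel_local_potential:
  "\<exists>C>0. \<forall>x. (\<integral>\<^sup>+y. ennreal (indicator {y. norm y < 1} y * (G (x - y) / norm y)) \<partial>lborel) \<le> ennreal C"
proof -
  obtain B where B: "B > 0" "\<And>s. \<bar>step' s\<bar> \<le> B" "\<And>s. \<bar>step'' s\<bar> \<le> B"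
    using step_derivative_bounds by metis
  define C where "C = 2 + \<alpha>\<^sup>2 * (32 * B + 12)"
  have Cpos: "C > 0" using B(1) by (simp add: C_def add_pos_nonneg)
  \<comment> \<open>The regularized singularity, with a bound independent of \<open>e\<close>.\<close>
  have main: "(LINT y|lborel. indicator {y. norm y < 1} y * ((norm y)\<^sup>2 + e) powr (-(1/2)) * G (x - y)) \<le> C / \<alpha>\<^sup>2"
    (is "(LINT y|lborel. ?w y * G (x - y)) \<le> _")
    and main_integrable: "integrable lborel (\<lambda>y. indicator {y. norm y < 1} y * ((norm y)\<^sup>2 + e) powr (-(1/2)) * G (x - y))"
    if e: "0 < e" "e \<le> 1" for e x
  proof -
    define \<psi> :: "real^2 \<Rightarrow> real" where "\<psi> y = - (cutoff ((norm y)\<^sup>2) * ((norm y)\<^sup>2 + e) powr (1/2))" for y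
    have w_pos: "0 < s + e" if "s \<ge> 0" for s using that e by simp
    have sm: "smooth \<psi>"
      unfolding \<psi>_def[abs_def]
      by (intro smooth_minus smooth_mult smooth_compose_real[OF smooth_cutoff smooth_norm_square]
          smooth_powr smooth_add smooth_norm_square smooth_const w_pos) simp
    have zero: "\<psi> y = 0" if "norm y \<ge> 2" for y
    proof -
      have "(norm y)\<^sup>2 \<ge> 2\<^sup>2" using that by (intro power_mono) auto
      then show ?thesis by (simp add: \<psi>_def)
    qed
    have test: "test_function \<psi>"
      by (rule test_functionI[OF sm, of 2]) (use zero in auto)
    define p' where "p' s = - (- step' (s - 1) * (s + e) powr (1/2) + cutoff s * (1/2 * (s + e) powr (-(1/2))))" for s
    define p'' where "p'' s = - (- step'' (s - 1) * (s + e) powr (1/2) - step' (s - 1) * (s + e) powr (-(1/2))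
       - cutoff s * (1/4 * (s + e) powr (-(3/2))))" for s
    have d1: "((\<lambda>s. - (cutoff s * (s + e) powr (1/2))) has_real_derivative p' s) (at s)" if "s \<ge> 0" for s
      using w_pos[OF that] unfolding p'_def
      by (auto intro!: derivative_eq_intros DERIV_cutoff)
    have d2: "(p' has_real_derivative p'' s) (at s)" if "s \<ge> 0" for s
      using w_pos[OF that] unfolding p'_def[abs_def] p''_def
      by (auto intro!: derivative_eq_intros DERIV_cutoff DERIV_chain2[OF DERIV_step'] simp: field_simps)
    have lap: "laplacian \<psi> y = 4 * p' ((norm y)\<^sup>2) + 4 * (norm y)\<^sup>2 * p'' ((norm y)\<^sup>2)" for y
      unfolding \<psi>_def[abs_def]
      by (subst radial_laplacian[where p' = p' and p'' = p'']) (use d1 d2 in auto)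
    \<comment> \<open>Inside the unit disc the cutoff is constant, so only the Laplacian of the square root remains.\<close>
    have near: "\<psi> y - \<alpha>\<^sup>2 * laplacian \<psi> y \<ge> \<alpha>\<^sup>2 * ?w y - C" if "norm y < 1" for y
    proof -
      define s where "s = (norm y)\<^sup>2"
      have s: "0 \<le> s" "s < 1" using that by (auto simp: s_def power_less_one_iff)
      note w = w_pos[OF s(1)]
      have "step'' (s - 1) = 0" "step' (s - 1) = 0" using s by (auto intro!: step''_eq_0 step'_eq_0)
      then have "laplacian \<psi> y = - (2 * (s + e) powr (-(1/2))) + s * (s + e) powr (-(3/2))"
        unfolding lap s_def[symmetric] p'_def p''_def using s by simp
      also have "s * (s + e) powr (-(3/2)) \<le> (s + e) * (s + e) powr (-(3/2))"
        using e by (intro mult_right_mono) auto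
      also have "\<dots> = (s + e) powr (-(1/2))"
        using w powr_add[of "s + e" 1 "-(3/2)"] by simp
      finally have "laplacian \<psi> y \<le> - ((s + e) powr (-(1/2)))" by simp
      then have 1: "\<alpha>\<^sup>2 * laplacian \<psi> y \<le> \<alpha>\<^sup>2 * (- ((s + e) powr (-(1/2))))"
        by (intro mult_left_mono) auto
      have "(s + e) powr (1/2) \<le> 4 powr (1/2)"
        using s e w by (intro powr_mono2) auto
      also have "(4::real) powr (1/2) = 2" by (simp add: powr_half_sqrt)
      finally have "\<psi> y \<ge> - 2" unfolding \<psi>_def s_def[symmetric] using s by simp
      moreover have "C \<ge> 2" using B(1) by (simp add: C_def)
      ultimately show ?thesis using 1 that by (simp add: s_def)
    qed
    \<comment> \<open>In the annulus where the cutoff varies, everything is bounded independently of \<open>e\<close>.\<close>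
    have far: "\<psi> y - \<alpha>\<^sup>2 * laplacian \<psi> y \<ge> - C" if "norm y \<ge> 1" for y
    proof -
      define s where "s = (norm y)\<^sup>2"
      have s: "1 \<le> s" using that by (simp add: s_def)
      show ?thesis
      proof (cases "s \<le> 2")
        case True
        have w1: "(s + e) powr (1/2) \<le> 2"
        proof -
          have "(s + e) powr (1/2) \<le> 4 powr (1/2)"
            using s e True by (intro powr_mono2) auto
          also have "(4::real) powr (1/2) = 2" by (simp add: powr_half_sqrt)
          finally show ?thesis .
        qed
        have w2: "(s + e) powr (-(1/2)) \<le> 1" "(s + e) powr (-(3/2)) \<le> 1"
          using s e powr_mono2'[of "-(1/2)" 1 "s + e"] powr_mono2'[of "-(3/2)" 1 "s + e"] by auto
        have c: "\<bar>cutoff s\<bar> \<le> 1" by simp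
        have "\<bar>p' s\<bar> \<le> B * 2 + 1 * (1/2 * 1)"
          unfolding p'_def abs_minus_cancel
          by (rule order_trans[OF abs_triangle_ineq])
             (auto simp: abs_mult intro!: add_mono mult_le_one mult_mono B w1 w2 c less_imp_le[OF B(1)])
        moreover have "\<bar>p'' s\<bar> \<le> (B * 2 + B * 1) + 1 * (1/4 * 1)"
        proof -
          have "\<bar>step'' (s - 1) * (s + e) powr (1/2)\<bar> \<le> B * 2"
            and "\<bar>step' (s - 1) * (s + e) powr (-(1/2))\<bar> \<le> B * 1"
            and "\<bar>cutoff s * (1/4 * (s + e) powr (-(3/2)))\<bar> \<le> 1 * (1/4 * 1)"
            unfolding abs_mult by (intro mult_mono B w1 w2 c; use w1 w2 B(1) in simp)+
          then show ?thesis unfolding p''_def by linarith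
        qed
        moreover have "\<bar>s * p'' s\<bar> \<le> 2 * \<bar>p'' s\<bar>"
          using True s by (simp add: abs_mult mult_right_mono)
        moreover have "laplacian \<psi> y = 4 * p' s + 4 * (s * p'' s)"
          unfolding lap s_def by simp
        ultimately have "laplacian \<psi> y \<le> 32 * B + 12" by linarith
        then have "\<alpha>\<^sup>2 * laplacian \<psi> y \<le> \<alpha>\<^sup>2 * (32 * B + 12)" by (intro mult_left_mono) auto
        moreover have "\<psi> y \<ge> - 2"
          using mult_mono[of "cutoff s" 1 "(s + e) powr (1/2)" 2] w1
          unfolding \<psi>_def s_def[symmetric] by simp
        ultimately show ?thesis by (simp add: C_def)
      next
        case False
        then have "laplacian \<psi> y = 0" "\<psi> y = 0"
          unfolding lap \<psi>_def s_def[symmetric] by (simp_all add: p'_def p''_def step'_eq_0 step''_eq_0)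
        then show ?thesis using Cpos by simp
      qed
    qed
    have ineq: "\<alpha>\<^sup>2 * ?w y - C \<le> \<psi> y - \<alpha>\<^sup>2 * laplacian \<psi> y" for y
      using near[of y] far[of y] by (cases "norm y < 1") (auto simp: indicator_def)
    have [measurable]: "\<psi> \<in> borel_measurable borel" "laplacian \<psi> \<in> borel_measurable borel"
      by (auto intro!: borel_measurable_continuous_onI smooth_continuous[OF sm] continuous_laplacian[OF sm])
    have wb: "\<bar>?w y\<bar> \<le> e powr (-(1/2))" for y
      using e by (auto simp: indicator_def intro!: powr_mono2')
    show iw: "integrable lborel (\<lambda>y. ?w y * G (x - y))"
      by (rule G_test_integrable[OF _ wb]) measurable
    obtain B1 where B1: "\<And>y. \<bar>\<psi> y\<bar> \<le> B1" using test_function_bounded[OF test] by metis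
    obtain B2 where B2: "\<And>y. \<bar>laplacian \<psi> y\<bar> \<le> B2" using laplacian_bounded[OF test] by metis
    have i1: "integrable lborel (\<lambda>y. \<psi> y * G (x - y))" by (rule G_test_integrable[OF _ B1]) measurable
    have i2: "integrable lborel (\<lambda>y. laplacian \<psi> y * G (x - y))" by (rule G_test_integrable[OF _ B2]) measurable
    have "\<alpha>\<^sup>2 * (LINT y|lborel. ?w y * G (x - y)) - C * 1 = (LINT y|lborel. (\<alpha>\<^sup>2 * ?w y - C) * G (x - y))"
      using iw G_shift(1,2)[of x] by (simp add: left_diff_distrib mult.assoc)
    also have "\<dots> \<le> (LINT y|lborel. (\<psi> y - \<alpha>\<^sup>2 * laplacian \<psi> y) * G (x - y))"
    proof (rule integral_mono_AE)
      show "integrable lborel (\<lambda>y. (\<alpha>\<^sup>2 * ?w y - C) * G (x - y))"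
        using iw G_shift(1)[of x] by (simp add: left_diff_distrib mult.assoc)
      show "integrable lborel (\<lambda>y. (\<psi> y - \<alpha>\<^sup>2 * laplacian \<psi> y) * G (x - y))"
        using i1 i2 by (simp add: left_diff_distrib mult.assoc)
      show "AE y in lborel. (\<alpha>\<^sup>2 * ?w y - C) * G (x - y) \<le> (\<psi> y - \<alpha>\<^sup>2 * laplacian \<psi> y) * G (x - y)"
        using G_shift(3)[of x] by eventually_elim (intro mult_right_mono ineq)
    qed
    also have "\<dots> = \<psi> x" by (rule G_test[OF test])
    also have "\<dots> \<le> 0" by (simp add: \<psi>_def)
    finally show "(LINT y|lborel. ?w y * G (x - y)) \<le> C / \<alpha>\<^sup>2"
      using alpha_pos by (simp add: field_simps)
  qed
  have "(\<integral>\<^sup>+y. ennreal (indicator {y. norm y < 1} y * (G (x - y) / norm y)) \<partial>lborel) \<le> ennreal (C / \<alpha>\<^sup>2)" for x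
  proof -
    define e where "e n = 1 / real (Suc n)" for n
    have e: "0 < e n" "e n \<le> 1" for n by (auto simp: e_def)
    have elim: "e \<longlonglongrightarrow> 0" unfolding e_def by (rule LIMSEQ_Suc[OF lim_1_over_n, THEN filterlim_cong[THEN iffD1, rotated -1]]) auto
    let ?h = "\<lambda>n y. ennreal (indicator {y. norm y < 1} y * ((norm y)\<^sup>2 + e n) powr (-(1/2)) * G (x - y))"
    have "(\<integral>\<^sup>+y. ennreal (indicator {y. norm y < 1} y * (G (x - y) / norm y)) \<partial>lborel)
        = (\<integral>\<^sup>+y. liminf (\<lambda>n. ?h n y) \<partial>lborel)"
    proof (rule nn_integral_cong_AE)
      show "AE y in lborel. ennreal (indicator {y. norm y < 1} y * (G (x - y) / norm y)) = liminf (\<lambda>n. ?h n y)"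
        using AE_lborel_singleton[of 0]
      proof eventually_elim
        case (elim y)
        then have pos: "norm y > 0" by simp
        have "(\<lambda>n. ((norm y)\<^sup>2 + e n) powr (-(1/2))) \<longlonglongrightarrow> ((norm y)\<^sup>2 + 0) powr (-(1/2))"
          using pos by (intro tendsto_powr tendsto_add tendsto_const \<open>e \<longlonglongrightarrow> 0\<close>) auto
        also have "((norm y)\<^sup>2 + 0) powr (-(1/2)) = 1 / norm y"
          by (simp only: add_0_right powr_minus powr_half_sqrt[OF zero_le_power2] real_sqrt_abs
              abs_norm_cancel inverse_eq_divide)
        finally have "(\<lambda>n. ?h n y) \<longlonglongrightarrow> ennreal (indicator {y. norm y < 1} y * (1 / norm y) * G (x - y))"
          by (intro tendsto_ennrealI tendsto_mult tendsto_const)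
        from lim_imp_Liminf[OF _ this] show ?case by simp
      qed
    qed
    also have "\<dots> \<le> liminf (\<lambda>n. \<integral>\<^sup>+y. ?h n y \<partial>lborel)"
      by (rule nn_integral_liminf) measurable
    also have "\<dots> \<le> ennreal (C / \<alpha>\<^sup>2)"
    proof (rule Liminf_le)
      have "(\<integral>\<^sup>+y. ?h n y \<partial>lborel) = ennreal (LINT y|lborel. indicator {y. norm y < 1} y * ((norm y)\<^sup>2 + e n) powr (-(1/2)) * G (x - y))" for n
        by (rule nn_integral_eq_integral[OF main_integrable[OF e]])
           (use G_shift(3)[of x] in \<open>eventually_elim; auto\<close>)
      then show "\<forall>\<^sub>F n in sequentially. (\<integral>\<^sup>+y. ?h n y \<partial>lborel) \<le> ennreal (C / \<alpha>\<^sup>2)"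
        by (intro always_eventually allI) (simp only: ennreal_leI main[OF e])
    qed simp
    finally show ?thesis .
  qed
  moreover have "C / \<alpha>\<^sup>2 > 0" using Cpos alpha_pos by simp
  ultimately show ?thesis by blast
qed


end

section \<open>Newton's theorem for the filtered kernel\<close>

context helmholtz
begin

lemma kernel_potential:
  "\<exists>C>0. \<forall>x. (\<integral>\<^sup>+y. ennreal (G y / norm (x - y)) \<partial>lborel) \<le> ennreal C"
proof -
  obtain C where C: "C > 0"
    "\<And>x. (\<integral>\<^sup>+y. ennreal (indicator {y. norm y < 1} y * (G (x - y) / norm y)) \<partial>lborel) \<le> ennreal C"
    using kernel_local_potential by blast
  have "(\<integral>\<^sup>+y. ennreal (G y / norm (x - y)) \<partial>lborel) \<le> ennreal (C + 1)" for x
  proof -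
    have "(\<integral>\<^sup>+y. ennreal (G y / norm (x - y)) \<partial>lborel)
        = (\<integral>\<^sup>+y. ennreal (G y / norm (x - y)) \<partial>(distr lborel borel (\<lambda>y. x - y)))"
      by (simp add: distr_lborel_reflection)
    also have "\<dots> = (\<integral>\<^sup>+y. ennreal (G (x - y) / norm y) \<partial>lborel)"
      by (subst nn_integral_distr) simp_all
    also have "\<dots> \<le> (\<integral>\<^sup>+y. ennreal (indicator {y. norm y < 1} y * (G (x - y) / norm y)) + ennreal (G (x - y)) \<partial>lborel)"
    proof (rule nn_integral_mono_AE)
      show "AE y in lborel. ennreal (G (x - y) / norm y)
          \<le> ennreal (indicator {y. norm y < 1} y * (G (x - y) / norm y)) + ennreal (G (x - y))"
        using G_shift(3)[of x]
      proof eventually_elim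
        case (elim y)
        have "G (x - y) / norm y \<le> G (x - y) / 1" if "norm y \<ge> 1"
          using that elim by (intro divide_left_mono) auto
        then show ?case
          by (cases "norm y < 1") (auto intro!: ennreal_leI)
      qed
    qed
    also have "\<dots> = (\<integral>\<^sup>+y. ennreal (indicator {y. norm y < 1} y * (G (x - y) / norm y)) \<partial>lborel)
        + (\<integral>\<^sup>+y. ennreal (G (x - y)) \<partial>lborel)"
      by (rule nn_integral_add) measurable
    also have "(\<integral>\<^sup>+y. ennreal (G (x - y)) \<partial>lborel) = ennreal 1"
      using nn_integral_eq_integral[OF G_shift(1,3)[of x]] G_shift(2)[of x] by simp
    also have "(\<integral>\<^sup>+y. ennreal (indicator {y. norm y < 1} y * (G (x - y) / norm y)) \<partial>lborel) + ennreal 1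
        \<le> ennreal C + ennreal 1"
      by (intro add_right_mono C)
    also have "\<dots> = ennreal (C + 1)" using C(1) by (simp add: ennreal_plus)
    finally show ?thesis .
  qed
  moreover have "C + 1 > 0" using C(1) by simp
  ultimately show ?thesis by blast
qed

definition enclosed :: "real \<Rightarrow> real" where
  "enclosed r = (LINT y|lborel. indicator {y. norm y < r} y * G y)"

lemma enclosed_integrable: "integrable lborel (\<lambda>y. indicator {y. norm y < r} y * G y)"
  using integrable_mult_indicator[of "{y. norm y < r}" lborel G] G_integrable by simp

lemma enclosed_nonneg: "0 \<le> enclosed r"
  unfolding enclosed_def
  by (rule integral_nonneg_AE) (use AE_G_nonneg in \<open>eventually_elim; auto simp: indicator_def\<close>)

lemma enclosed_mono: "r \<le> s \<Longrightarrow> enclosed r \<le> enclosed s"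
  unfolding enclosed_def
  by (rule integral_mono_AE[OF enclosed_integrable enclosed_integrable])
     (use AE_G_nonneg in \<open>eventually_elim; auto simp: indicator_def\<close>)

lemma enclosed_le_1: "enclosed r \<le> 1"
  unfolding enclosed_def G_integral[symmetric]
  by (rule integral_mono_AE[OF enclosed_integrable G_integrable])
     (use AE_G_nonneg in \<open>eventually_elim; auto simp: indicator_def\<close>)

lemma enclosed_tail: "\<exists>D>0. \<forall>r>0. 1 - enclosed r \<le> D / r\<^sup>2"
  using kernel_tail by (simp add: enclosed_def set_lebesgue_integral_def)

lemma biot_savart_G_integrable:
  "integrable lborel (\<lambda>y. G y *\<^sub>R biot_savart (x - y))"
  and biot_savart_G_bound: "\<exists>B>0. \<forall>x. (LINT y|lborel. norm (G y *\<^sub>R biot_savart (x - y))) \<le> B"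
proof -
  obtain C where C: "C > 0" "\<And>x. (\<integral>\<^sup>+y. ennreal (G y / norm (x - y)) \<partial>lborel) \<le> ennreal C"
    using kernel_potential by metis
  have le: "(\<integral>\<^sup>+y. ennreal (norm (G y *\<^sub>R biot_savart (x - y))) \<partial>lborel) \<le> ennreal C" for x
  proof -
    have "(\<integral>\<^sup>+y. ennreal (norm (G y *\<^sub>R biot_savart (x - y))) \<partial>lborel) \<le> (\<integral>\<^sup>+y. ennreal (G y / norm (x - y)) \<partial>lborel)"
    proof (rule nn_integral_mono_AE)
      show "AE y in lborel. ennreal (norm (G y *\<^sub>R biot_savart (x - y))) \<le> ennreal (G y / norm (x - y))"
        using AE_G_nonneg
      proof eventually_elim
        case (elim y)
        have "1 / (2 * pi * norm (x - y)) \<le> 1 / norm (x - y)"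
          using pi_gt3 by (cases "x = y") (auto simp: field_simps intro!: mult_left_le[of _ "norm (x - y)", simplified])
        then have "G y * (1 / (2 * pi * norm (x - y))) \<le> G y * (1 / norm (x - y))"
          using elim by (intro mult_left_mono)
        then show ?case using elim by (intro ennreal_leI) (simp add: norm_biot_savart)
      qed
    qed
    then show ?thesis using C(2) order_trans by blast
  qed
  show i: "integrable lborel (\<lambda>y. G y *\<^sub>R biot_savart (x - y))" for x
    using le_less_trans[OF le[of x]] by (intro integrableI_bounded) auto
  have "(LINT y|lborel. norm (G y *\<^sub>R biot_savart (x - y))) \<le> C" for x
  proof -
    have "ennreal (LINT y|lborel. norm (G y *\<^sub>R biot_savart (x - y))) \<le> ennreal C"
      using nn_integral_eq_integral[OF integrable_norm[OF i[of x]]] le[of x] by simp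
    then show ?thesis using C(1) by (simp add: ennreal_le_iff)
  qed
  then show "\<exists>B>0. \<forall>x. (LINT y|lborel. norm (G y *\<^sub>R biot_savart (x - y))) \<le> B" using C(1) by blast
qed

lemma G_rotate:
  fixes h :: "real^2 \<Rightarrow> 'b::{banach, second_countable_topology}"
  assumes [measurable]: "h \<in> borel_measurable borel"
  shows "integrable lborel (\<lambda>y. G y *\<^sub>R h y) \<Longrightarrow> integrable lborel (\<lambda>y. G y *\<^sub>R h (rot \<theta> y))"
    and "(LINT y|lborel. G y *\<^sub>R h (rot \<theta> y)) = (LINT y|lborel. G y *\<^sub>R h y)"
proof -
  have d: "distr lborel borel (rot \<theta>) = lborel" by (rule distr_lborel_orthogonal[OF orthogonal_rot])
  have [measurable]: "rot \<theta> \<in> borel_measurable borel"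
    by (intro borel_measurable_continuous_onI linear_continuous_on linear_conv_bounded_linear[THEN iffD1]
        orthogonal_transformation_linear orthogonal_rot)
  have G: "G (rot \<theta> y) = G y" for y by (rule G_radial) simp
  have m: "rot \<theta> \<in> lborel \<rightarrow>\<^sub>M borel" by simp
  have mh: "(\<lambda>y. G y *\<^sub>R h y) \<in> borel_measurable borel" by measurable
  show "integrable lborel (\<lambda>y. G y *\<^sub>R h (rot \<theta> y))" if "integrable lborel (\<lambda>y. G y *\<^sub>R h y)"
    using integrable_distr_eq[OF m mh] that unfolding d G by blast
  show "(LINT y|lborel. G y *\<^sub>R h (rot \<theta> y)) = (LINT y|lborel. G y *\<^sub>R h y)"
    using integral_distr[OF m mh] unfolding d G by simp
qed

text \<open>
  Rotations do not change \<open>G\<close>, so \<open>K * G\<close> is the integral of \<open>G\<close> against the average of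
  \<open>biot_savart (x - y)\<close> over the circle through \<open>y\<close>. That average vanishes for \<open>\<bar>y\<bar> > \<bar>x\<bar>\<close> and
  is \<open>biot_savart x\<close> for \<open>\<bar>y\<bar> < \<bar>x\<bar>\<close>; the circle \<open>\<bar>y\<bar> = \<bar>x\<bar>\<close> is a null set. The exchange of the
  two integrals rests on the potential bound at the given point \<open>x\<close>.
\<close>

lemma filtered_kernel_newton:
  assumes "x \<noteq> 0"
  shows "filtered_kernel G x = enclosed (norm x) *\<^sub>R biot_savart x"
proof -
  define F where "F = (\<lambda>(t, y). indicator {0..1} t *\<^sub>R (G y *\<^sub>R biot_savart (x - rot (2 * pi * t) y)))"
  have cont: "continuous_on UNIV (\<lambda>p. rot (2 * pi * fst p) (snd p))"
    unfolding rot_def by (intro continuous_intros bounded_linear.continuous_on[OF bounded_linear_perp])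
  have "(\<lambda>p. rot (2 * pi * fst p) (snd p)) \<in> borel_measurable (borel \<Otimes>\<^sub>M borel)"
    using borel_measurable_continuous_onI[OF cont] by (simp add: borel_prod)
  then have [measurable]: "(\<lambda>(t, y). rot (2 * pi * t) y) \<in> borel_measurable (borel \<Otimes>\<^sub>M borel)"
    by (simp add: case_prod_beta')
  have [measurable]: "F \<in> borel_measurable (borel \<Otimes>\<^sub>M borel)" unfolding F_def by measurable
  have Fm: "F \<in> borel_measurable (lborel \<Otimes>\<^sub>M lborel)"
    using \<open>F \<in> borel_measurable (borel \<Otimes>\<^sub>M borel)\<close> by (simp cong: measurable_cong_sets)
  let ?h = "\<lambda>y. biot_savart (x - y)"
  have hm: "?h \<in> borel_measurable borel" by measurable
  define N where "N = (LINT y|lborel. G y *\<^sub>R biot_savart (x - y))"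
  have iy: "integrable lborel (\<lambda>y. F (t, y))" for t
    unfolding F_def prod.case
    by (intro integrable_scaleR_right G_rotate(1)[OF hm biot_savart_G_integrable, of "2 * pi * t"])
  have vy: "(LINT y|lborel. F (t, y)) = indicator {0..1} t *\<^sub>R N" for t
    unfolding F_def prod.case integral_scaleR_right G_rotate(2)[OF hm, of "2 * pi * t"] N_def ..
  have ny: "(LINT y|lborel. norm (F (t, y))) = indicator {0..1} t *\<^sub>R (LINT y|lborel. norm (G y *\<^sub>R biot_savart (x - y)))" for t
  proof -
    have "(LINT y|lborel. norm (G y *\<^sub>R biot_savart (x - rot (2 * pi * t) y)))
        = (LINT y|lborel. G y *\<^sub>R (norm (biot_savart (x - rot (2 * pi * t) y))))"
      by (rule integral_cong_AE) (use AE_G_nonneg in \<open>auto elim!: eventually_mono\<close>)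
    also have "\<dots> = (LINT y|lborel. G y *\<^sub>R norm (biot_savart (x - y)))"
      by (rule G_rotate(2)[of "\<lambda>y. norm (biot_savart (x - y))"]) measurable
    also have "\<dots> = (LINT y|lborel. norm (G y *\<^sub>R biot_savart (x - y)))"
      by (rule integral_cong_AE) (use AE_G_nonneg in \<open>auto elim!: eventually_mono\<close>)
    finally show ?thesis unfolding F_def prod.case norm_scaleR[of "indicator _ _"] by simp
  qed
  have int: "integrable (lborel \<Otimes>\<^sub>M lborel) F"
  proof (rule lborel_pair.Fubini_integrable[OF Fm])
    show "integrable lborel (\<lambda>t. LINT y|lborel. norm (F (t, y)))"
      unfolding ny by (intro integrable_scaleR_left) (auto simp: integrable_indicator_iff)
  qed (use iy in auto)
  have "N = (LINT t|lborel. (LINT y|lborel. F (t, y)))"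
    unfolding vy by simp
  also have "\<dots> = (LINT y|lborel. (LINT t|lborel. F (t, y)))"
    using lborel_pair.Fubini_integral[of "\<lambda>t y. F (t, y)"] int by simp
  also have "\<dots> = (LINT y|lborel. (indicator {y. norm y < norm x} y * G y) *\<^sub>R biot_savart x)"
  proof (rule integral_cong_AE)
    have "sphere 0 (norm x) \<in> null_sets lborel"
      using negligible_sphere[of 0 "norm x"] by (simp add: null_sets_completion_iff negligible_iff_null_sets)
    then have "AE y in lborel. y \<notin> sphere 0 (norm x)" by (rule AE_not_in)
    then show "AE y in lborel. (LINT t|lborel. F (t, y)) = (indicator {y. norm y < norm x} y * G y) *\<^sub>R biot_savart x"
    proof eventually_elim
      case (elim y)
      then have ne: "norm y \<noteq> norm x" by simp
      have "(LINT t|lborel. F (t, y)) = (LINT t|lborel. G y *\<^sub>R (indicator {0..1} t *\<^sub>R biot_savart (x - rot (2 * pi * t) y)))"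
        by (simp add: F_def mult.commute)
      also have "\<dots> = G y *\<^sub>R (if norm y < norm x then biot_savart x else 0)"
        unfolding integral_scaleR_right circle_average_biot_savart(2)[OF assms ne] ..
      finally show ?case by simp
    qed
    show "(\<lambda>y. LINT t|lborel. F (t, y)) \<in> borel_measurable lborel"
      using lborel_pair.integrable_snd[of "\<lambda>t y. F (t, y)"] int by (intro borel_measurable_integrable) simp
  qed measurable
  also have "\<dots> = enclosed (norm x) *\<^sub>R biot_savart x"
    using enclosed_integrable by (simp add: enclosed_def)
  finally show ?thesis by (simp add: N_def filtered_kernel_def conv_def)
qed


text \<open>
  A rotation by \<open>\<pi>\<close> reverses the field.
\<close>

lemma filtered_kernel_0: "filtered_kernel G 0 = 0"
proof -
  have r: "rot pi y = - y" for y by (simp add: rot_def)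
  have b: "biot_savart (0 - rot pi y) = - biot_savart (0 - y)" for y
    by (simp add: r biot_savart_def perp_minus)
  have "(LINT y|lborel. G y *\<^sub>R biot_savart (0 - rot pi y)) = (LINT y|lborel. G y *\<^sub>R biot_savart (0 - y))"
    by (rule G_rotate(2)[of "\<lambda>y. biot_savart (0 - y)"]) measurable
  then have "- filtered_kernel G 0 = filtered_kernel G 0"
    unfolding b filtered_kernel_def conv_def by simp
  then show ?thesis by (auto simp: vec_eq_iff)
qed

end

text \<open>
  For the filtered kernel, the profile \<open>k\<close> is \<open>1 / (2\<pi> r\<^sup>2)\<close> times the fraction of \<open>G\<close> enclosed
  by the circle of radius \<open>r\<close>. Thus \<open>k_mass\<close> says that this fraction is at most one, \<open>k_bound\<close>
  that the velocity is bounded, and \<open>k_far\<close> that the field is close to that of a point vortex at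
  large distance.
\<close>

locale vortex_kernel =
  fixes K :: "real^2 \<Rightarrow> real^2" and k :: "real \<Rightarrow> real" and B D :: real
  assumes K_eq: "K z = k (norm z) *\<^sub>R perp z"
    and K_measurable [measurable]: "K \<in> borel_measurable borel"
    and k_nonneg: "0 \<le> k r"
    and k_mass: "k r * r\<^sup>2 \<le> 1 / (2 * pi)"
    and k_bound: "k r * r \<le> B"
    and k_far: "r > 0 \<Longrightarrow> \<bar>k r * r\<^sup>2 - 1 / (2 * pi)\<bar> \<le> D / r"

context helmholtz
begin

text \<open>
  The profile takes the value \<open>0\<close> at \<open>r = 0\<close> by division by zero, which agrees with the
  vanishing of the kernel at the origin. The tail of \<open>G\<close> gives the rate \<open>1 / r\<^sup>2\<close> for large \<open>r\<close>;
  weakening it to \<open>1 / r\<close> lets the trivial bound \<open>1\<close> cover small \<open>r\<close>.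
\<close>

theorem filtered_kernel_vortex_kernel:
  "\<exists>k B D. vortex_kernel (filtered_kernel G) k B D"
proof -
  define k where "k r = enclosed r / (2 * pi * r\<^sup>2)" for r
  obtain B where B: "B > 0" "\<And>x. (LINT y|lborel. norm (G y *\<^sub>R biot_savart (x - y))) \<le> B"
    using biot_savart_G_bound by blast
  obtain D where D: "D > 0" "\<And>r. r > 0 \<Longrightarrow> 1 - enclosed r \<le> D / r\<^sup>2"
    using enclosed_tail by blast
  have K_eq: "filtered_kernel G z = k (norm z) *\<^sub>R perp z" for z
  proof (cases "z = 0")
    case False
    show ?thesis
      unfolding filtered_kernel_newton[OF False] k_def biot_savart_def scaleR_scaleR divide_inverse ..
  qed (simp add: filtered_kernel_0)
  have [measurable]: "enclosed \<in> borel_measurable borel"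
    by (rule borel_measurable_mono) (simp add: mono_def enclosed_mono)
  have [measurable]: "perp \<in> borel_measurable borel"
    by (intro borel_measurable_continuous_onI linear_continuous_on bounded_linear_perp)
  have nonneg: "0 \<le> k r" for r by (simp add: k_def enclosed_nonneg)
  have kr: "k r * r\<^sup>2 = enclosed r / (2 * pi)" if "r \<noteq> 0" for r
    using that by (simp add: k_def)
  show ?thesis
  proof (intro exI, unfold_locales)
    show "filtered_kernel G z = k (norm z) *\<^sub>R perp z" for z by (rule K_eq)
    show "filtered_kernel G \<in> borel_measurable borel"
      unfolding K_eq[abs_def] k_def by measurable
    show "0 \<le> k r" for r by (rule nonneg)
    show "k r * r\<^sup>2 \<le> 1 / (2 * pi)" for r
      using enclosed_le_1[of r] by (cases "r = 0") (simp_all add: kr divide_right_mono)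
    show "k r * r \<le> B" for r
    proof (cases "r > 0")
      case True
      define x :: "real^2" where "x = r *\<^sub>R axis 1 1"
      have nx: "norm x = r" using True by (simp add: x_def)
      have "k r * r = norm (filtered_kernel G x)"
        using nonneg[of r] nx by (simp add: K_eq)
      also have "\<dots> \<le> (LINT y|lborel. norm (G y *\<^sub>R biot_savart (x - y)))"
        unfolding filtered_kernel_def conv_def by (rule integral_norm_bound)
      also have "\<dots> \<le> B" by (rule B)
      finally show ?thesis .
    next
      case False
      then have "k r * r \<le> 0" using nonneg[of r] by (simp add: mult_nonneg_nonpos)
      then show ?thesis using B(1) by linarith
    qed
    show "\<bar>k r * r\<^sup>2 - 1 / (2 * pi)\<bar> \<le> (1 + D) / r" if r: "r > 0" for r
    proof -
      have le: "1 - enclosed r \<le> (1 + D) / r"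
      proof (cases "r \<le> 1")
        case True
        have "1 - enclosed r \<le> 1" using enclosed_nonneg[of r] by simp
        also have "\<dots> \<le> (1 + D) / r" using True r D(1) by (simp add: field_simps)
        finally show ?thesis .
      next
        case False
        have "D / r\<^sup>2 \<le> D / r"
          using False D(1) by (intro divide_left_mono) (auto simp: power2_eq_square)
        also have "\<dots> \<le> (1 + D) / r" using r by (simp add: divide_right_mono)
        finally show ?thesis using D(2)[OF r] by linarith
      qed
      have "\<bar>k r * r\<^sup>2 - 1 / (2 * pi)\<bar> = (1 - enclosed r) / (2 * pi)"
        using r enclosed_le_1[of r] by (simp add: kr diff_divide_distrib[symmetric] abs_if field_simps)
      also have "\<dots> \<le> (1 - enclosed r) / 1"
        using enclosed_le_1[of r] pi_gt3 by (intro divide_left_mono) auto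
      finally show ?thesis using le by simp
    qed
  qed
qed

end

section \<open>Measurable families of measures\<close>

text \<open>
  Measurability in the parameter passes from an intersection-stable generator to the generated
  \<open>\<sigma>\<close>-algebra by Dynkin's argument. It matters for weak solutions: a Bochner integral over time
  of a function that is not measurable would be zero by convention, and the weak formulation
  would say nothing.
\<close>

lemma measurable_emeasure_family:
  fixes \<rho> :: "'s \<Rightarrow> 'b measure"
  assumes E: "sets N = sigma_sets \<Omega> E" "Int_stable E" "E \<subseteq> Pow \<Omega>"
    and \<rho>: "\<And>s. sets (\<rho> s) = sets N" "\<And>s. finite_measure (\<rho> s)"
    and gen: "\<And>A. A \<in> E \<Longrightarrow> (\<lambda>s. emeasure (\<rho> s) A) \<in> borel_measurable M"
    and top: "(\<lambda>s. emeasure (\<rho> s) \<Omega>) \<in> borel_measurable M"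
    and A: "A \<in> sets N"
  shows "(\<lambda>s. emeasure (\<rho> s) A) \<in> borel_measurable M"
  using E(2,3) A unfolding E(1)
proof (induction rule: sigma_sets_induct_disjoint)
  case (compl A)
  have "emeasure (\<rho> s) (\<Omega> - A) = emeasure (\<rho> s) \<Omega> - emeasure (\<rho> s) A" for s
  proof (rule emeasure_Diff)
    interpret finite_measure "\<rho> s" by (rule \<rho>)
    show "emeasure (\<rho> s) A \<noteq> \<infinity>" by simp
    show "\<Omega> \<in> sets (\<rho> s)" "A \<in> sets (\<rho> s)" "A \<subseteq> \<Omega>"
      using compl(1) sigma_sets_into_sp[OF E(3)] by (auto simp: \<rho> E(1) sigma_sets_top)
  qed
  then show ?case using compl.IH top by simp
next
  case (union A)
  have "(\<Sum>i. emeasure (\<rho> s) (A i)) = emeasure (\<rho> s) (\<Union>i. A i)" for s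
    using union(1,2) by (intro suminf_emeasure) (auto simp: \<rho> E(1))
  moreover have "(\<lambda>s. \<Sum>i. emeasure (\<rho> s) (A i)) \<in> borel_measurable M"
    using union(3) by measurable
  ultimately show ?case by simp
qed (use gen in auto)

lemma measurable_nn_integral_family:
  fixes \<rho> :: "'s \<Rightarrow> 'b measure"
  assumes \<rho>: "\<And>s. sets (\<rho> s) = sets N"
    and m: "\<And>A. A \<in> sets N \<Longrightarrow> (\<lambda>s. emeasure (\<rho> s) A) \<in> borel_measurable M"
    and g: "g \<in> borel_measurable N"
  shows "(\<lambda>s. \<integral>\<^sup>+x. g x \<partial>\<rho> s) \<in> borel_measurable M"
proof -
  have mc: "borel_measurable (\<rho> s) = borel_measurable N" for s
    by (rule measurable_cong_sets) (auto simp: \<rho>)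
  show ?thesis using g
  proof (induction rule: borel_measurable_induct)
    case (cong f g)
    have "(\<integral>\<^sup>+x. f x \<partial>\<rho> s) = (\<integral>\<^sup>+x. g x \<partial>\<rho> s)" for s
      using cong(3) sets_eq_imp_space_eq[OF \<rho>, of s] by (intro nn_integral_cong) auto
    then show ?case using cong(4) by simp
  next
    case (set A)
    then show ?case using m[of A] by (simp add: \<rho>)
  next
    case (mult u c)
    then show ?case by (simp add: nn_integral_cmult mc)
  next
    case (add u v)
    then show ?case by (simp add: nn_integral_add mc)
  next
    case (seq U)
    have "(\<integral>\<^sup>+x. (SUP i. U i x) \<partial>\<rho> s) = (SUP i. \<integral>\<^sup>+x. U i x \<partial>\<rho> s)" for s
      using seq by (intro nn_integral_monotone_convergence_SUP) (auto simp: mc)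
    moreover have "(\<lambda>s. SUP i. \<integral>\<^sup>+x. U i x \<partial>\<rho> s) \<in> borel_measurable M"
      using seq by (intro borel_measurable_SUP) auto
    ultimately show ?case by (simp add: SUP_apply[abs_def] image_comp)
  qed
qed

lemma measurable_integral_family:
  fixes \<rho> :: "'s \<Rightarrow> 'b measure" and g :: "'b \<Rightarrow> real"
  assumes \<rho>: "\<And>s. sets (\<rho> s) = sets N" "\<And>s. finite_measure (\<rho> s)"
    and m: "\<And>A. A \<in> sets N \<Longrightarrow> (\<lambda>s. emeasure (\<rho> s) A) \<in> borel_measurable M"
    and g: "g \<in> borel_measurable N" and C: "\<And>x. \<bar>g x\<bar> \<le> C"
  shows "(\<lambda>s. \<integral>x. g x \<partial>\<rho> s) \<in> borel_measurable M"
proof -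
  have mc: "borel_measurable (\<rho> s) = borel_measurable N" for s
    by (rule measurable_cong_sets) (auto simp: \<rho>)
  have "integrable (\<rho> s) g" for s
  proof (rule finite_measure.integrable_const_bound[OF \<rho>(2)])
    show "AE x in \<rho> s. norm (g x) \<le> C" using C by simp
    show "g \<in> borel_measurable (\<rho> s)" unfolding mc by (rule g)
  qed
  then have "(\<integral>x. g x \<partial>\<rho> s) = enn2real (\<integral>\<^sup>+x. ennreal (g x) \<partial>\<rho> s) - enn2real (\<integral>\<^sup>+x. ennreal (- g x) \<partial>\<rho> s)" for s
    by (rule real_lebesgue_integral_def)
  moreover have "(\<lambda>s. enn2real (\<integral>\<^sup>+x. ennreal (g x) \<partial>\<rho> s) - enn2real (\<integral>\<^sup>+x. ennreal (- g x) \<partial>\<rho> s)) \<in> borel_measurable M"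
  proof (intro borel_measurable_diff borel_measurable_enn2real)
    show "(\<lambda>s. \<integral>\<^sup>+x. ennreal (g x) \<partial>\<rho> s) \<in> borel_measurable M"
      by (rule measurable_nn_integral_family[OF \<rho>(1) m measurable_compose[OF g measurable_ennreal]])
    show "(\<lambda>s. \<integral>\<^sup>+x. ennreal (- g x) \<partial>\<rho> s) \<in> borel_measurable M"
      by (rule measurable_nn_integral_family[OF \<rho>(1) m
          measurable_compose[OF borel_measurable_uminus[OF g] measurable_ennreal]])
  qed
  ultimately show ?thesis by simp
qed

lemma measurable_emeasure_pair_family:
  fixes \<nu> :: "'s \<Rightarrow> 'b measure"
  assumes \<nu>: "\<And>s. sets (\<nu> s) = sets N" "\<And>s. finite_measure (\<nu> s)"
    and m: "\<And>A. A \<in> sets N \<Longrightarrow> (\<lambda>s. emeasure (\<nu> s) A) \<in> borel_measurable M"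
    and A: "A \<in> sets (N \<Otimes>\<^sub>M N)"
  shows "(\<lambda>s. emeasure (\<nu> s \<Otimes>\<^sub>M \<nu> s) A) \<in> borel_measurable M"
proof -
  have rect: "(\<lambda>s. emeasure (\<nu> s \<Otimes>\<^sub>M \<nu> s) (a \<times> b)) \<in> borel_measurable M" if "a \<in> sets N" "b \<in> sets N" for a b
  proof -
    have "emeasure (\<nu> s \<Otimes>\<^sub>M \<nu> s) (a \<times> b) = emeasure (\<nu> s) a * emeasure (\<nu> s) b" for s
    proof -
      interpret finite_measure "\<nu> s" by (rule \<nu>)
      show ?thesis using that by (intro emeasure_pair_measure_Times) (auto simp: \<nu>)
    qed
    then show ?thesis using m that by simp
  qed
  show ?thesis
  proof (rule measurable_emeasure_family[OF sets_pair_measure Int_stable_pair_measure_generator pair_measure_closed _ _ _ _ A])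
    show "sets (\<nu> s \<Otimes>\<^sub>M \<nu> s) = sets (N \<Otimes>\<^sub>M N)" for s by (intro sets_pair_measure_cong \<nu>)
    show "finite_measure (\<nu> s \<Otimes>\<^sub>M \<nu> s)" for s by (intro finite_measure_pair_measure \<nu>)
    show "(\<lambda>s. emeasure (\<nu> s \<Otimes>\<^sub>M \<nu> s) (space N \<times> space N)) \<in> borel_measurable M"
      by (intro rect) auto
  qed (use rect in auto)
qed

text \<open>
  The indicator of a compact set is a decreasing limit of compactly supported continuous
  functions.
\<close>

lemma measurable_emeasure_compact:
  fixes \<nu> :: "'s \<Rightarrow> 'a::euclidean_space measure"
  assumes \<nu>: "\<And>s. sets (\<nu> s) = sets borel" "\<And>s. finite_measure (\<nu> s)"
    and weak: "\<And>f :: 'a \<Rightarrow> real. continuous_on UNIV f \<Longrightarrow> (f \<longlongrightarrow> 0) at_infinity \<Longrightarrow> (\<lambda>s. \<integral>x. f x \<partial>\<nu> s) \<in> borel_measurable M"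
    and S: "compact S"
  shows "(\<lambda>s. emeasure (\<nu> s) S) \<in> borel_measurable M"
proof (cases "S = {}")
  case False
  define f where "f n x = max 0 (1 - real (Suc n) * infdist x S)" for n and x :: 'a
  have cont: "continuous_on UNIV (f n)" for n
    unfolding f_def[abs_def] by (intro continuous_intros)
  obtain R where R: "\<And>x. x \<in> S \<Longrightarrow> norm x \<le> R" using compact_imp_bounded[OF S] bounded_iff by blast
  have zero: "f n x = 0" if "norm x \<ge> R + 1" for n x
  proof -
    obtain y where y: "y \<in> S" "infdist x S = dist x y"
      using infdist_attains_inf[OF compact_imp_closed[OF S] False] by blast
    have "1 \<le> dist x y" using that R[OF y(1)] norm_triangle_ineq2[of x y] by (simp add: dist_norm)
    then have "1 * 1 \<le> real (Suc n) * infdist x S" unfolding y(2) by (intro mult_mono) auto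
    then show ?thesis by (simp add: f_def)
  qed
  have van: "(f n \<longlongrightarrow> 0) at_infinity" for n
    by (rule tendsto_eventually) (use zero in \<open>auto simp: eventually_at_infinity\<close>)
  have f01: "0 \<le> f n x" "f n x \<le> 1" for n x
    by (auto simp: f_def infdist_nonneg)
  have lim: "(\<lambda>n. f n x) \<longlonglongrightarrow> indicator S x" for x
  proof (cases "x \<in> S")
    case True
    then show ?thesis by (simp add: f_def)
  next
    case notin: False
    then have pos: "infdist x S > 0"
      using in_closed_iff_infdist_zero[OF compact_imp_closed[OF S] False] infdist_nonneg[of x S] by (simp add: less_le)
    obtain n0 where n0: "1 < real n0 * infdist x S" using reals_Archimedean3[OF pos] by blast
    have "\<forall>\<^sub>F n in sequentially. f n x = 0"
      using eventually_ge_at_top[of n0]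
    proof eventually_elim
      case (elim n)
      then have "real n0 * infdist x S \<le> real (Suc n) * infdist x S" using pos by (intro mult_right_mono) auto
      then show ?case using n0 by (simp add: f_def)
    qed
    then show ?thesis using notin by (simp add: tendsto_eventually)
  qed
  have "(\<lambda>n. \<integral>x. f n x \<partial>\<nu> s) \<longlonglongrightarrow> measure (\<nu> s) S" for s
  proof -
    interpret finite_measure "\<nu> s" by (rule \<nu>)
    have mc: "borel_measurable (\<nu> s) = borel_measurable borel"
      by (rule measurable_cong_sets) (auto simp: \<nu>)
    have "(\<lambda>n. \<integral>x. f n x \<partial>\<nu> s) \<longlonglongrightarrow> (\<integral>x. indicator S x \<partial>\<nu> s)"
      by (rule integral_dominated_convergence[where w = "\<lambda>_. 1"])
         (use lim f01 borel_measurable_continuous_onI[OF cont] borel_closed[OF compact_imp_closed[OF S]] in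
           \<open>auto simp: mc intro!: borel_measurable_indicator\<close>)
    moreover have "S \<in> sets (\<nu> s)" using borel_closed[OF compact_imp_closed[OF S]] by (simp add: \<nu>)
    ultimately show ?thesis by simp
  qed
  then have "(\<lambda>s. measure (\<nu> s) S) \<in> borel_measurable M"
    by (rule borel_measurable_LIMSEQ_real[OF _ weak[OF cont van]])
  then have "(\<lambda>s. ennreal (measure (\<nu> s) S)) \<in> borel_measurable M" by measurable
  moreover have "emeasure (\<nu> s) S = ennreal (measure (\<nu> s) S)" for s
    using finite_measure.emeasure_eq_measure[OF \<nu>(2)] by blast
  ultimately show ?thesis by simp
qed simp

lemma measurable_emeasure_borel:
  fixes \<nu> :: "'s \<Rightarrow> 'a::euclidean_space measure"
  assumes \<nu>: "\<And>s. sets (\<nu> s) = sets borel" "\<And>s. finite_measure (\<nu> s)"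
    and weak: "\<And>f :: 'a \<Rightarrow> real. continuous_on UNIV f \<Longrightarrow> (f \<longlongrightarrow> 0) at_infinity \<Longrightarrow> (\<lambda>s. \<integral>x. f x \<partial>\<nu> s) \<in> borel_measurable M"
    and A: "A \<in> sets borel"
  shows "(\<lambda>s. emeasure (\<nu> s) A) \<in> borel_measurable M"
proof -
  have gen: "(\<lambda>s. emeasure (\<nu> s) U) \<in> borel_measurable M" if U: "open U" for U
  proof -
    obtain C :: "nat \<Rightarrow> 'a set" where C: "\<And>n. compact (C n)" "\<And>n. C n \<subseteq> interior (C (Suc n))" "\<Union>(range C) = U"
      using open_Union_compact_subsets[OF U] by metis
    have "incseq C" using C(2) interior_subset by (intro incseq_SucI) blast
    moreover have "range C \<subseteq> sets (\<nu> s)" for s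
      using C(1) borel_closed[OF compact_imp_closed] by (auto simp: \<nu>)
    ultimately have "emeasure (\<nu> s) U = (SUP n. emeasure (\<nu> s) (C n))" for s
      using SUP_emeasure_incseq[of C "\<nu> s"] C(3) by simp
    moreover have "(\<lambda>s. SUP n. emeasure (\<nu> s) (C n)) \<in> borel_measurable M"
      using measurable_emeasure_compact[OF \<nu> weak C(1)] by measurable
    ultimately show ?thesis by simp
  qed
  show ?thesis
  proof (rule measurable_emeasure_family[OF _ _ _ \<nu> _ _ A])
    show "sets (borel :: 'a measure) = sigma_sets UNIV {S. open S}" by (simp add: borel_def)
    show "Int_stable {S :: 'a set. open S}" by (auto simp: Int_stable_def)
    show "(\<lambda>s. emeasure (\<nu> s) UNIV) \<in> borel_measurable M" by (rule gen) simp
  qed (use gen in auto)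
qed


section \<open>Weak solutions tested against functions of space\<close>

lemma bounded_radon_measureD:
  assumes "bounded_radon_measure \<mu>"
  shows "finite_measure \<mu>" "sets \<mu> = sets borel" "space \<mu> = UNIV" "borel_measurable \<mu> = borel_measurable borel"
  using assms sets_eq_imp_space_eq[of \<mu> borel] measurable_cong_sets[of \<mu> borel borel borel]
  by (auto simp: bounded_radon_measure_def)

lemma integrable_bounded_radon:
  fixes f :: "'a::euclidean_space \<Rightarrow> 'b::{banach, second_countable_topology}"
  assumes "bounded_radon_measure \<mu>" "f \<in> borel_measurable borel" "\<And>x. norm (f x) \<le> C"
  shows "integrable \<mu> f"
proof (rule finite_measure.integrable_const_bound[OF bounded_radon_measureD(1)[OF assms(1)]])
  show "AE x in \<mu>. norm (f x) \<le> C" using assms(3) by simp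
  show "f \<in> borel_measurable \<mu>" unfolding bounded_radon_measureD(4)[OF assms(1)] by (rule assms(2))
qed

lemma norm_integral_le_mass:
  fixes f :: "real^2 \<Rightarrow> 'b::{banach, second_countable_topology}"
  assumes \<mu>: "bounded_radon_measure \<mu>" and f: "f \<in> borel_measurable borel" "\<And>x. norm (f x) \<le> C"
  shows "norm (\<integral>x. f x \<partial>\<mu>) \<le> C * mass \<mu>"
proof -
  have "norm (\<integral>x. f x \<partial>\<mu>) \<le> (\<integral>x. norm (f x) \<partial>\<mu>)"
    by (rule integral_norm_bound)
  also have "\<dots> \<le> (\<integral>x. C \<partial>\<mu>)"
    using f(2) by (intro integral_mono integrable_norm integrable_bounded_radon[OF assms]
        finite_measure.integrable_const bounded_radon_measureD[OF \<mu>])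
  finally have "norm (\<integral>x. f x \<partial>\<mu>) \<le> (\<integral>x. C \<partial>\<mu>)" .
  then show ?thesis
    by (simp add: mass_def bounded_radon_measureD(3)[OF \<mu>] mult.commute)
qed

context vortex_kernel
begin

lemma norm_K: "norm (K z) = k (norm z) * norm z"
  using k_nonneg by (simp add: K_eq)

lemma K_bounded: "norm (K z) \<le> B"
  using k_bound by (simp add: norm_K)

lemma B_nonneg: "0 \<le> B"
  using order_trans[OF norm_ge_zero K_bounded[of 0]] .

lemma K_odd: "K (- z) = - K z"
  by (simp add: K_eq perp_minus)

lemma K_decay: "norm z * norm (K z) \<le> 1"
proof -
  have "norm z * norm (K z) \<le> 1 / (2 * pi)"
    using k_mass[of "norm z"] by (simp add: norm_K power2_eq_square mult_ac)
  also have "\<dots> \<le> 1" using pi_gt3 by simp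
  finally show ?thesis .
qed

text \<open>
  The rate at which the velocity generated by \<open>\<mu>\<close> itself changes \<open>\<integral> f d\<mu>\<close> when \<open>g\<close> is the
  gradient of \<open>f\<close>.
\<close>

definition flux :: "(real^2 \<Rightarrow> real^2) \<Rightarrow> (real^2) measure \<Rightarrow> real" where
  "flux g \<mu> = (\<integral>x. g x \<bullet> (\<integral>y. K (x - y) \<partial>\<mu>) \<partial>\<mu>)"

context
  fixes \<mu> :: "(real^2) measure" and g :: "real^2 \<Rightarrow> real^2" and C :: real
  assumes \<mu>: "bounded_radon_measure \<mu>"
    and g [measurable]: "g \<in> borel_measurable borel" and gC: "\<And>x. norm (g x) \<le> C"
begin

lemma pair_measurable: "borel_measurable (\<mu> \<Otimes>\<^sub>M \<mu>) = borel_measurable (borel \<Otimes>\<^sub>M borel)"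
  by (intro measurable_cong_sets sets_pair_measure_cong bounded_radon_measureD[OF \<mu>] refl)

lemma integrable_pair_bounded:
  fixes f :: "(real^2) \<times> (real^2) \<Rightarrow> real"
  assumes "f \<in> borel_measurable (borel \<Otimes>\<^sub>M borel)" "\<And>p. \<bar>f p\<bar> \<le> c"
  shows "integrable (\<mu> \<Otimes>\<^sub>M \<mu>) f"
proof -
  interpret finite_measure "\<mu> \<Otimes>\<^sub>M \<mu>"
    by (intro finite_measure_pair_measure bounded_radon_measureD[OF \<mu>])
  show ?thesis
    by (rule integrable_const_bound[where B = c]) (use assms in \<open>simp_all add: pair_measurable\<close>)
qed

lemma K_shift_integrable: "integrable \<mu> (\<lambda>y. K (x - y))"
  by (rule integrable_bounded_radon[OF \<mu> _ K_bounded]) measurable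

lemma velocity_field_bounded: "norm (\<integral>y. K (x - y) \<partial>\<mu>) \<le> B * mass \<mu>"
  by (rule norm_integral_le_mass[OF \<mu> _ K_bounded]) measurable

lemma velocity_field_measurable: "(\<lambda>x. \<integral>y. K (x - y) \<partial>\<mu>) \<in> borel_measurable borel"
proof -
  interpret finite_measure \<mu> by (rule bounded_radon_measureD[OF \<mu>])
  have "(\<lambda>(x, y). K (x - y)) \<in> borel_measurable (borel \<Otimes>\<^sub>M borel)" by measurable
  then have "(\<lambda>(x, y). K (x - y)) \<in> borel_measurable (borel \<Otimes>\<^sub>M \<mu>)"
    by (simp add: measurable_cong_sets[OF sets_pair_measure_cong[OF refl bounded_radon_measureD(2)[OF \<mu>]] refl])
  then show ?thesis
    by (rule borel_measurable_lebesgue_integral)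
qed

lemma interaction_integrable: "integrable (\<mu> \<Otimes>\<^sub>M \<mu>) (\<lambda>p. g (fst p) \<bullet> K (fst p - snd p))"
proof (rule integrable_pair_bounded)
  have "\<bar>g (fst p) \<bullet> K (fst p - snd p)\<bar> \<le> norm (g (fst p)) * norm (K (fst p - snd p))" for p
    by (rule Cauchy_Schwarz_ineq2)
  also have "\<dots> p \<le> C * B" for p
    by (intro mult_mono gC K_bounded order_trans[OF norm_ge_zero gC]) auto
  finally show "\<bar>g (fst p) \<bullet> K (fst p - snd p)\<bar> \<le> C * B" for p .
qed measurable

lemma flux_eq_pair: "flux g \<mu> = (\<integral>p. g (fst p) \<bullet> K (fst p - snd p) \<partial>(\<mu> \<Otimes>\<^sub>M \<mu>))"
proof -
  interpret finite_measure \<mu> by (rule bounded_radon_measureD[OF \<mu>])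
  interpret P: pair_sigma_finite \<mu> \<mu> ..
  have "flux g \<mu> = (\<integral>x. (\<integral>y. g x \<bullet> K (x - y) \<partial>\<mu>) \<partial>\<mu>)"
    unfolding flux_def using K_shift_integrable by (simp add: integral_inner_right)
  also have "\<dots> = (\<integral>p. g (fst p) \<bullet> K (fst p - snd p) \<partial>(\<mu> \<Otimes>\<^sub>M \<mu>))"
    using P.integral_fst'[OF interaction_integrable] by simp
  finally show ?thesis .
qed

text \<open>
  The kernel is odd, so exchanging the two variables changes the sign of the interaction and the
  gradient may be replaced by half of its difference at the two points.
\<close>

lemma flux_symmetrized:
  "flux g \<mu> = (\<integral>p. (g (fst p) - g (snd p)) \<bullet> K (fst p - snd p) \<partial>(\<mu> \<Otimes>\<^sub>M \<mu>)) / 2"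
proof -
  interpret finite_measure \<mu> by (rule bounded_radon_measureD[OF \<mu>])
  interpret P: pair_sigma_finite \<mu> \<mu> ..
  have sw: "(\<integral>p. g (snd p) \<bullet> K (snd p - fst p) \<partial>(\<mu> \<Otimes>\<^sub>M \<mu>)) = flux g \<mu>"
    and swi: "integrable (\<mu> \<Otimes>\<^sub>M \<mu>) (\<lambda>p. g (snd p) \<bullet> K (snd p - fst p))"
    using P.integral_product_swap[OF borel_measurable_integrable[OF interaction_integrable]]
      P.integrable_product_swap[OF interaction_integrable] flux_eq_pair by (auto simp: case_prod_beta')
  have "K (snd p - fst p) = - K (fst p - snd p)" for p
    using K_odd[of "fst p - snd p"] by simp
  then have eq: "(g (fst p) - g (snd p)) \<bullet> K (fst p - snd p)
      = g (fst p) \<bullet> K (fst p - snd p) + g (snd p) \<bullet> K (snd p - fst p)" for p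
    by (simp add: inner_diff_left)
  show ?thesis
    unfolding eq Bochner_Integration.integral_add[OF interaction_integrable swi] sw flux_eq_pair[symmetric] by simp
qed

lemma flux_abs_le: "\<bar>flux g \<mu>\<bar> \<le> C * (B * mass \<mu>) * mass \<mu>"
proof -
  have "\<bar>g x \<bullet> (\<integral>y. K (x - y) \<partial>\<mu>)\<bar> \<le> C * (B * mass \<mu>)" for x
    by (rule order_trans[OF Cauchy_Schwarz_ineq2])
       (intro mult_mono gC velocity_field_bounded order_trans[OF norm_ge_zero gC], auto)
  then show ?thesis
    using norm_integral_le_mass[OF \<mu>, of "\<lambda>x. g x \<bullet> (\<integral>y. K (x - y) \<partial>\<mu>)"] velocity_field_measurable
    by (simp add: flux_def)
qed

end

end

locale vortex_flow = vortex_kernel K k B D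
  for K :: "real^2 \<Rightarrow> real^2" and k :: "real \<Rightarrow> real" and B D :: real +
  fixes q :: "real \<Rightarrow> (real^2) measure"
  assumes radon: "t \<ge> 0 \<Longrightarrow> bounded_radon_measure (q t)"
    and locally_bounded: "locally_bounded_compactly_supported q"
    and weak_star: "weak_star_continuous q"
    and weak: "test_function \<phi> \<Longrightarrow>
        (LINT t:{0..}|lborel. (LINT x|q t.
            frechet_derivative \<phi> (at (x, t)) (0, 1)
          + frechet_derivative \<phi> (at (x, t)) (LINT y|q t. K (x - y), 0)))
        + (LINT x|q 0. \<phi> (x, 0)) = 0"
begin

text \<open>
  Times before the initial one carry the initial measure, which makes the family weakly continuous
  on the whole line, hence measurable there.
\<close>

definition extended :: "real \<Rightarrow> (real^2) measure" where
  "extended t = q (max 0 t)"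

lemma extended_radon: "bounded_radon_measure (extended t)"
  by (simp add: extended_def radon)

lemma extended_nonneg [simp]: "t \<ge> 0 \<Longrightarrow> extended t = q t"
  by (simp add: extended_def)

lemma extended_continuous:
  fixes f :: "real^2 \<Rightarrow> real"
  assumes "continuous_on UNIV f" "(f \<longlongrightarrow> 0) at_infinity"
  shows "continuous_on UNIV (\<lambda>t. \<integral>x. f x \<partial>extended t)"
proof -
  have "continuous_on {0..} (\<lambda>t. \<integral>x. f x \<partial>q t)"
    using weak_star assms by (simp add: weak_star_continuous_def)
  then have "continuous_on UNIV (\<lambda>t. \<integral>x. f x \<partial>q (max 0 t))"
    by (rule continuous_on_compose2) (auto intro!: continuous_intros)
  then show ?thesis by (simp add: extended_def)
qed

lemma extended_emeasure_measurable: "A \<in> sets borel \<Longrightarrow> (\<lambda>t. emeasure (extended t) A) \<in> borel_measurable borel"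
  by (rule measurable_emeasure_borel)
     (use extended_radon borel_measurable_continuous_onI[OF extended_continuous] in \<open>auto simp: bounded_radon_measure_def\<close>)

lemma extended_flux_measurable:
  assumes g: "g \<in> borel_measurable borel" "\<And>x. norm (g x) \<le> C"
  shows "(\<lambda>t. flux g (extended t)) \<in> borel_measurable borel"
proof -
  have fin: "finite_measure (extended t)" and set: "sets (extended t) = sets borel" for t
    using extended_radon by (auto simp: bounded_radon_measure_def)
  have "(\<lambda>t. \<integral>p. g (fst p) \<bullet> K (fst p - snd p) \<partial>(extended t \<Otimes>\<^sub>M extended t)) \<in> borel_measurable borel"
  proof (rule measurable_integral_family[where N = "borel \<Otimes>\<^sub>M borel" and C = "C * B"])
    show "sets (extended t \<Otimes>\<^sub>M extended t) = sets (borel \<Otimes>\<^sub>M borel)" for t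
      by (intro sets_pair_measure_cong set)
    show "finite_measure (extended t \<Otimes>\<^sub>M extended t)" for t
      by (intro finite_measure_pair_measure fin)
    show "(\<lambda>t. emeasure (extended t \<Otimes>\<^sub>M extended t) A) \<in> borel_measurable borel" if "A \<in> sets (borel \<Otimes>\<^sub>M borel)" for A
      by (rule measurable_emeasure_pair_family[OF set fin extended_emeasure_measurable that])
    show "(\<lambda>p. g (fst p) \<bullet> K (fst p - snd p)) \<in> borel_measurable (borel \<Otimes>\<^sub>M borel)"
      using g(1)[measurable] by measurable
    show "\<bar>g (fst p) \<bullet> K (fst p - snd p)\<bar> \<le> C * B" for p
      by (rule order_trans[OF Cauchy_Schwarz_ineq2])
         (intro mult_mono g(2) K_bounded order_trans[OF norm_ge_zero g(2)], auto)
  qed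
  then show ?thesis by (simp add: flux_eq_pair[OF extended_radon g])
qed

lemma test_function_vanishes_at_infinity:
  assumes "test_function f" shows "(f \<longlongrightarrow> 0) at_infinity"
proof -
  obtain R where "\<And>x. norm x > R \<Longrightarrow> f x = 0" using test_functionD(2)[OF assms] by blast
  then have "\<forall>x. norm x \<ge> R + 1 \<longrightarrow> f x = 0" by auto
  then have "\<forall>\<^sub>F x in at_infinity. f x = 0" unfolding eventually_at_infinity by blast
  then show ?thesis by (rule tendsto_eventually)
qed

end

text \<open>
  If the integrand fails to be integrable, its integral is zero by convention and the bound is
  trivial.
\<close>

lemma abs_integral_Icc_le:
  fixes h :: "real \<Rightarrow> real"
  assumes "a \<le> b" "0 \<le> c" and h: "AE t in lborel. t \<in> {a..b} \<longrightarrow> \<bar>h t\<bar> \<le> c"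
  shows "\<bar>LINT t|lborel. indicator {a..b} t * h t\<bar> \<le> c * (b - a)"
proof (cases "integrable lborel (\<lambda>t. indicator {a..b} t * h t)")
  case True
  have "\<bar>LINT t|lborel. indicator {a..b} t * h t\<bar> \<le> (LINT t|lborel. \<bar>indicator {a..b} t * h t\<bar>)"
    by (rule integral_abs_bound)
  also have "\<dots> \<le> (LINT t|lborel. c * indicator {a..b} t)"
  proof (rule integral_mono_AE)
    show "integrable lborel (\<lambda>t. \<bar>indicator {a..b} t * h t\<bar>)" using True by (rule integrable_abs)
    show "integrable lborel (\<lambda>t. c * indicator {a..b} t :: real)" by (auto simp: emeasure_lborel_Icc_eq)
    show "AE t in lborel. \<bar>indicator {a..b} t * h t\<bar> \<le> c * indicator {a..b} t"
      using h by eventually_elim (auto simp: indicator_def)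
  qed
  also have "\<dots> = c * (b - a)" using assms(1) by simp
  finally show ?thesis .
qed (use assms in \<open>simp add: not_integrable_integral_eq\<close>)

lemma integrable_Icc_AE_bounded:
  fixes h :: "real \<Rightarrow> real"
  assumes [measurable]: "h \<in> borel_measurable borel" and h: "AE t in lborel. t \<in> {a..b} \<longrightarrow> \<bar>h t\<bar> \<le> c"
  shows "integrable lborel (\<lambda>t. indicator {a..b} t * h t)"
proof (rule Bochner_Integration.integrable_bound)
  show "integrable lborel (\<lambda>t. c * indicator {a..b} t :: real)" by (auto simp: emeasure_lborel_Icc_eq)
  show "AE t in lborel. norm (indicator {a..b} t * h t) \<le> norm (c * indicator {a..b} t :: real)"
    using h by eventually_elim (auto simp: indicator_def)
qed measurable

context vortex_flow
begin

text \<open>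
  At this stage the mass is controlled for almost every time only; conservation of mass removes
  the exceptional times later.
\<close>

lemma mass_AE_bounded:
  obtains M where "M \<ge> 0" "AE s in lborel. s \<in> {0..T} \<longrightarrow> mass (q s) \<le> M"
proof -
  have "\<bar>T\<bar> + 1 > 0" by simp
  then obtain M0 where M0: "AE s in lborel. 0 \<le> s \<and> s \<le> \<bar>T\<bar> + 1 \<longrightarrow> compact (measure_support (q s)) \<and> mass (q s) \<le> M0"
    using locally_bounded unfolding locally_bounded_compactly_supported_def by blast
  show ?thesis
  proof (rule that[of "max 0 M0"])
    show "AE s in lborel. s \<in> {0..T} \<longrightarrow> mass (q s) \<le> max 0 M0"
      using M0 by eventually_elim auto
  qed simp
qed

lemma mass_nonneg: "0 \<le> mass \<mu>"
  by (simp add: mass_def)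

lemma flux_AE_bounded:
  assumes M: "M \<ge> 0" "AE s in lborel. s \<in> {0..T} \<longrightarrow> mass (q s) \<le> M"
    and g: "g \<in> borel_measurable borel" "\<And>x. norm (g x) \<le> C"
  shows "AE s in lborel. s \<in> {0..T} \<longrightarrow> \<bar>flux g (q s)\<bar> \<le> C * (B * M) * M"
  using M(2)
proof eventually_elim
  case (elim s)
  show ?case
  proof
    assume s: "s \<in> {0..T}"
    have C: "0 \<le> C" using order_trans[OF norm_ge_zero g(2)] .
    have "\<bar>flux g (q s)\<bar> \<le> C * (B * mass (q s)) * mass (q s)"
      using s by (intro flux_abs_le radon g) auto
    also have "\<dots> \<le> C * (B * M) * M"
      using elim s C B_nonneg M(1) by (intro mult_mono mult_left_mono) (auto simp: mass_nonneg)
    finally show "\<bar>flux g (q s)\<bar> \<le> C * (B * M) * M" .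
  qed
qed

lemma flux_integrable:
  assumes g: "g \<in> borel_measurable borel" "\<And>x. norm (g x) \<le> C"
  shows "integrable lborel (\<lambda>s. indicator {0..T} s * flux g (q s))"
proof -
  obtain M where M: "M \<ge> 0" "AE s in lborel. s \<in> {0..T} \<longrightarrow> mass (q s) \<le> M"
    by (rule mass_AE_bounded)
  have "integrable lborel (\<lambda>s. indicator {0..T} s * flux g (extended s))"
    by (rule integrable_Icc_AE_bounded[OF extended_flux_measurable[OF g], where c = "C * (B * M) * M"])
       (use flux_AE_bounded[OF M g] in \<open>auto elim!: eventually_mono\<close>)
  also have "(\<lambda>s. indicator {0..T} s * flux g (extended s)) = (\<lambda>s. indicator {0..T} s * flux g (q s))"
    by (auto simp: indicator_def)
  finally show ?thesis .
qed

text \<open>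
  The weak formulation is tested against \<open>f x * \<theta> s\<close>, where \<open>\<theta>\<close> is one up to time \<open>\<tau>\<close> and falls
  to zero on \<open>[\<tau>, \<tau> + \<epsilon>]\<close>. There \<open>\<theta>'\<close> has integral \<open>-1\<close> and size \<open>1 / \<epsilon>\<close>, so by continuity of
  \<open>\<integral> f dq\<close> in time the term with \<open>\<theta>'\<close> tends to \<open>- \<integral> f dq(\<tau>)\<close>; the term with \<open>\<theta>\<close> differs from the
  integral up to \<open>\<tau>\<close> by \<open>O(\<epsilon>)\<close>.
\<close>

theorem integral_test_function_evolution:
  assumes f: "test_function f" and \<tau>: "\<tau> \<ge> 0"
  shows "(\<integral>x. f x \<partial>q \<tau>) = (\<integral>x. f x \<partial>q 0) + (LINT s|lborel. indicator {0..\<tau>} s * flux (grad f) (q s))"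
proof -
  note sf = test_functionD(1)[OF f]
  obtain L where L: "L > 0" "\<And>x. norm (grad f x) \<le> L"
    "\<And>x y. norm (grad f x - grad f y) \<le> L * norm (x - y)"
    using test_function_grad_bounds[OF f] by metis
  obtain Bf where Bf: "Bf > 0" "\<And>x. \<bar>f x\<bar> \<le> Bf" using test_function_bounded[OF f] by metis
  obtain b where b: "b > 0" "\<And>s. \<bar>step' s\<bar> \<le> b" "\<And>s. \<bar>step'' s\<bar> \<le> b"
    "\<And>s s'. \<bar>step' s - step' s'\<bar> \<le> b * \<bar>s - s'\<bar>"
    using step_derivative_bounds by metis
  have fm: "f \<in> borel_measurable borel" and gm: "grad f \<in> borel_measurable borel"
    by (auto intro!: borel_measurable_continuous_onI smooth_continuous[OF sf] continuous_on_grad[OF sf])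
  define F where "F t = (\<integral>x. f x \<partial>extended t)" for t
  define A where "A t = flux (grad f) (extended t)" for t
  have Fcont: "continuous_on UNIV F"
    unfolding F_def[abs_def]
    by (rule extended_continuous[OF smooth_continuous[OF sf] test_function_vanishes_at_infinity[OF f]])
  have Am: "A \<in> borel_measurable borel"
    unfolding A_def[abs_def] by (rule extended_flux_measurable[OF gm L(2)])
  obtain M where M: "M \<ge> 0" "AE s in lborel. s \<in> {0..\<tau> + 1} \<longrightarrow> mass (q s) \<le> M"
    by (rule mass_AE_bounded)
  define MA where "MA = L * (B * M) * M"
  have MA: "MA \<ge> 0" using L(1) B_nonneg M(1) by (simp add: MA_def)
  have Ab: "AE s in lborel. s \<in> {0..\<tau> + 1} \<longrightarrow> \<bar>A s\<bar> \<le> MA"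
    using flux_AE_bounded[OF M gm L(2)] by eventually_elim (auto simp: A_def MA_def)
  define I where "I = (LINT s|lborel. indicator {0..\<tau>} s * A s)"
  \<comment> \<open>Half of \<open>\<delta>\<close> pays for the oscillation of \<open>F\<close>, half for the flux after time \<open>\<tau>\<close>.\<close>
  have approx: "\<bar>F \<tau> - F 0 - I\<bar> \<le> \<delta>" if \<delta>: "\<delta> > 0" for \<delta>
  proof -
    define \<eta> where "\<eta> = \<delta> / (2 * b)"
    have \<eta>: "\<eta> > 0" using \<delta> b(1) by (simp add: \<eta>_def)
    have "isCont F \<tau>" using Fcont by (simp add: continuous_on_eq_continuous_at)
    then obtain d where d: "d > 0" "\<And>t. \<bar>t - \<tau>\<bar> < d \<Longrightarrow> \<bar>F t - F \<tau>\<bar> < \<eta>"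
      using \<eta> unfolding continuous_at_eps_delta dist_real_def by blast
    define \<epsilon> where "\<epsilon> = min 1 (min (d / 2) (\<delta> / (2 * (MA + 1))))"
    have \<epsilon>: "\<epsilon> > 0" "\<epsilon> \<le> 1" "\<epsilon> < d" using d(1) \<delta> MA by (auto simp: \<epsilon>_def)
    have half: "m * (\<delta> / (2 * m)) = \<delta> / 2" if "m > 0" for m using that by simp
    have "MA * \<epsilon> \<le> (MA + 1) * (\<delta> / (2 * (MA + 1)))"
      using MA \<epsilon>(1) by (intro mult_mono) (auto simp: \<epsilon>_def)
    also have "\<dots> = \<delta> / 2" using MA by (intro half) simp
    finally have \<epsilon>4: "MA * \<epsilon> \<le> \<delta> / 2" .
    \<comment> \<open>The factor \<open>step (s + 2)\<close> is one for nonnegative times; it only makes the support compact.\<close>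
    define \<theta> where "\<theta> s = step (s + 2) * (1 - step ((s - \<tau>) / \<epsilon>))" for s
    have lin: "bounded_linear (\<lambda>s::real. s / \<epsilon>)" by (rule bounded_linear_divide)
    have "smooth (\<lambda>s. step (s / \<epsilon> + (- \<tau> / \<epsilon>)))" by (rule smooth_affine[OF smooth_step lin])
    then have "smooth (\<lambda>s. step ((s - \<tau>) / \<epsilon>))" by (simp add: diff_divide_distrib)
    then have "smooth \<theta>"
      unfolding \<theta>_def[abs_def]
      by (intro smooth_mult smooth_diff smooth_const smooth_affine[OF smooth_step bounded_linear_ident])
    moreover have "\<theta> s = 0" if "norm s > \<tau> + 3" for s
    proof (cases "s \<le> -2")
      case False
      then have "s - \<tau> \<ge> \<epsilon>" using that \<tau> \<epsilon> by (auto simp: abs_if split: if_splits)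
      then have "(s - \<tau>) / \<epsilon> \<ge> 1" using \<epsilon>(1) by (simp add: pos_le_divide_eq)
      then show ?thesis by (simp add: \<theta>_def)
    qed (simp add: \<theta>_def)
    ultimately have \<theta>test: "test_function \<theta>" by (rule test_functionI)
    define \<theta>' where "\<theta>' s = - (step' ((s - \<tau>) / \<epsilon>) / \<epsilon>)" for s
    have \<theta>0: "\<theta> s = 1 - step ((s - \<tau>) / \<epsilon>)" if "s \<ge> 0" for s using that by (simp add: \<theta>_def)
    have der: "((\<lambda>s. (s - \<tau>) / \<epsilon>) has_real_derivative 1 / \<epsilon>) (at s)" for s
      using \<epsilon>(1) by (auto intro!: derivative_eq_intros)
    have d1: "((\<lambda>s. 1 - step ((s - \<tau>) / \<epsilon>)) has_real_derivative \<theta>' s) (at s)" for s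
      using DERIV_diff[OF DERIV_const[of 1] DERIV_chain2[OF DERIV_step der], of s] by (simp add: \<theta>'_def)
    have d2: "((\<lambda>s. step (s + 2)) has_real_derivative step' (s + 2)) (at s)" for s
      using DERIV_step[of "s + 2"] by (simp add: DERIV_shift)
    have grad\<theta>: "grad \<theta> s = \<theta>' s" if "s \<ge> 0" for s
    proof (rule grad_unique)
      have "(\<theta> has_real_derivative step (s + 2) * \<theta>' s + step' (s + 2) * (1 - step ((s - \<tau>) / \<epsilon>))) (at s)"
        unfolding \<theta>_def[abs_def] using DERIV_mult'[OF d2 d1] by simp
      then have "(\<theta> has_real_derivative \<theta>' s) (at s)"
        using that by (simp add: step'_eq_0)
      then show "(\<theta> has_derivative (\<bullet>) (\<theta>' s)) (at s)"
        by (simp add: has_field_derivative_def inner_real_def[abs_def] fun_eq_iff)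
    qed
    let ?\<phi> = "\<lambda>p :: (real^2) \<times> real. f (fst p) * \<theta> (snd p)"
    have inner: "(LINT x|q t. frechet_derivative ?\<phi> (at (x, t)) (0, 1)
          + frechet_derivative ?\<phi> (at (x, t)) (LINT y|q t. K (x - y), 0)) = \<theta>' t * F t + \<theta> t * A t" if t: "t \<ge> 0" for t
    proof -
      note \<mu> = radon[OF t]
      have i1: "integrable (q t) f" by (rule integrable_bounded_radon[OF \<mu> fm]) (use Bf in auto)
      have "\<bar>grad f x \<bullet> (LINT y|q t. K (x - y))\<bar> \<le> L * (B * mass (q t))" for x
        by (rule order_trans[OF Cauchy_Schwarz_ineq2])
           (use L velocity_field_bounded[OF \<mu> gm L(2)] in \<open>auto intro!: mult_mono\<close>)
      then have i2: "integrable (q t) (\<lambda>x. grad f x \<bullet> (LINT y|q t. K (x - y)))"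
        by (intro integrable_bounded_radon[OF \<mu>, where C = "L * (B * mass (q t))"] borel_measurable_inner gm
            velocity_field_measurable[OF \<mu> gm L(2)]) auto
      have "(LINT x|q t. frechet_derivative ?\<phi> (at (x, t)) (0, 1)
          + frechet_derivative ?\<phi> (at (x, t)) (LINT y|q t. K (x - y), 0))
        = (LINT x|q t. \<theta>' t * f x + \<theta> t * (grad f x \<bullet> (LINT y|q t. K (x - y))))"
        unfolding test_function_prod(2)[OF f \<theta>test] grad\<theta>[OF t] by (simp add: mult.commute)
      also have "\<dots> = \<theta>' t * (LINT x|q t. f x) + \<theta> t * (LINT x|q t. grad f x \<bullet> (LINT y|q t. K (x - y)))"
        using i1 i2 by simp
      finally show ?thesis using t by (simp add: F_def A_def flux_def)
    qed
    have "(LINT t:{0..}|lborel. \<theta>' t * F t + \<theta> t * A t) + F 0 * \<theta> 0 = 0"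
    proof -
      have "(LINT t:{0..}|lborel. \<theta>' t * F t + \<theta> t * A t) =
         (LINT t:{0..}|lborel. (LINT x|q t. frechet_derivative ?\<phi> (at (x, t)) (0, 1)
          + frechet_derivative ?\<phi> (at (x, t)) (LINT y|q t. K (x - y), 0)))"
        by (rule set_lebesgue_integral_cong) (use inner in auto)
      moreover have "F 0 = (LINT x|q 0. f x)" by (simp add: F_def)
      ultimately show ?thesis using weak[OF test_function_prod(1)[OF f \<theta>test]] by simp
    qed
    moreover have "\<theta> 0 = 1" using \<tau> \<epsilon>(1) by (simp add: \<theta>0 divide_nonpos_pos)
    moreover define h1 where "h1 t = indicator {\<tau>..\<tau> + \<epsilon>} t * (\<theta>' t * F t)" for t
    moreover define h2 where "h2 t = indicator {0..\<tau>} t * A t" for t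
    moreover define h3 where "h3 t = indicator {\<tau>..\<tau> + \<epsilon>} t * (if t = \<tau> then 0 else \<theta> t * A t)" for t
    moreover have "indicator {0..} t *\<^sub>R (\<theta>' t * F t + \<theta> t * A t) = h1 t + h2 t + h3 t" for t
    proof -
      consider "t < 0" | "0 \<le> t" "t < \<tau>" | "t = \<tau>" | "\<tau> < t" "t \<le> \<tau> + \<epsilon>" | "\<tau> + \<epsilon> < t" by linarith
      then show ?thesis
      proof cases
        case 2
        then have "(t - \<tau>) / \<epsilon> \<le> 0" using \<epsilon>(1) by (simp add: divide_nonpos_pos)
        then have "\<theta>' t = 0" "\<theta> t = 1" using 2 by (simp_all add: \<theta>'_def \<theta>0 step'_eq_0)
        then show ?thesis using 2 by (simp add: h1_def h2_def h3_def)
      next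
        case 3
        then have "\<theta>' t = 0" "\<theta> t = 1" using \<tau> by (simp_all add: \<theta>'_def \<theta>0 step'_eq_0)
        then show ?thesis using 3 \<tau> by (simp add: h1_def h2_def h3_def)
      next
        case 5
        then have "(t - \<tau>) / \<epsilon> \<ge> 1" using \<epsilon>(1) by (simp add: pos_le_divide_eq)
        then have "\<theta>' t = 0" "\<theta> t = 0" using 5 \<tau> \<epsilon>(1) by (simp_all add: \<theta>'_def \<theta>0 step'_eq_0)
        then show ?thesis using 5 \<epsilon>(1) by (simp add: h1_def h2_def h3_def)
      qed (use \<tau> \<epsilon>(1) in \<open>simp_all add: h1_def h2_def h3_def\<close>)
    qed
    ultimately have eq: "(LINT t|lborel. h1 t + h2 t + h3 t) + F 0 = 0"
      by (simp add: set_lebesgue_integral_def)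
    have step'cont: "continuous_on UNIV step'" by (rule smooth_continuous[OF smooth_step'])
    have \<theta>'cont: "continuous_on S \<theta>'" for S
      unfolding \<theta>'_def[abs_def]
      by (intro continuous_intros continuous_on_compose2[OF step'cont]) (use \<epsilon>(1) in auto)
    have i\<theta>': "integrable lborel (\<lambda>t. indicator {\<tau>..\<tau> + \<epsilon>} t * \<theta>' t)"
      using borel_integrable_atLeastAtMost'[OF \<theta>'cont, of \<tau> "\<tau> + \<epsilon>"] by (simp add: set_integrable_def)
    have ih1: "integrable lborel h1"
      using borel_integrable_atLeastAtMost'[of \<tau> "\<tau> + \<epsilon>" "\<lambda>t. \<theta>' t * F t"]
        continuous_on_mult[OF \<theta>'cont continuous_on_subset[OF Fcont subset_UNIV]]
      by (simp add: set_integrable_def h1_def[abs_def])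
    have ih2: "integrable lborel h2"
      unfolding h2_def by (rule integrable_Icc_AE_bounded[OF Am, where c = MA])
        (use Ab in \<open>auto elim!: eventually_mono\<close>)
    have \<theta>m [measurable]: "\<theta> \<in> borel_measurable borel"
      by (intro borel_measurable_continuous_onI smooth_continuous[OF test_functionD(1)[OF \<theta>test]])
    have \<theta>01: "\<bar>\<theta> t\<bar> \<le> 1" for t
      unfolding \<theta>_def abs_mult by (rule mult_le_one) auto
    have h3b: "AE t in lborel. t \<in> {\<tau>..\<tau> + \<epsilon>} \<longrightarrow> \<bar>if t = \<tau> then 0 else \<theta> t * A t\<bar> \<le> MA"
      using Ab
    proof eventually_elim
      case (elim t)
      show ?case
      proof
        assume "t \<in> {\<tau>..\<tau> + \<epsilon>}"
        then have "\<bar>A t\<bar> \<le> MA" using elim \<tau> \<epsilon> by auto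
        then have "\<bar>\<theta> t\<bar> * \<bar>A t\<bar> \<le> 1 * MA" using \<theta>01[of t] by (intro mult_mono) auto
        then show "\<bar>if t = \<tau> then 0 else \<theta> t * A t\<bar> \<le> MA" using MA by (simp add: abs_mult)
      qed
    qed
    have ih3: "integrable lborel h3"
      unfolding h3_def by (rule integrable_Icc_AE_bounded[OF _ h3b]) (use Am in measurable)
    have h3: "\<bar>integral\<^sup>L lborel h3\<bar> \<le> \<delta> / 2"
      using abs_integral_Icc_le[OF _ MA h3b] \<epsilon>(1) \<epsilon>4 by (simp add: h3_def[abs_def])
    have "(LINT t|lborel. indicator {\<tau>..\<tau> + \<epsilon>} t *\<^sub>R \<theta>' t) = (1 - step ((\<tau> + \<epsilon> - \<tau>) / \<epsilon>)) - (1 - step ((\<tau> - \<tau>) / \<epsilon>))"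
      using \<epsilon>(1) d1
      by (intro integral_FTC_atLeastAtMost \<theta>'cont)
         (auto simp: has_real_derivative_iff_has_vector_derivative[symmetric] intro: has_field_derivative_at_within)
    then have "(LINT t|lborel. indicator {\<tau>..\<tau> + \<epsilon>} t * \<theta>' t) = -1" using \<epsilon>(1) by simp
    then have "integral\<^sup>L lborel h1 + F \<tau> = (LINT t|lborel. h1 t - (indicator {\<tau>..\<tau> + \<epsilon>} t * \<theta>' t) * F \<tau>)"
      using ih1 i\<theta>' by simp
    also have "\<dots> = (LINT t|lborel. indicator {\<tau>..\<tau> + \<epsilon>} t * (\<theta>' t * (F t - F \<tau>)))"
      by (simp add: h1_def algebra_simps)
    finally have h1eq: "integral\<^sup>L lborel h1 + F \<tau> = (LINT t|lborel. indicator {\<tau>..\<tau> + \<epsilon>} t * (\<theta>' t * (F t - F \<tau>)))" .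
    have "\<bar>\<theta>' t * (F t - F \<tau>)\<bar> \<le> b / \<epsilon> * \<eta>" if "t \<in> {\<tau>..\<tau> + \<epsilon>}" for t
      unfolding abs_mult
    proof (rule mult_mono)
      show "\<bar>\<theta>' t\<bar> \<le> b / \<epsilon>" using b(2)[of "(t - \<tau>) / \<epsilon>"] \<epsilon>(1) by (simp add: \<theta>'_def divide_right_mono)
      show "\<bar>F t - F \<tau>\<bar> \<le> \<eta>" using d(2)[of t] that \<epsilon>(3) by auto
    qed (use b(1) \<epsilon>(1) in auto)
    then have "\<bar>integral\<^sup>L lborel h1 + F \<tau>\<bar> \<le> b / \<epsilon> * \<eta> * (\<tau> + \<epsilon> - \<tau>)"
      unfolding h1eq using \<epsilon>(1) b(1) \<eta> by (intro abs_integral_Icc_le) auto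
    also have "\<dots> = \<delta> / 2" using \<epsilon>(1) b(1) by (simp add: \<eta>_def)
    finally have h1: "\<bar>integral\<^sup>L lborel h1 + F \<tau>\<bar> \<le> \<delta> / 2" .
    have "integral\<^sup>L lborel h1 + I + integral\<^sup>L lborel h3 + F 0 = 0"
    proof -
      have "I = integral\<^sup>L lborel h2" by (simp add: I_def h2_def[abs_def])
      then show ?thesis using eq ih1 ih2 ih3 by simp
    qed
    then show ?thesis using h1 h3 by linarith
  qed
  have "\<bar>F \<tau> - F 0 - I\<bar> \<le> 0"
    by (rule field_le_epsilon) (use approx in simp)
  moreover have "I = (LINT s|lborel. indicator {0..\<tau>} s * flux (grad f) (q s))"
    unfolding I_def by (rule Bochner_Integration.integral_cong) (auto simp: A_def indicator_def)
  ultimately show ?thesis using \<tau> by (simp add: F_def)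
qed

end

section \<open>Radial transport at a fixed time\<close>

text \<open>
  Splitting the velocity into the parts produced by two regions amounts to restricting the
  measure. The restriction is again a bounded Radon measure, so everything known about fluxes
  applies to it.
\<close>

definition restricted :: "'a set \<Rightarrow> 'a measure \<Rightarrow> 'a measure" where
  "restricted Q \<mu> = density \<mu> (indicator Q)"

lemma restricted:
  fixes \<mu> :: "'a::euclidean_space measure"
  assumes \<mu>: "bounded_radon_measure \<mu>" and Q: "Q \<in> sets borel"
  shows bounded_radon_restricted: "bounded_radon_measure (restricted Q \<mu>)"
    and measure_restricted: "A \<in> sets borel \<Longrightarrow> measure (restricted Q \<mu>) A = measure \<mu> (Q \<inter> A)"
    and integral_restricted: "f \<in> borel_measurable borel \<Longrightarrow>
      (\<integral>x. f x \<partial>restricted Q \<mu>) = (\<integral>x. indicator Q x *\<^sub>R (f x :: 'b::{banach, second_countable_topology}) \<partial>\<mu>)"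
proof -
  note D = bounded_radon_measureD[OF \<mu>]
  interpret finite_measure \<mu> by (rule D)
  have Qm: "Q \<in> sets \<mu>" using Q by (simp add: D)
  have em: "emeasure (restricted Q \<mu>) A = emeasure \<mu> (Q \<inter> A)" if "A \<in> sets borel" for A
  proof -
    have "emeasure (restricted Q \<mu>) A = (\<integral>\<^sup>+x. indicator Q x * indicator A x \<partial>\<mu>)"
      unfolding restricted_def using that Qm by (intro emeasure_density) (auto simp: D)
    also have "\<dots> = (\<integral>\<^sup>+x. indicator (Q \<inter> A) x \<partial>\<mu>)"
      by (intro nn_integral_cong) (auto simp: indicator_def)
    also have "\<dots> = emeasure \<mu> (Q \<inter> A)" using that Q by (intro nn_integral_indicator) (auto simp: D)
    finally show ?thesis .
  qed
  show "bounded_radon_measure (restricted Q \<mu>)"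
    unfolding bounded_radon_measure_def
  proof
    show "sets (restricted Q \<mu>) = sets borel" by (simp add: restricted_def D)
    have "space (restricted Q \<mu>) = UNIV" by (simp add: restricted_def D)
    then show "finite_measure (restricted Q \<mu>)"
      using em[of UNIV] by (intro finite_measureI) (simp add: emeasure_eq_measure)
  qed
  show "measure (restricted Q \<mu>) A = measure \<mu> (Q \<inter> A)" if "A \<in> sets borel"
    using em[OF that] by (simp add: measure_def)
  show "(\<integral>x. f x \<partial>restricted Q \<mu>) = (\<integral>x. indicator Q x *\<^sub>R f x \<partial>\<mu>)" if f: "f \<in> borel_measurable borel" for f :: "'a \<Rightarrow> 'b"
    unfolding restricted_def ennreal_indicator[symmetric]
    using f Qm by (intro integral_density) (auto simp: D)
qed

lemma abs_integral_le_measure: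
  fixes f :: "'a::euclidean_space \<Rightarrow> real"
  assumes \<mu>: "bounded_radon_measure \<mu>" and P: "P \<in> sets borel" and c: "0 \<le> c"
    and f: "\<And>x. \<bar>f x\<bar> \<le> c * indicator P x"
  shows "\<bar>\<integral>x. f x \<partial>\<mu>\<bar> \<le> c * measure \<mu> P"
proof (cases "integrable \<mu> f")
  case True
  interpret finite_measure \<mu> by (rule bounded_radon_measureD[OF \<mu>])
  have Pm: "P \<in> sets \<mu>" using P by (simp add: bounded_radon_measureD[OF \<mu>])
  have "\<bar>\<integral>x. f x \<partial>\<mu>\<bar> \<le> (\<integral>x. \<bar>f x\<bar> \<partial>\<mu>)" by (rule integral_abs_bound)
  also have "\<dots> \<le> (\<integral>x. c * indicator P x \<partial>\<mu>)"
    using True Pm f by (intro integral_mono integrable_abs) (auto intro!: integrable_mult_right integrable_real_indicator simp: emeasure_eq_measure)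
  also have "\<dots> = c * measure \<mu> P" using Pm by simp
  finally show ?thesis .
qed (use c in \<open>simp add: not_integrable_integral_eq\<close>)

context vortex_kernel
begin

lemma le_one_plus_square: "n \<le> 1 + n\<^sup>2" for n :: real
  using zero_le_power2[of "n - 1 / 2"] by (simp add: power2_eq_square algebra_simps)

text \<open>
  Symmetrization turns a bound for single interactions into a bound by masses of regions: the
  two products of indicators contribute equally, which cancels the factor one half.
\<close>

lemma flux_le_symmetric:
  assumes \<mu>: "bounded_radon_measure \<mu>" and g: "g \<in> borel_measurable borel" "\<And>x. norm (g x) \<le> C"
    and P: "P \<in> sets borel" and Q: "Q \<in> sets borel" and L: "0 \<le> L"
    and le: "\<And>x y. \<bar>(g x - g y) \<bullet> K (x - y)\<bar> \<le> L * (indicator P x * indicator Q y + indicator Q x * indicator P y)"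
  shows "\<bar>flux g \<mu>\<bar> \<le> L * measure \<mu> P * measure \<mu> Q"
proof -
  note D = bounded_radon_measureD[OF \<mu>]
  interpret finite_measure \<mu> by (rule D)
  interpret PP: pair_sigma_finite \<mu> \<mu> ..
  have rect_int: "integrable (\<mu> \<Otimes>\<^sub>M \<mu>) (\<lambda>p. indicator R (fst p) * indicator S (snd p) :: real)"
    and rect: "(\<integral>p. (indicator R (fst p) * indicator S (snd p) :: real) \<partial>(\<mu> \<Otimes>\<^sub>M \<mu>)) = measure \<mu> R * measure \<mu> S"
    if R: "R \<in> sets borel" and S: "S \<in> sets borel" for R S
  proof -
    show i: "integrable (\<mu> \<Otimes>\<^sub>M \<mu>) (\<lambda>p. indicator R (fst p) * indicator S (snd p) :: real)"
      by (rule integrable_pair_bounded[OF \<mu> g, where c = 1]) (use R S in \<open>auto simp: indicator_def\<close>)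
    have "(\<integral>p. (indicator R (fst p) * indicator S (snd p) :: real) \<partial>(\<mu> \<Otimes>\<^sub>M \<mu>)) = (\<integral>x. (\<integral>y. (indicator R x * indicator S y :: real) \<partial>\<mu>) \<partial>\<mu>)"
      using PP.integral_fst'[OF i] by simp
    also have "\<dots> = measure \<mu> R * measure \<mu> S" using R S by (simp add: D)
    finally show "(\<integral>p. (indicator R (fst p) * indicator S (snd p) :: real) \<partial>(\<mu> \<Otimes>\<^sub>M \<mu>)) = measure \<mu> R * measure \<mu> S" .
  qed
  let ?E = "\<lambda>p. (g (fst p) - g (snd p)) \<bullet> K (fst p - snd p)"
  have iE: "integrable (\<mu> \<Otimes>\<^sub>M \<mu>) ?E"
  proof (rule integrable_pair_bounded[OF \<mu> g])
    show "?E \<in> borel_measurable (borel \<Otimes>\<^sub>M borel)" using g(1)[measurable] by measurable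
    show "\<bar>?E p\<bar> \<le> L * 2" for p
      by (rule order_trans[OF le]) (use L in \<open>auto simp: indicator_def intro!: mult_left_mono\<close>)
  qed
  have "\<bar>\<integral>p. ?E p \<partial>(\<mu> \<Otimes>\<^sub>M \<mu>)\<bar> \<le> (\<integral>p. \<bar>?E p\<bar> \<partial>(\<mu> \<Otimes>\<^sub>M \<mu>))" by (rule integral_abs_bound)
  also have "\<dots> \<le> (\<integral>p. L * (indicator P (fst p) * indicator Q (snd p) + indicator Q (fst p) * indicator P (snd p)) \<partial>(\<mu> \<Otimes>\<^sub>M \<mu>))"
    by (rule integral_mono[OF integrable_abs[OF iE]]) (use rect_int[OF P Q] rect_int[OF Q P] le in auto)
  also have "\<dots> = L * (measure \<mu> P * measure \<mu> Q + measure \<mu> Q * measure \<mu> P)"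
    using rect_int[OF P Q] rect_int[OF Q P] rect[OF P Q] rect[OF Q P] by simp
  finally show ?thesis
    unfolding flux_symmetrized[OF \<mu> g] by simp
qed

text \<open>
  If \<open>g\<close> lives in \<open>Q\<close>, the interactions inside \<open>Q\<close> form a flux of the restricted measure and can
  be symmetrized on their own.
\<close>

lemma flux_split:
  assumes \<mu>: "bounded_radon_measure \<mu>" and g: "g \<in> borel_measurable borel" "\<And>x. norm (g x) \<le> C"
    and Q: "Q \<in> sets borel" and off: "\<And>x. x \<notin> Q \<Longrightarrow> g x = 0"
  shows "flux g \<mu> = (\<integral>x. g x \<bullet> (\<integral>y. K (x - y) \<partial>restricted (- Q) \<mu>) \<partial>\<mu>) + flux g (restricted Q \<mu>)"
proof -
  have Qc: "- Q \<in> sets borel" using Q by auto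
  note \<mu>1 = bounded_radon_restricted[OF \<mu> Qc] and \<mu>2 = bounded_radon_restricted[OF \<mu> Q]
  let ?V1 = "\<lambda>x. \<integral>y. K (x - y) \<partial>restricted (- Q) \<mu>" and ?V2 = "\<lambda>x. \<integral>y. K (x - y) \<partial>restricted Q \<mu>"
  have m: "(\<lambda>y. K (x - y)) \<in> borel_measurable borel" for x by measurable
  have ik: "integrable \<mu> (\<lambda>y. indicator R y *\<^sub>R K (x - y))" if "R \<in> sets borel" for R x
    by (rule integrable_bounded_radon[OF \<mu>, where C = B])
       (use that K_bounded B_nonneg in \<open>auto simp: indicator_def\<close>)
  have V: "(\<integral>y. K (x - y) \<partial>\<mu>) = ?V1 x + ?V2 x" for x
  proof -
    have "?V1 x + ?V2 x = (\<integral>y. indicator (- Q) y *\<^sub>R K (x - y) + indicator Q y *\<^sub>R K (x - y) \<partial>\<mu>)"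
      unfolding integral_restricted[OF \<mu> Qc m] integral_restricted[OF \<mu> Q m]
      using ik[OF Qc] ik[OF Q] by simp
    also have "\<dots> = (\<integral>y. K (x - y) \<partial>\<mu>)"
      by (rule Bochner_Integration.integral_cong) (auto simp: indicator_def)
    finally show ?thesis by simp
  qed
  have Vm: "?V1 \<in> borel_measurable borel" "?V2 \<in> borel_measurable borel"
    using velocity_field_measurable[OF \<mu>1 g] velocity_field_measurable[OF \<mu>2 g] by auto
  have iV: "integrable \<mu> (\<lambda>x. g x \<bullet> V x)" if "V \<in> borel_measurable borel" "\<And>x. norm (V x) \<le> c" for V c
  proof (rule integrable_bounded_radon[OF \<mu>])
    show "(\<lambda>x. g x \<bullet> V x) \<in> borel_measurable borel" using that(1)[measurable] g(1)[measurable] by measurable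
    show "norm (g x \<bullet> V x) \<le> C * c" for x
      unfolding real_norm_def
      by (rule order_trans[OF Cauchy_Schwarz_ineq2])
         (intro mult_mono g that order_trans[OF norm_ge_zero g(2)] norm_ge_zero)
  qed
  have "flux g \<mu> = (\<integral>x. g x \<bullet> ?V1 x + g x \<bullet> ?V2 x \<partial>\<mu>)"
    unfolding flux_def V by (simp add: inner_add_right)
  also have "\<dots> = (\<integral>x. g x \<bullet> ?V1 x \<partial>\<mu>) + (\<integral>x. g x \<bullet> ?V2 x \<partial>\<mu>)"
    by (intro Bochner_Integration.integral_add iV[OF Vm(1) velocity_field_bounded[OF \<mu>1 g]]
        iV[OF Vm(2) velocity_field_bounded[OF \<mu>2 g]])
  also have "(\<integral>x. g x \<bullet> ?V2 x \<partial>\<mu>) = (\<integral>x. indicator Q x *\<^sub>R (g x \<bullet> ?V2 x) \<partial>\<mu>)"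
    by (rule Bochner_Integration.integral_cong) (use off in \<open>auto simp: indicator_def\<close>)
  also have "\<dots> = flux g (restricted Q \<mu>)"
    unfolding flux_def
    by (rule integral_restricted[OF \<mu> Q, symmetric]) (use Vm(2)[measurable] g(1)[measurable] in measurable)
  finally show ?thesis .
qed

lemma D_nonneg: "0 \<le> D"
  using order_trans[OF abs_ge_zero k_far[of 1]] by simp

text \<open>
  Both values are compared with the profile \<open>1 / (2\<pi> r\<^sup>2)\<close> of a point vortex, at \<open>s\<close> and at \<open>r\<close>.
\<close>

lemma k_difference:
  assumes X: "r > 0" and s: "r / 2 \<le> s" and d: "\<bar>s - r\<bar> \<le> y"
  shows "\<bar>k s - k r\<bar> \<le> (9 * D + 6 * y) / r ^ 3"
proof -
  define c where "c = 1 / (2 * pi)"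
  have c: "0 \<le> c" "c \<le> 1" using pi_gt3 by (auto simp: c_def)
  have sp: "s > 0" using X s by linarith
  have inv: "1 / s \<le> 2 / r" using X s sp by (simp add: field_simps)
  have inv3: "1 / s ^ 3 \<le> 8 / r ^ 3"
    using power_mono[OF inv, of 3] sp by (simp add: power_divide)
  have "\<bar>k s - c / s\<^sup>2\<bar> = \<bar>k s * s\<^sup>2 - c\<bar> / s\<^sup>2"
    using sp by (simp add: abs_if field_simps)
  also have "\<dots> \<le> (D / s) / s\<^sup>2"
    using k_far[OF sp] by (intro divide_right_mono) (auto simp: c_def)
  also have "\<dots> = D * (1 / s ^ 3)" by (simp add: power2_eq_square power3_eq_cube)
  also have "\<dots> \<le> D * (8 / r ^ 3)" using inv3 D_nonneg by (intro mult_left_mono)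
  finally have 1: "\<bar>k s - c / s\<^sup>2\<bar> \<le> 8 * D / r ^ 3" by (simp add: mult.commute)
  have "\<bar>k r - c / r\<^sup>2\<bar> = \<bar>k r * r\<^sup>2 - c\<bar> / r\<^sup>2"
    using X by (simp add: abs_if field_simps)
  also have "\<dots> \<le> (D / r) / r\<^sup>2"
    using k_far[OF X] by (intro divide_right_mono) (auto simp: c_def)
  finally have 2: "\<bar>k r - c / r\<^sup>2\<bar> \<le> D / r ^ 3" by (simp add: power2_eq_square power3_eq_cube)
  have "\<bar>c / s\<^sup>2 - c / r\<^sup>2\<bar> = c * \<bar>r - s\<bar> * (1 / s\<^sup>2 / r + 1 / s / r\<^sup>2)"
  proof -
    have "c / s\<^sup>2 - c / r\<^sup>2 = c * (r - s) * (1 / s\<^sup>2 / r + 1 / s / r\<^sup>2)"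
      using X sp by (simp add: field_simps power2_eq_square)
    moreover have "0 \<le> 1 / s\<^sup>2 / r + 1 / s / r\<^sup>2" using X sp by simp
    ultimately show ?thesis using c by (simp add: abs_mult)
  qed
  also have "\<dots> \<le> 1 * y * (4 / r ^ 3 + 2 / r ^ 3)"
  proof (intro mult_mono add_mono)
    have "1 / s\<^sup>2 \<le> 4 / r\<^sup>2" using power_mono[OF inv, of 2] sp by (simp add: power_divide)
    then have "1 / s\<^sup>2 / r \<le> 4 / r\<^sup>2 / r" using X by (intro divide_right_mono) auto
    then show "1 / s\<^sup>2 / r \<le> 4 / r ^ 3" by (simp add: power2_eq_square power3_eq_cube)
    have "1 / s / r\<^sup>2 \<le> 2 / r / r\<^sup>2" using inv by (intro divide_right_mono) auto
    then show "1 / s / r\<^sup>2 \<le> 2 / r ^ 3" by (simp add: power2_eq_square power3_eq_cube)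
  qed (use c d X sp in auto)
  finally have 3: "\<bar>c / s\<^sup>2 - c / r\<^sup>2\<bar> \<le> 6 * y / r ^ 3" by (simp add: add_divide_distrib[symmetric] mult.commute)
  have triangle: "\<bar>a - d\<bar> \<le> \<bar>a - b\<bar> + \<bar>b - e\<bar> + \<bar>d - e\<bar>" for a b d e :: real by linarith
  have "\<bar>k s - k r\<bar> \<le> 8 * D / r ^ 3 + 6 * y / r ^ 3 + D / r ^ 3"
    by (rule order_trans[OF triangle add_mono[OF add_mono[OF 1 3] 2]])
  also have "\<dots> = (9 * D + 6 * y) / r ^ 3"
    unfolding add_divide_distrib[symmetric] by (rule arg_cong[of _ _ "\<lambda>z. z / r ^ 3"]) simp
  finally show ?thesis .
qed

text \<open>
  With \<open>X = x - c\<close> and \<open>Y = y - c\<close>, the radial part of one interaction is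
  \<open>k \<bar>X - Y\<bar> (Y \<bullet> perp X)\<close>. Replacing \<open>k \<bar>X - Y\<bar>\<close> by \<open>k \<bar>X\<bar>\<close> costs \<open>O((\<bar>Y\<bar> + \<bar>Y\<bar>\<^sup>2) / \<bar>X\<bar>\<^sup>2)\<close> for
  \<open>\<bar>Y\<bar> \<le> r/2\<close>. The replaced term, integrated over the whole plane, vanishes because \<open>c\<close> is the
  centre of mass, and its part over \<open>\<bar>Y\<bar> > r/2\<close> is controlled by the moment of inertia.
\<close>

lemma far_field_radial:
  assumes \<mu>: "bounded_radon_measure \<mu>"
    and J: "integrable \<mu> (\<lambda>y. (norm (y - c))\<^sup>2)" "(\<integral>y. (norm (y - c))\<^sup>2 \<partial>\<mu>) \<le> J"
    and centre: "\<And>e. (\<integral>y. (y - c) \<bullet> e \<partial>\<mu>) = 0"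
    and r: "0 < r" "r \<le> norm (x - c)"
  shows "\<bar>(x - c) \<bullet> (\<integral>y. K (x - y) \<partial>restricted {y. norm (y - c) \<le> r / 2} \<mu>)\<bar>
    \<le> (9 * D + 8) * (mass \<mu> + 2 * J) / (r * norm (x - c))"
proof -
  note Dm = bounded_radon_measureD[OF \<mu>]
  interpret finite_measure \<mu> by (rule Dm)
  define X where "X = x - c"
  define R where "R = norm X"
  have R: "R > 0" "r \<le> R" using r by (auto simp: R_def X_def)
  let ?S = "{y. norm (y - c) \<le> r / 2}"
  have S: "?S \<in> sets borel" by measurable
  \<comment> \<open>The subtracted term has integral zero, so \<open>h\<close> has the integral that is to be estimated.\<close>
  define h where "h y = indicator ?S y * (X \<bullet> K (x - y)) - k R * ((y - c) \<bullet> perp X)" for y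
  have XK: "X \<bullet> K (x - y) = k (norm (x - y)) * ((y - c) \<bullet> perp X)" for y
  proof -
    have e: "x - y = X - (y - c)" by (simp add: X_def)
    show ?thesis unfolding K_eq
      by (simp only: e perp_diff inner_scaleR_right inner_diff_right perp_inner_self) (simp add: inner_2 algebra_simps)
  qed
  have bound: "\<bar>h y\<bar> \<le> (9 * D + 8) / (r * R) * (1 + 2 * (norm (y - c))\<^sup>2)" for y
  proof -
    define n where "n = norm (y - c)"
    have n: "n \<ge> 0" "n \<le> 1 + n\<^sup>2" using le_one_plus_square[of n] by (auto simp: n_def)
    have ip: "\<bar>(y - c) \<bullet> perp X\<bar> \<le> n * R"
      using Cauchy_Schwarz_ineq2[of "y - c" "perp X"] by (simp add: n_def R_def)
    have fin: "(9 * D * n + 8 * n\<^sup>2) / (r * R) \<le> (9 * D + 8) / (r * R) * (1 + 2 * n\<^sup>2)"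
    proof -
      have "9 * D * n \<le> 9 * D * (1 + n\<^sup>2)" using n D_nonneg by (intro mult_left_mono) auto
      moreover have "(9 * D + 8) * (1 + 2 * n\<^sup>2) = 9 * D * (1 + n\<^sup>2) + 9 * D * n\<^sup>2 + 8 + 16 * n\<^sup>2"
        by (simp add: algebra_simps)
      moreover have "0 \<le> 9 * D * n\<^sup>2" using D_nonneg by simp
      ultimately have "9 * D * n + 8 * n\<^sup>2 \<le> (9 * D + 8) * (1 + 2 * n\<^sup>2)"
        using zero_le_power2[of n] by linarith
      then have "(9 * D * n + 8 * n\<^sup>2) / (r * R) \<le> (9 * D + 8) * (1 + 2 * n\<^sup>2) / (r * R)"
        using r R by (intro divide_right_mono) auto
      then show ?thesis by simp
    qed
    show ?thesis
    proof (cases "n \<le> r / 2")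
      case True
      have "\<bar>norm (x - y) - R\<bar> \<le> n"
        using norm_triangle_ineq3[of "x - y" X] by (simp add: R_def X_def n_def norm_minus_commute)
      moreover from this have "R / 2 \<le> norm (x - y)" using True R by linarith
      ultimately have kd: "\<bar>k (norm (x - y)) - k R\<bar> \<le> (9 * D + 6 * n) / R ^ 3"
        using k_difference[OF R(1)] by blast
      have "\<bar>h y\<bar> = \<bar>k (norm (x - y)) - k R\<bar> * \<bar>(y - c) \<bullet> perp X\<bar>"
        using True unfolding h_def XK by (simp add: n_def abs_mult[symmetric] left_diff_distrib)
      also have "\<dots> \<le> ((9 * D + 6 * n) / R ^ 3) * (n * R)"
        using kd ip by (intro mult_mono) auto
      also have "\<dots> = (9 * D * n + 6 * n\<^sup>2) / (R * R)"
        using R(1) by (simp add: power3_eq_cube power2_eq_square field_simps)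
      also have "\<dots> \<le> (9 * D * n + 8 * n\<^sup>2) / (r * R)"
        using R r n D_nonneg by (intro frac_le mult_right_mono) auto
      finally show ?thesis using fin by (simp add: n_def)
    next
      case False
      have "k R \<le> 1 / R\<^sup>2"
      proof -
        have "k R * R\<^sup>2 \<le> 1" using k_mass[of R] pi_gt3 by (intro order_trans[OF k_mass]) simp
        then show ?thesis using R(1) by (simp add: field_simps)
      qed
      have "\<bar>h y\<bar> = k R * \<bar>(y - c) \<bullet> perp X\<bar>"
        using False k_nonneg unfolding h_def by (simp add: n_def abs_mult)
      also have "\<dots> \<le> (1 / R\<^sup>2) * (n * R)"
        using \<open>k R \<le> 1 / R\<^sup>2\<close> ip k_nonneg by (intro mult_mono) auto
      also have "\<dots> = n / R" using R(1) by (simp add: power2_eq_square)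
      also have "\<dots> \<le> (n * (2 * n / r)) / R"
      proof -
        have "1 \<le> 2 * n / r" using False r by (simp add: field_simps)
        then have "n * 1 \<le> n * (2 * n / r)" using n by (intro mult_left_mono)
        then show ?thesis using R(1) by (intro divide_right_mono) linarith+
      qed
      also have "\<dots> = (2 * n\<^sup>2) / (r * R)" by (simp add: power2_eq_square)
      also have "\<dots> \<le> (9 * D * n + 8 * n\<^sup>2) / (r * R)"
        using R r n D_nonneg by (intro divide_right_mono) auto
      finally show ?thesis using fin by (simp add: n_def)
    qed
  qed
  have iw: "integrable \<mu> (\<lambda>y. (9 * D + 8) / (r * R) * (1 + 2 * (norm (y - c))\<^sup>2))"
    using J(1) by (intro integrable_mult_right Bochner_Integration.integrable_add integrable_const) auto
  have m1: "(\<lambda>y. K (x - y)) \<in> borel_measurable borel" by measurable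
  have i1: "integrable \<mu> (\<lambda>y. indicator ?S y *\<^sub>R K (x - y))"
    by (rule integrable_bounded_radon[OF \<mu>, where C = B])
       (use K_bounded B_nonneg in \<open>auto simp: indicator_def\<close>)
  have i1': "integrable \<mu> (\<lambda>y. indicator ?S y * (X \<bullet> K (x - y)))"
    using integrable_inner_right[OF i1, of X] by simp
  have "integrable \<mu> (\<lambda>y. (y - c) \<bullet> perp X)"
  proof (rule Bochner_Integration.integrable_bound)
    show "integrable \<mu> (\<lambda>y. R * (1 + (norm (y - c))\<^sup>2))"
      using J(1) by (intro integrable_mult_right Bochner_Integration.integrable_add integrable_const)
    show "(\<lambda>y. (y - c) \<bullet> perp X) \<in> borel_measurable \<mu>" unfolding Dm(4) by measurable
    have "\<bar>(y - c) \<bullet> perp X\<bar> \<le> R * (1 + (norm (y - c))\<^sup>2)" for y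
    proof -
      have "\<bar>(y - c) \<bullet> perp X\<bar> \<le> norm (y - c) * R"
        using Cauchy_Schwarz_ineq2[of "y - c" "perp X"] by (simp add: R_def)
      also have "\<dots> \<le> (1 + (norm (y - c))\<^sup>2) * R"
        using R by (intro mult_right_mono le_one_plus_square) auto
      finally show ?thesis by (simp add: mult.commute)
    qed
    then show "AE y in \<mu>. norm ((y - c) \<bullet> perp X) \<le> norm (R * (1 + (norm (y - c))\<^sup>2))"
      using R by (auto simp: abs_mult)
  qed
  then have i2: "integrable \<mu> (\<lambda>y. k R * ((y - c) \<bullet> perp X))" by simp
  have ih: "integrable \<mu> h" unfolding h_def[abs_def] using i1' i2 by (rule Bochner_Integration.integrable_diff)
  have "X \<bullet> (\<integral>y. K (x - y) \<partial>restricted ?S \<mu>) = (\<integral>y. indicator ?S y * (X \<bullet> K (x - y)) \<partial>\<mu>)"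
    unfolding integral_restricted[OF \<mu> S m1] using integral_inner_right[OF i1, of X] by simp
  also have "\<dots> = (\<integral>y. h y \<partial>\<mu>)"
    unfolding h_def Bochner_Integration.integral_diff[OF i1' i2] using centre by simp
  finally have "\<bar>X \<bullet> (\<integral>y. K (x - y) \<partial>restricted ?S \<mu>)\<bar> \<le> (\<integral>y. \<bar>h y\<bar> \<partial>\<mu>)"
    using integral_abs_bound[of \<mu> h] by simp
  also have "\<dots> \<le> (\<integral>y. (9 * D + 8) / (r * R) * (1 + 2 * (norm (y - c))\<^sup>2) \<partial>\<mu>)"
    using ih iw bound by (intro integral_mono integrable_abs) auto
  also have "\<dots> = (9 * D + 8) / (r * R) * (mass \<mu> + 2 * (\<integral>y. (norm (y - c))\<^sup>2 \<partial>\<mu>))"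
    using J(1) by (simp add: mass_def Dm(3))
  also have "\<dots> \<le> (9 * D + 8) / (r * R) * (mass \<mu> + 2 * J)"
    using J(2) r R D_nonneg by (intro mult_left_mono) auto
  finally show ?thesis by (simp add: X_def R_def)
qed

end

section \<open>Flux through an annulus\<close>

definition tail :: "real^2 \<Rightarrow> real \<Rightarrow> (real^2) measure \<Rightarrow> real" where
  "tail c r \<mu> = measure \<mu> {x. r < norm (x - c)}"

lemma tail_set [measurable]: "{x :: real^2. r < norm (x - c)} \<in> sets borel"
  by measurable

lemma tail_nonneg: "0 \<le> tail c r \<mu>"
  by (simp add: tail_def)

lemma tail_antimono:
  assumes \<mu>: "bounded_radon_measure \<mu>" and "r \<le> s"
  shows "tail c s \<mu> \<le> tail c r \<mu>"
  unfolding tail_def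
  by (rule finite_measure.finite_measure_mono[OF bounded_radon_measureD(1)[OF \<mu>]])
     (use assms(2) in \<open>auto simp: bounded_radon_measureD[OF \<mu>]\<close>)

lemma tail_le_mass:
  assumes \<mu>: "bounded_radon_measure \<mu>" shows "tail c r \<mu> \<le> mass \<mu>"
  unfolding tail_def mass_def
  by (rule finite_measure.finite_measure_mono[OF bounded_radon_measureD(1)[OF \<mu>]])
     (auto simp: bounded_radon_measureD[OF \<mu>])

lemma tail_chebyshev:
  assumes \<mu>: "bounded_radon_measure \<mu>" and r: "r > 0"
    and J: "integrable \<mu> (\<lambda>y. (norm (y - c))\<^sup>2)" "(\<integral>y. (norm (y - c))\<^sup>2 \<partial>\<mu>) \<le> J"
  shows "tail c r \<mu> \<le> J / r\<^sup>2"
proof -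
  interpret finite_measure \<mu> by (rule bounded_radon_measureD[OF \<mu>])
  have P: "{x. r < norm (x - c)} \<in> sets \<mu>" by (simp add: bounded_radon_measureD[OF \<mu>])
  have "r\<^sup>2 * tail c r \<mu> = (\<integral>x. r\<^sup>2 * indicator {x. r < norm (x - c)} x \<partial>\<mu>)"
    using P by (simp add: tail_def)
  also have "\<dots> \<le> (\<integral>y. (norm (y - c))\<^sup>2 \<partial>\<mu>)"
  proof (rule integral_mono[OF _ J(1)])
    show "integrable \<mu> (\<lambda>x. r\<^sup>2 * indicator {x. r < norm (x - c)} x)"
      using P by (intro integrable_mult_right integrable_real_indicator) (auto simp: emeasure_eq_measure)
    show "r\<^sup>2 * indicator {x. r < norm (x - c)} x \<le> (norm (x - c))\<^sup>2" for x
      using r by (auto simp: indicator_def intro: power_mono)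
  qed
  finally show ?thesis using J(2) r by (simp add: field_simps)
qed

text \<open>
  A smooth replacement of the indicator of the region outside radius \<open>r + h\<close>; the denominator is
  \<open>(r + h)\<^sup>2 - r\<^sup>2\<close>, and \<open>outer_grad\<close> is the gradient.
\<close>

definition outer_weight :: "real^2 \<Rightarrow> real \<Rightarrow> real \<Rightarrow> real^2 \<Rightarrow> real" where
  "outer_weight c r h x = step (((norm (x - c))\<^sup>2 - r\<^sup>2) / (2 * r * h + h\<^sup>2))"

definition outer_grad :: "real^2 \<Rightarrow> real \<Rightarrow> real \<Rightarrow> real^2 \<Rightarrow> real^2" where
  "outer_grad c r h x = (2 * step' (((norm (x - c))\<^sup>2 - r\<^sup>2) / (2 * r * h + h\<^sup>2)) / (2 * r * h + h\<^sup>2)) *\<^sub>R (x - c)"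

locale annulus =
  fixes c :: "real^2" and r h b :: real
  assumes r: "0 < r" and h: "0 < h" "h \<le> r"
    and b: "0 < b" "\<And>s. \<bar>step' s\<bar> \<le> b" "\<And>s s'. \<bar>step' s - step' s'\<bar> \<le> b * \<bar>s - s'\<bar>"
begin

abbreviation d :: real where "d \<equiv> 2 * r * h + h\<^sup>2"

abbreviation arg :: "real^2 \<Rightarrow> real" where "arg x \<equiv> ((norm (x - c))\<^sup>2 - r\<^sup>2) / d"

lemma d: "d > 0" "d \<ge> 2 * r * h" "r\<^sup>2 + d = (r + h)\<^sup>2"
  using r h by (auto simp: add_pos_nonneg power2_sum)

lemma arg_le_0: "norm (x - c) \<le> r \<Longrightarrow> arg x \<le> 0"
  using d(1) by (intro divide_nonpos_pos) (auto simp: power_mono)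

lemma arg_ge_1: assumes "norm (x - c) \<ge> r + h" shows "arg x \<ge> 1"
proof -
  have "(r + h)\<^sup>2 \<le> (norm (x - c))\<^sup>2" using assms r h by (intro power_mono) auto
  then have "1 * d \<le> (norm (x - c))\<^sup>2 - r\<^sup>2"
    unfolding d(3)[symmetric] le_diff_eq mult_1_left by (simp only: add.commute)
  then show ?thesis using d(1) by (simp only: pos_le_divide_eq)
qed

lemma outer_weight_bounds:
  "outer_weight c r h x \<le> indicator {x. r < norm (x - c)} x"
  "indicator {x. r + h < norm (x - c)} x \<le> outer_weight c r h x"
  using arg_le_0[of x] arg_ge_1[of x] by (auto simp: outer_weight_def indicator_def)

lemma outer_grad_eq_0: "norm (x - c) \<le> r \<or> norm (x - c) \<ge> r + h \<Longrightarrow> outer_grad c r h x = 0"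
  using step'_eq_0[of "arg x"] arg_le_0[of x] arg_ge_1[of x] by (auto simp: outer_grad_def)

lemma test_function_inner: "test_function (\<lambda>x. 1 - outer_weight c r h x)"
  and grad_inner: "grad (\<lambda>x. 1 - outer_weight c r h x) x = - outer_grad c r h x"
proof -
  have sm: "smooth (\<lambda>x. (norm (x + (- c)))\<^sup>2)"
    by (rule smooth_affine[OF smooth_norm_square bounded_linear_ident])
  have "smooth (\<lambda>x. 1 - outer_weight c r h x)"
    unfolding outer_weight_def
    using smooth_mult[OF smooth_diff[OF sm smooth_const[of "r\<^sup>2"]] smooth_const[of "1 / d"]]
    by (intro smooth_diff smooth_const smooth_compose_real[OF smooth_step]) simp
  then show "test_function (\<lambda>x. 1 - outer_weight c r h x)"
  proof (rule test_functionI[where R = "r + h + norm c"])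
    fix x :: "real^2" assume "r + h + norm c < norm x"
    then have "norm (x - c) \<ge> r + h" using norm_triangle_ineq2[of x c] by linarith
    then show "1 - outer_weight c r h x = 0" using arg_ge_1[of x] by (simp add: outer_weight_def)
  qed
  have l: "((\<lambda>s. (s - r\<^sup>2) / d) has_real_derivative 1 / d) (at s)" for s
    using d(1) by (auto intro!: derivative_eq_intros)
  have "((\<lambda>s. 1 - step ((s - r\<^sup>2) / d)) has_real_derivative - (step' (arg x) / d)) (at ((norm (x - c))\<^sup>2))"
    using DERIV_diff[OF DERIV_const[of 1] DERIV_chain2[OF DERIV_step l]] by simp
  from radial_derivative[OF this] show "grad (\<lambda>x. 1 - outer_weight c r h x) x = - outer_grad c r h x"
    by (intro grad_unique) (simp add: outer_weight_def outer_grad_def)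
qed

lemma outer_grad_measurable: "outer_grad c r h \<in> borel_measurable borel"
proof -
  have "continuous_on UNIV (\<lambda>x. - grad (\<lambda>x. 1 - outer_weight c r h x) x)"
    by (intro continuous_on_minus continuous_on_grad test_functionD(1) test_function_inner)
  then show ?thesis by (intro borel_measurable_continuous_onI) (simp add: grad_inner)
qed

lemma outer_coefficient: "\<bar>2 * step' s / d\<bar> \<le> b / (r * h)"
proof -
  have "\<bar>2 * step' s / d\<bar> = 2 * \<bar>step' s\<bar> / d" using d(1) by (simp add: abs_mult)
  also have "\<dots> \<le> 2 * b / (2 * r * h)"
    using b(1) b(2)[of s] d r h by (intro frac_le) auto
  finally show ?thesis by simp
qed

lemma norm_outer_grad: "norm (outer_grad c r h x) \<le> 2 * b / h"
proof (cases "norm (x - c) \<le> r + h")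
  case True
  have "norm (outer_grad c r h x) = \<bar>2 * step' (arg x) / d\<bar> * norm (x - c)"
    by (simp add: outer_grad_def)
  also have "\<dots> \<le> b / (r * h) * (2 * r)"
    using outer_coefficient[of "arg x"] True h b(1) r by (intro mult_mono) auto
  also have "\<dots> = 2 * b / h" using r h by simp
  finally show ?thesis .
next
  case False
  then show ?thesis using outer_grad_eq_0[of x] b(1) h by simp
qed

text \<open>
  For the point farther from \<open>c\<close> the step is evaluated at radius \<open>min \<bar>x - c\<bar> (r + h)\<close> instead,
  which does not change it since \<open>step'\<close> vanishes beyond. This keeps all radii below \<open>2r\<close> and
  covers points outside the annulus without separate estimates.
\<close>

lemma outer_grad_lipschitz: "norm (outer_grad c r h x - outer_grad c r h y) \<le> 5 * b / h\<^sup>2 * norm (x - y)"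
proof -
  have *: "norm (outer_grad c r h x - outer_grad c r h y) \<le> 5 * b / h\<^sup>2 * norm (x - y)"
    if le: "norm (y - c) \<le> norm (x - c)" for x y
  proof (cases "norm (y - c) \<ge> r + h")
    case True
    then have "outer_grad c r h x = 0" "outer_grad c r h y = 0"
      using le by (auto intro!: outer_grad_eq_0)
    then show ?thesis using b(1) by simp
  next
    case False
    define m where "m = min (norm (x - c)) (r + h)"
    define s where "s \<rho> = step' ((\<rho>\<^sup>2 - r\<^sup>2) / d)" for \<rho>
    have sx: "step' (arg x) = s m"
    proof (cases "norm (x - c) \<le> r + h")
      case False
      have "((r + h)\<^sup>2 - r\<^sup>2) / d = 1" using d by (simp add: divide_eq_1_iff)
      then have "s m = 0" using False by (simp add: s_def m_def step'_eq_0)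
      then show ?thesis using False step'_eq_0[of "arg x"] arg_ge_1[of x] by simp
    qed (simp add: s_def m_def)
    have m: "norm (y - c) \<le> m" "m \<le> r + h" "m - norm (y - c) \<le> norm (x - y)"
      using le False norm_triangle_ineq2[of "x - c" "y - c"] by (auto simp: m_def)
    have "\<bar>s m - s (norm (y - c))\<bar> \<le> b * \<bar>(m\<^sup>2 - r\<^sup>2) / d - ((norm (y - c))\<^sup>2 - r\<^sup>2) / d\<bar>"
      unfolding s_def by (rule b(3))
    also have "(m\<^sup>2 - r\<^sup>2) / d - ((norm (y - c))\<^sup>2 - r\<^sup>2) / d = (m - norm (y - c)) * (m + norm (y - c)) / d"
      by (simp add: diff_divide_distrib[symmetric] power2_eq_square algebra_simps)
    also have "b * \<bar>(m - norm (y - c)) * (m + norm (y - c)) / d\<bar> \<le> b * (norm (x - y) * (2 * (2 * r)) / (2 * r * h))"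
    proof -
      have m0: "0 \<le> m" using m(1) norm_ge_zero order_trans by blast
      have "(m - norm (y - c)) * (m + norm (y - c)) / d \<le> norm (x - y) * (2 * (2 * r)) / (2 * r * h)"
        using m m0 h r d False by (intro frac_le mult_mono) auto
      moreover have "0 \<le> (m - norm (y - c)) * (m + norm (y - c)) / d"
        using m(1) m0 d(1) by simp
      ultimately have "\<bar>(m - norm (y - c)) * (m + norm (y - c)) / d\<bar> \<le> norm (x - y) * (2 * (2 * r)) / (2 * r * h)"
        by (simp only: abs_of_nonneg)
      then show ?thesis using b(1) by (intro mult_left_mono) auto
    qed
    also have "\<dots> = 2 * b / h * norm (x - y)" using r h by (simp add: field_simps)
    finally have sd: "\<bar>s m - s (norm (y - c))\<bar> \<le> 2 * b / h * norm (x - y)" .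
    have "outer_grad c r h x - outer_grad c r h y =
        (2 * s m / d) *\<^sub>R (x - y) + (2 * (s m - s (norm (y - c))) / d) *\<^sub>R (y - c)"
      unfolding outer_grad_def sx by (simp add: s_def algebra_simps diff_divide_distrib)
    also have "norm \<dots> \<le> \<bar>2 * s m / d\<bar> * norm (x - y) + 2 * \<bar>s m - s (norm (y - c))\<bar> / d * norm (y - c)"
      using d(1) by (intro order_trans[OF norm_triangle_ineq])
        (simp add: abs_mult abs_divide del: right_diff_distrib_numeral)
    also have "\<dots> \<le> b / (r * h) * norm (x - y) + 2 * (2 * b / h * norm (x - y)) / (2 * r * h) * (2 * r)"
      using outer_coefficient sd d r h False b(1)
      by (intro add_mono mult_mono frac_le mult_left_mono) (auto simp: s_def)
    also have "\<dots> = (b / (r * h) + 4 * b / h\<^sup>2) * norm (x - y)"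
      using r h by (simp add: field_simps power2_eq_square)
    also have "\<dots> \<le> (b / h\<^sup>2 + 4 * b / h\<^sup>2) * norm (x - y)"
    proof (intro mult_right_mono add_right_mono)
      have "h\<^sup>2 \<le> r * h" using h by (simp add: power2_eq_square)
      then show "b / (r * h) \<le> b / h\<^sup>2" using b(1) h r by (intro divide_left_mono) auto
    qed simp
    also have "\<dots> = 5 * b / h\<^sup>2 * norm (x - y)" by (simp add: add_divide_distrib[symmetric])
    finally show ?thesis .
  qed
  show ?thesis
    using *[of y x] *[of x y] by (cases "norm (y - c) \<le> norm (x - c)") (auto simp: norm_minus_commute)
qed

end

context vortex_kernel
begin

text \<open>
  The interactions with vorticity inside radius \<open>r/2\<close> are bounded by \<open>far_field_radial\<close> in both
  estimates. For the vorticity beyond \<open>r/2\<close>, the first estimate symmetrizes, uses the Lipschitz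
  constant \<open>5b / h\<^sup>2\<close> of the gradient together with \<open>\<bar>z\<bar> \<bar>K z\<bar> \<le> 1\<close>, and needs no information on
  the tail beyond Chebyshev's inequality. The second one uses that \<open>K\<close> is bounded and is better
  once the tail is known to be small.
\<close>

lemma flux_annulus:
  assumes \<mu>: "bounded_radon_measure \<mu>" and ann: "annulus r h b"
    and J: "integrable \<mu> (\<lambda>y. (norm (y - c))\<^sup>2)" "(\<integral>y. (norm (y - c))\<^sup>2 \<partial>\<mu>) \<le> J"
    and centre: "\<And>e. (\<integral>y. (y - c) \<bullet> e \<partial>\<mu>) = 0"
  defines "A \<equiv> (9 * D + 8) * (mass \<mu> + 2 * J)"
  shows "\<bar>flux (outer_grad c r h) \<mu>\<bar> \<le> b * (A + 20 * J) / (h\<^sup>2 * r\<^sup>2) * tail c r \<mu>"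
    and "\<bar>flux (outer_grad c r h) \<mu>\<bar> \<le> (b * A / (h * r ^ 3) + 2 * b * B / h * tail c (r / 2) \<mu>) * tail c r \<mu>"
proof -
  interpret annulus c r h b by (rule ann)
  let ?g = "outer_grad c r h"
  note g = outer_grad_measurable norm_outer_grad
  define P where "P = {x. r < norm (x - c)}"
  define Q where "Q = {x. r / 2 < norm (x - c)}"
  have PQ: "P \<in> sets borel" "Q \<in> sets borel" "P \<subseteq> Q" using r by (auto simp: P_def Q_def)
  have mP: "measure \<mu> P = tail c r \<mu>" and mQ: "measure \<mu> Q = tail c (r / 2) \<mu>"
    by (simp_all add: P_def Q_def tail_def)
  note \<mu>Q = bounded_radon_restricted[OF \<mu> PQ(2)]
  have gP: "?g x = 0" if "x \<notin> P" for x using that by (intro outer_grad_eq_0) (auto simp: P_def)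
  have Jnn: "0 \<le> J" by (rule order_trans[OF Bochner_Integration.integral_nonneg J(2)]) simp
  have A: "0 \<le> A" using D_nonneg Jnn by (simp add: A_def mass_def)
  have split: "flux ?g \<mu> = (\<integral>x. ?g x \<bullet> (\<integral>y. K (x - y) \<partial>restricted (- Q) \<mu>) \<partial>\<mu>) + flux ?g (restricted Q \<mu>)"
    by (rule flux_split[OF \<mu> g PQ(2)]) (use gP PQ(3) in blast)
  have Qc: "- Q = {y. norm (y - c) \<le> r / 2}" by (auto simp: Q_def)
  have far: "\<bar>\<integral>x. ?g x \<bullet> (\<integral>y. K (x - y) \<partial>restricted (- Q) \<mu>) \<partial>\<mu>\<bar> \<le> b * A / (h * r ^ 3) * measure \<mu> P"
  proof (rule abs_integral_le_measure[OF \<mu> PQ(1)])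
    fix x
    let ?V = "\<integral>y. K (x - y) \<partial>restricted (- Q) \<mu>"
    show "\<bar>?g x \<bullet> ?V\<bar> \<le> b * A / (h * r ^ 3) * indicator P x"
    proof (cases "x \<in> P")
      case True
      then have xr: "r \<le> norm (x - c)" by (simp add: P_def)
      have "\<bar>?g x \<bullet> ?V\<bar> = \<bar>2 * step' (arg x) / d\<bar> * \<bar>(x - c) \<bullet> ?V\<bar>"
        unfolding outer_grad_def inner_scaleR_left by (rule abs_mult)
      also have "\<dots> \<le> b / (r * h) * (A / (r * norm (x - c)))"
        using far_field_radial[OF \<mu> J centre r xr] b(1) r h
        unfolding A_def Qc by (intro mult_mono outer_coefficient) auto
      also have "\<dots> \<le> b / (r * h) * (A / (r * r))"
        using xr r h b(1) A by (intro mult_left_mono divide_left_mono) (auto intro!: mult_pos_pos)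
      also have "\<dots> = b * A / (h * r ^ 3)" using r h by (simp add: power3_eq_cube)
      finally show ?thesis using True by simp
    qed (simp add: gP)
  qed (use b(1) A h r in simp)
  have mQP: "measure (restricted Q \<mu>) P = measure \<mu> P" "measure (restricted Q \<mu>) UNIV = measure \<mu> Q"
    using measure_restricted[OF \<mu> PQ(2)] PQ by (simp_all add: Int_absorb1)
  have "\<bar>flux ?g (restricted Q \<mu>)\<bar> \<le> 5 * b / h\<^sup>2 * measure (restricted Q \<mu>) P * measure (restricted Q \<mu>) UNIV"
  proof (rule flux_le_symmetric[OF \<mu>Q g PQ(1)])
    fix x y
    have "\<bar>(?g x - ?g y) \<bullet> K (x - y)\<bar> \<le> norm (?g x - ?g y) * norm (K (x - y))"
      by (rule Cauchy_Schwarz_ineq2)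
    also have "\<dots> \<le> (5 * b / h\<^sup>2 * norm (x - y)) * norm (K (x - y))"
      by (intro mult_right_mono outer_grad_lipschitz) auto
    also have "\<dots> \<le> 5 * b / h\<^sup>2 * 1"
      unfolding mult.assoc[of _ "norm (x - y)"] using b(1) by (intro mult_left_mono K_decay) auto
    finally have "\<bar>(?g x - ?g y) \<bullet> K (x - y)\<bar> \<le> 5 * b / h\<^sup>2" by simp
    moreover have "\<bar>(?g x - ?g y) \<bullet> K (x - y)\<bar> = 0" if "x \<notin> P" "y \<notin> P" using that by (simp add: gP)
    moreover have "0 \<le> 5 * b / h\<^sup>2" using b(1) by simp
    ultimately show "\<bar>(?g x - ?g y) \<bullet> K (x - y)\<bar> \<le> 5 * b / h\<^sup>2 *
        (indicator P x * indicator UNIV y + indicator UNIV x * indicator P y)"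
      by (cases "x \<in> P"; cases "y \<in> P") auto
  qed (use b(1) in auto)
  then have near1: "\<bar>flux ?g (restricted Q \<mu>)\<bar> \<le> 5 * b / h\<^sup>2 * tail c r \<mu> * tail c (r / 2) \<mu>"
    by (simp only: mQP mP mQ)
  have near2: "\<bar>flux ?g (restricted Q \<mu>)\<bar> \<le> 2 * b / h * (B * measure \<mu> Q) * measure \<mu> P"
  proof -
    have "\<bar>flux ?g (restricted Q \<mu>)\<bar> \<le> 2 * b / h * (B * measure \<mu> Q) * measure (restricted Q \<mu>) P"
      unfolding flux_def
    proof (rule abs_integral_le_measure[OF \<mu>Q PQ(1)])
      fix x
      have "\<bar>?g x \<bullet> (\<integral>y. K (x - y) \<partial>restricted Q \<mu>)\<bar> \<le> 2 * b / h * (B * measure \<mu> Q)"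
        using velocity_field_bounded[OF \<mu>Q g, of x] b(1) h
        by (intro order_trans[OF Cauchy_Schwarz_ineq2] mult_mono norm_outer_grad) (auto simp: mass_def mQP)
      then show "\<bar>?g x \<bullet> (\<integral>y. K (x - y) \<partial>restricted Q \<mu>)\<bar> \<le> 2 * b / h * (B * measure \<mu> Q) * indicator P x"
        by (cases "x \<in> P") (auto simp: gP)
    qed (use b(1) h B_nonneg in auto)
    then show ?thesis by (simp only: mQP)
  qed
  show "\<bar>flux ?g \<mu>\<bar> \<le> (b * A / (h * r ^ 3) + 2 * b * B / h * tail c (r / 2) \<mu>) * tail c r \<mu>"
    using far near2 unfolding split mP mQ by (simp add: algebra_simps)
  have "tail c (r / 2) \<mu> \<le> J / (r / 2)\<^sup>2" using r by (intro tail_chebyshev[OF \<mu> _ J]) simp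
  then have "5 * b / h\<^sup>2 * tail c r \<mu> * tail c (r / 2) \<mu> \<le> 5 * b / h\<^sup>2 * tail c r \<mu> * (J / (r / 2)\<^sup>2)"
    using b(1) by (intro mult_left_mono) (auto simp: tail_nonneg)
  also have "\<dots> = b * (20 * J) / (h\<^sup>2 * r\<^sup>2) * tail c r \<mu>"
    using r h by (simp add: power_divide field_simps)
  finally have n1: "\<bar>flux ?g (restricted Q \<mu>)\<bar> \<le> b * (20 * J) / (h\<^sup>2 * r\<^sup>2) * tail c r \<mu>"
    using near1 by linarith
  have "b * A / (h * r ^ 3) \<le> b * A / (h\<^sup>2 * r\<^sup>2)"
  proof (rule divide_left_mono)
    have "h\<^sup>2 * r\<^sup>2 = (h * r\<^sup>2) * h" by (simp add: power2_eq_square)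
    also have "\<dots> \<le> (h * r\<^sup>2) * r" using h by (intro mult_left_mono) auto
    also have "\<dots> = h * r ^ 3" by (simp add: power2_eq_square power3_eq_cube)
    finally show "h\<^sup>2 * r\<^sup>2 \<le> h * r ^ 3" .
  qed (use b(1) A h r in auto)
  then have "b * A / (h * r ^ 3) * tail c r \<mu> \<le> b * A / (h\<^sup>2 * r\<^sup>2) * tail c r \<mu>"
    by (intro mult_right_mono) (auto simp: tail_nonneg)
  then have "\<bar>flux ?g \<mu>\<bar> \<le> b * A / (h\<^sup>2 * r\<^sup>2) * tail c r \<mu> + b * (20 * J) / (h\<^sup>2 * r\<^sup>2) * tail c r \<mu>"
    using far n1 unfolding split mP by linarith
  also have "\<dots> = b * (A + 20 * J) / (h\<^sup>2 * r\<^sup>2) * tail c r \<mu>"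
    by (simp add: distrib_left add_divide_distrib distrib_right)
  finally show "\<bar>flux ?g \<mu>\<bar> \<le> b * (A + 20 * J) / (h\<^sup>2 * r\<^sup>2) * tail c r \<mu>" .
qed

end

section \<open>Conservation laws\<close>

definition bump :: "real^2 \<Rightarrow> real" where
  "bump z = cutoff ((norm z)\<^sup>2)"

lemma bump_simps [simp]: "norm z \<le> 1 \<Longrightarrow> bump z = 1" "0 \<le> bump z" "bump z \<le> 1"
  by (simp_all add: bump_def power_le_one)

lemma smooth_bump: "smooth bump"
  unfolding bump_def[abs_def] by (rule smooth_compose_real[OF smooth_cutoff smooth_norm_square])

lemma test_function_times_bump:
  assumes "smooth g" shows "test_function (\<lambda>z. g z * bump z)"
proof (rule test_functionI[where R = 2])
  show "smooth (\<lambda>z. g z * bump z)" by (rule smooth_mult[OF assms smooth_bump])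
  fix z :: "real^2" assume "2 < norm z"
  then have "2\<^sup>2 \<le> (norm z)\<^sup>2" by (intro power_mono) auto
  then show "g z * bump z = 0" by (simp add: bump_def)
qed

lemma test_function_cmult:
  assumes "test_function f"
  shows "test_function (\<lambda>x. a * f x)" and "grad (\<lambda>x. a * f x) x = a *\<^sub>R grad f x"
proof -
  obtain R where "\<And>x. norm x > R \<Longrightarrow> f x = 0" using test_functionD(2)[OF assms] by blast
  then show "test_function (\<lambda>x. a * f x)"
    by (intro test_functionI[where R = R] smooth_mult smooth_const test_functionD(1)[OF assms]) auto
  note d = smooth_has_derivative[OF test_functionD(1)[OF assms], of x]
  show "grad (\<lambda>x. a * f x) x = a *\<^sub>R grad f x"
    by (rule grad_unique, rule has_derivative_eq_rhs[OF has_derivative_mult_right[OF d]])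
       (simp add: frechet_derivative_eq_grad[OF test_functionD(1)[OF assms]])
qed

text \<open>
  Spreading a fixed profile over the scale \<open>n + 1\<close> divides its gradient by \<open>n + 1\<close> and the
  Lipschitz constant of the gradient by its square; the factor \<open>a\<close> restores the growth of the
  moment that is being cut off.
\<close>

definition rescaled :: "real^2 \<Rightarrow> real \<Rightarrow> nat \<Rightarrow> (real^2 \<Rightarrow> real) \<Rightarrow> real^2 \<Rightarrow> real" where
  "rescaled c a n f x = a * f ((x - c) /\<^sub>R real (Suc n))"

lemma rescaled:
  assumes "test_function f"
  shows test_function_rescaled: "test_function (rescaled c a n f)"
    and grad_rescaled: "grad (rescaled c a n f) x = (a / real (Suc n)) *\<^sub>R grad f ((x - c) /\<^sub>R real (Suc n))"
proof -
  have n: "real (Suc n) \<noteq> 0" by simp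
  note t = test_function_affine[OF assms n, of c]
  show "test_function (rescaled c a n f)"
    unfolding rescaled_def[abs_def] by (rule test_function_cmult(1)[OF t(1)])
  show "grad (rescaled c a n f) x = (a / real (Suc n)) *\<^sub>R grad f ((x - c) /\<^sub>R real (Suc n))"
    unfolding rescaled_def[abs_def] test_function_cmult(2)[OF t(1)] t(2) by (simp add: divide_inverse)
qed

lemma norm_divide_Suc: "norm (z /\<^sub>R real (Suc n)) = norm z / real (Suc n)"
  by (simp only: norm_scaleR abs_inverse abs_of_nat divide_inverse_commute)

lemma norm_divide_le_1: "norm z \<le> N \<Longrightarrow> 0 < N \<Longrightarrow> norm (z /\<^sub>R N) \<le> 1"
  by (simp add: field_simps)

lemma rescaled_bump_tendsto:
  "(\<lambda>n. bump ((x - c) /\<^sub>R real (Suc n))) \<longlonglongrightarrow> 1"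
proof -
  obtain N where N: "norm (x - c) < real N" using reals_Archimedean2 by blast
  have "\<forall>\<^sub>F n in sequentially. bump ((x - c) /\<^sub>R real (Suc n)) = 1"
    using eventually_ge_at_top[of N]
  proof eventually_elim
    case (elim n)
    then have "norm (x - c) \<le> real (Suc n)" using N by simp
    then show ?case by (intro bump_simps norm_divide_le_1) auto
  qed
  then show ?thesis by (rule tendsto_eventually)
qed

lemma smooth_measurable: "smooth f \<Longrightarrow> f \<in> borel_measurable borel"
  by (intro borel_measurable_continuous_onI smooth_continuous)

lemma tail_tendsto_0:
  assumes \<mu>: "bounded_radon_measure \<mu>"
  shows "(\<lambda>n. tail c (real (Suc n)) \<mu>) \<longlonglongrightarrow> 0"
proof -
  interpret finite_measure \<mu> by (rule bounded_radon_measureD[OF \<mu>])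
  have "(\<lambda>n. measure \<mu> {x. real (Suc n) < norm (x - c)}) \<longlonglongrightarrow> measure \<mu> (\<Inter>n. {x. real (Suc n) < norm (x - c)})"
    by (rule finite_Lim_measure_decseq) (auto simp: bounded_radon_measureD[OF \<mu>] decseq_def)
  also have "(\<Inter>n. {x. real (Suc n) < norm (x - c)}) = {}"
  proof -
    have "\<exists>n. norm (x - c) \<le> real (Suc n)" for x
      using real_arch_simple[of "norm (x - c)"] by (metis Suc_n_not_le_n le_cases of_nat_le_iff order_trans)
    then show ?thesis by (auto simp: set_eq_iff) (metis not_less of_nat_Suc)
  qed
  finally show ?thesis by (simp add: tail_def)
qed

context vortex_flow
begin

text \<open>
  The cutoff at scale \<open>n\<close> has a gradient of order \<open>1 / n\<close>, so its flux vanishes in the limit.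
\<close>

theorem mass_conserved:
  assumes t: "t \<ge> 0" shows "mass (q t) = mass (q 0)"
proof -
  have test: "test_function bump" using test_function_times_bump[OF smooth_const[of 1]] by simp
  obtain L where L: "L > 0" "\<And>x. norm (grad bump x) \<le> L"
    "\<And>x y. norm (grad bump x - grad bump y) \<le> L * norm (x - y)"
    using test_function_grad_bounds[OF test] by metis
  define f where "f n = rescaled 0 1 n bump" for n
  note tf = test_function_rescaled[OF test, of 0 1, folded f_def]
  have gb: "norm (grad (f n) x) \<le> L / real (Suc n)" for n x
    using L(2) unfolding f_def grad_rescaled[OF test] by (simp add: divide_right_mono)
  obtain M where M: "M \<ge> 0" "AE s in lborel. s \<in> {0..t} \<longrightarrow> mass (q s) \<le> M"
    by (rule mass_AE_bounded)
  have lim: "(\<lambda>n. \<integral>x. f n x \<partial>q s) \<longlonglongrightarrow> mass (q s)" if s: "s \<ge> 0" for s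
  proof -
    note \<mu> = radon[OF s] and D = bounded_radon_measureD[OF radon[OF s]]
    interpret finite_measure "q s" by (rule D)
    have "(\<lambda>n. \<integral>x. f n x \<partial>q s) \<longlonglongrightarrow> (\<integral>x. 1 \<partial>q s)"
    proof (rule integral_dominated_convergence[where w = "\<lambda>_. 1"])
      show "f n \<in> borel_measurable (q s)" for n
        unfolding D by (rule smooth_measurable[OF test_functionD(1)[OF tf]])
      show "AE x in q s. (\<lambda>n. f n x) \<longlonglongrightarrow> 1"
        using rescaled_bump_tendsto[of _ 0] by (simp add: f_def rescaled_def)
    qed (auto simp: f_def rescaled_def)
    then show ?thesis by (simp add: mass_def D)
  qed
  have change: "\<bar>(\<integral>x. f n x \<partial>q t) - (\<integral>x. f n x \<partial>q 0)\<bar> \<le> L * (B * M) * M * t / real (Suc n)" for n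
  proof -
    have "grad (f n) \<in> borel_measurable borel"
      by (intro borel_measurable_continuous_onI continuous_on_grad test_functionD(1) tf)
    from flux_AE_bounded[OF M this gb]
    have "\<bar>LINT s|lborel. indicator {0..t} s * flux (grad (f n)) (q s)\<bar> \<le> L / real (Suc n) * (B * M) * M * (t - 0)"
      using t L(1) M(1) B_nonneg by (intro abs_integral_Icc_le) auto
    then show ?thesis using integral_test_function_evolution[OF tf t, of n] by simp
  qed
  have "(\<lambda>n. (\<integral>x. f n x \<partial>q t) - (\<integral>x. f n x \<partial>q 0)) \<longlonglongrightarrow> 0"
  proof (rule Lim_null_comparison)
    show "\<forall>\<^sub>F n in sequentially. norm ((\<integral>x. f n x \<partial>q t) - (\<integral>x. f n x \<partial>q 0)) \<le> L * (B * M) * M * t / real (Suc n)"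
      unfolding real_norm_def by (intro always_eventually allI change)
    show "(\<lambda>n. L * (B * M) * M * t / real (Suc n)) \<longlonglongrightarrow> 0"
      by (rule LIMSEQ_Suc[OF lim_const_over_n])
  qed
  moreover have "(\<lambda>n. (\<integral>x. f n x \<partial>q t) - (\<integral>x. f n x \<partial>q 0)) \<longlonglongrightarrow> mass (q t) - mass (q 0)"
    by (intro tendsto_diff lim) (use t in auto)
  ultimately show ?thesis using LIMSEQ_unique by fastforce
qed

end

text \<open>
  The initial measure lives in the disc of radius \<open>R1\<close> around its centre of mass \<open>c\<close>.
\<close>

locale confined_flow = vortex_flow +
  fixes c :: "real^2" and R1 :: real
  assumes R1: "R1 > 0"
    and initially_confined: "emeasure (q 0) {x. R1 < norm (x - c)} = 0"
    and initially_centred: "(\<integral>x. (x - c) \<bullet> e \<partial>q 0) = 0"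
begin

abbreviation m0 :: real where "m0 \<equiv> mass (q 0)"

lemma AE_initially_confined: "AE x in q 0. norm (x - c) \<le> R1"
proof -
  have "{x. R1 < norm (x - c)} \<in> null_sets (q 0)"
    using initially_confined bounded_radon_measureD[OF radon[of 0]] by (simp add: null_sets_def)
  from AE_not_in[OF this] show ?thesis by eventually_elim auto
qed

lemma tail_measurable: "(\<lambda>s. tail c r (extended s)) \<in> borel_measurable borel"
  unfolding tail_def measure_def
  by (rule borel_measurable_enn2real[OF extended_emeasure_measurable]) simp

lemma tail_le_m0: "s \<ge> 0 \<Longrightarrow> tail c r (q s) \<le> m0"
  using tail_le_mass[OF radon, of s c r] mass_conserved[of s] by linarith

lemma tail_integrable: "integrable lborel (\<lambda>s. indicator {0..t} s * tail c r (q s))"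
proof -
  have "integrable lborel (\<lambda>s. indicator {0..t} s * tail c r (extended s))"
    by (rule integrable_Icc_AE_bounded[OF tail_measurable, where c = m0])
       (use tail_le_m0 in \<open>auto simp: tail_nonneg\<close>)
  also have "(\<lambda>s. indicator {0..t} s * tail c r (extended s)) = (\<lambda>s. indicator {0..t} s * tail c r (q s))"
    by (auto simp: indicator_def)
  finally show ?thesis .
qed

text \<open>
  The gradient of \<open>\<bar>x - c\<bar>\<^sup>2\<close> is \<open>2 (x - c)\<close>, and \<open>(x - y) \<bullet> K (x - y) = 0\<close>: after
  symmetrization, two points inside the disc of radius \<open>n\<close> contribute nothing to the flux of the
  cutoff. The flux is therefore bounded by the mass outside that disc, which tends to zero at
  each time, and by dominated convergence its time integral does too.
\<close>

theorem second_moment: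
  assumes t: "t \<ge> 0"
  shows "integrable (q t) (\<lambda>x. (norm (x - c))\<^sup>2)" and "(\<integral>x. (norm (x - c))\<^sup>2 \<partial>q t) \<le> R1\<^sup>2 * m0"
proof -
  define f1 :: "real^2 \<Rightarrow> real" where "f1 z = (norm z)\<^sup>2 * bump z" for z
  have test: "test_function f1"
    unfolding f1_def[abs_def] by (rule test_function_times_bump[OF smooth_norm_square])
  have grad1: "grad f1 z = 2 *\<^sub>R z" if "norm z \<le> 1" for z
  proof -
    have z: "(norm z)\<^sup>2 \<le> 1" using that by (simp add: power_le_one)
    have "((\<lambda>s. s * cutoff s) has_real_derivative (norm z)\<^sup>2 * (- step' ((norm z)\<^sup>2 - 1)) + 1 * cutoff ((norm z)\<^sup>2)) (at ((norm z)\<^sup>2))"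
      by (rule DERIV_mult'[OF DERIV_ident DERIV_cutoff])
    then have "((\<lambda>s. s * cutoff s) has_real_derivative 1) (at ((norm (z - 0))\<^sup>2))"
      using z by (simp add: step'_eq_0)
    from radial_derivative[OF this] show ?thesis
      by (intro grad_unique) (simp add: f1_def[abs_def] bump_def)
  qed
  obtain L where L: "L > 0" "\<And>x. norm (grad f1 x) \<le> L"
    "\<And>x y. norm (grad f1 x - grad f1 y) \<le> L * norm (x - y)"
    using test_function_grad_bounds[OF test] by metis
  define f where "f n = rescaled c ((real (Suc n))\<^sup>2) n f1" for n
  have f_eq: "f n x = (norm (x - c))\<^sup>2 * bump ((x - c) /\<^sub>R real (Suc n))" for n x
    by (simp add: f_def rescaled_def f1_def power_mult_distrib power_inverse)
  have tf: "test_function (f n)" for n unfolding f_def by (rule test_function_rescaled[OF test])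
  have gr: "grad (f n) x = real (Suc n) *\<^sub>R grad f1 ((x - c) /\<^sub>R real (Suc n))" for n x
    unfolding f_def grad_rescaled[OF test] by (simp add: power2_eq_square)
  have gm: "grad (f n) \<in> borel_measurable borel" for n
    by (intro borel_measurable_continuous_onI continuous_on_grad test_functionD(1) tf)
  have gb: "norm (grad (f n) x) \<le> real (Suc n) * L" for n x
    unfolding gr norm_scaleR using L(2) by (simp add: mult_left_mono)
  have lip: "norm (grad (f n) x - grad (f n) y) \<le> L * norm (x - y)" for n x y
  proof -
    have "norm (grad (f n) x - grad (f n) y) = real (Suc n) * norm (grad f1 ((x - c) /\<^sub>R real (Suc n)) - grad f1 ((y - c) /\<^sub>R real (Suc n)))"
      unfolding gr by (simp add: scaleR_diff_right[symmetric] del: of_nat_Suc)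
    also have "\<dots> \<le> real (Suc n) * (L * norm ((x - c) /\<^sub>R real (Suc n) - (y - c) /\<^sub>R real (Suc n)))"
      by (intro mult_left_mono L) auto
    also have "(x - c) /\<^sub>R real (Suc n) - (y - c) /\<^sub>R real (Suc n) = (x - y) /\<^sub>R real (Suc n)"
      by (simp add: scaleR_diff_right[symmetric] del: of_nat_Suc)
    also have "real (Suc n) * (L * norm ((x - y) /\<^sub>R real (Suc n))) = L * norm (x - y)"
      unfolding norm_divide_Suc by (simp del: of_nat_Suc)
    finally show ?thesis .
  qed
  have flux: "\<bar>flux (grad (f n)) (q s)\<bar> \<le> L * m0 * tail c (real (Suc n)) (q s)" if s: "s \<ge> 0" for n s
  proof -
    define P where "P = {x. real (Suc n) < norm (x - c)}"
    have inP: "grad (f n) x = 2 *\<^sub>R (x - c)" if "x \<notin> P" for x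
    proof -
      have "norm ((x - c) /\<^sub>R real (Suc n)) \<le> 1"
        by (rule norm_divide_le_1) (use that in \<open>auto simp: P_def\<close>)
      from grad1[OF this] show ?thesis unfolding gr by (simp del: of_nat_Suc)
    qed
    have "\<bar>flux (grad (f n)) (q s)\<bar> \<le> L * measure (q s) P * measure (q s) UNIV"
    proof (rule flux_le_symmetric[OF radon[OF s] gm gb])
      fix x y
      let ?E = "(grad (f n) x - grad (f n) y) \<bullet> K (x - y)"
      have "\<bar>?E\<bar> \<le> norm (grad (f n) x - grad (f n) y) * norm (K (x - y))" by (rule Cauchy_Schwarz_ineq2)
      also have "\<dots> \<le> (L * norm (x - y)) * norm (K (x - y))" by (intro mult_right_mono lip) auto
      also have "\<dots> \<le> L * 1"
        unfolding mult.assoc using L(1) by (intro mult_left_mono K_decay) auto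
      finally have "\<bar>?E\<bar> \<le> L" by simp
      moreover have "?E = 0" if "x \<notin> P" "y \<notin> P"
      proof -
        have "grad (f n) x - grad (f n) y = 2 *\<^sub>R (x - y)" using that by (simp add: inP algebra_simps)
        then show ?thesis by (simp add: K_eq)
      qed
      ultimately show "\<bar>?E\<bar> \<le> L * (indicator P x * indicator UNIV y + indicator UNIV x * indicator P y)"
        using L(1) by (cases "x \<in> P"; cases "y \<in> P") auto
    qed (use L(1) in \<open>auto simp: P_def\<close>)
    also have "\<dots> = L * m0 * tail c (real (Suc n)) (q s)"
      using mass_conserved[OF s] by (simp add: tail_def P_def mass_def mult_ac)
    finally show ?thesis .
  qed
  \<comment> \<open>Up to a constant, a bound for the total flux of the cutoff at scale \<open>n + 1\<close> up to time \<open>t\<close>.\<close>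
  define e where "e n = (LINT s|lborel. indicator {0..t} s * tail c (real (Suc n)) (q s))" for n
  have "e \<longlonglongrightarrow> (LINT s::real|lborel. 0)"
    unfolding e_def
  proof (rule integral_dominated_convergence[where w = "\<lambda>s. m0 * indicator {0..t} s"])
    show "(\<lambda>s. indicator {0..t} s * tail c (real (Suc n)) (q s)) \<in> borel_measurable lborel" for n
      using tail_integrable by (rule borel_measurable_integrable)
    show "integrable lborel (\<lambda>s. m0 * indicator {0..t} s :: real)" by (auto simp: emeasure_lborel_Icc_eq)
    have "(\<lambda>n. indicator {0..t} s * tail c (real (Suc n)) (q s)) \<longlonglongrightarrow> 0" for s
      using tail_tendsto_0[OF radon, of s c] by (cases "s \<in> {0..t}") (simp_all del: of_nat_Suc)
    then show "AE s in lborel. (\<lambda>n. indicator {0..t} s * tail c (real (Suc n)) (q s)) \<longlonglongrightarrow> 0"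
      by (intro AE_I2)
    show "AE s in lborel. norm (indicator {0..t} s * tail c (real (Suc n)) (q s)) \<le> m0 * indicator {0..t} s" for n
      using tail_le_m0 by (auto simp: indicator_def tail_nonneg)
  qed simp
  then have e0: "e \<longlonglongrightarrow> 0" by simp
  have le: "(\<integral>x. f n x \<partial>q t) \<le> R1\<^sup>2 * m0 + L * m0 * e n" for n
  proof -
    have D0: "bounded_radon_measure (q 0)" by (rule radon) simp
    interpret Q0: finite_measure "q 0" by (rule bounded_radon_measureD[OF D0])
    obtain C where C: "\<And>x. \<bar>f n x\<bar> \<le> C" using test_function_bounded[OF tf[of n]] by metis
    have i0: "integrable (q 0) (f n)"
      by (rule integrable_bounded_radon[OF D0 smooth_measurable[OF test_functionD(1)[OF tf]]]) (use C in simp)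
    have "(\<integral>x. f n x \<partial>q 0) \<le> (\<integral>x. R1\<^sup>2 \<partial>q 0)"
    proof (rule integral_mono_AE[OF i0])
      show "AE x in q 0. f n x \<le> R1\<^sup>2"
        using AE_initially_confined
      proof eventually_elim
        case (elim x)
        have "(norm (x - c))\<^sup>2 * bump ((x - c) /\<^sub>R real (Suc n)) \<le> R1\<^sup>2 * 1"
          using elim R1 by (intro mult_mono power_mono) auto
        then show ?case by (simp add: f_eq)
      qed
    qed simp
    also have "\<dots> = R1\<^sup>2 * m0" by (simp add: mass_def bounded_radon_measureD[OF D0])
    finally have 1: "(\<integral>x. f n x \<partial>q 0) \<le> R1\<^sup>2 * m0" .
    have "(LINT s|lborel. indicator {0..t} s * flux (grad (f n)) (q s))
        \<le> (LINT s|lborel. L * m0 * (indicator {0..t} s * tail c (real (Suc n)) (q s)))"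
    proof (rule integral_mono[OF flux_integrable[OF gm gb]])
      show "integrable lborel (\<lambda>s. L * m0 * (indicator {0..t} s * tail c (real (Suc n)) (q s)))"
        by (intro integrable_mult_right tail_integrable)
      show "indicator {0..t} s * flux (grad (f n)) (q s) \<le> L * m0 * (indicator {0..t} s * tail c (real (Suc n)) (q s))" for s
        using flux[of s n] by (auto simp: indicator_def)
    qed
    also have "\<dots> = L * m0 * e n" by (simp add: e_def)
    finally show ?thesis using 1 integral_test_function_evolution[OF tf t, of n] by linarith
  qed
  note \<mu> = radon[OF t] and Dt = bounded_radon_measureD[OF radon[OF t]]
  have fm: "f n \<in> borel_measurable borel" for n by (rule smooth_measurable[OF test_functionD(1)[OF tf]])
  have "(\<integral>\<^sup>+x. ennreal ((norm (x - c))\<^sup>2) \<partial>q t) = (\<integral>\<^sup>+x. liminf (\<lambda>n. ennreal (f n x)) \<partial>q t)"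
  proof (rule nn_integral_cong)
    fix x
    have "(\<lambda>n. f n x) \<longlonglongrightarrow> (norm (x - c))\<^sup>2 * 1"
      unfolding f_eq by (intro tendsto_mult tendsto_const rescaled_bump_tendsto)
    then have "(\<lambda>n. ennreal (f n x)) \<longlonglongrightarrow> ennreal ((norm (x - c))\<^sup>2)"
      by (intro tendsto_ennrealI) simp
    from lim_imp_Liminf[OF _ this] show "ennreal ((norm (x - c))\<^sup>2) = liminf (\<lambda>n. ennreal (f n x))" by simp
  qed
  also have "\<dots> \<le> liminf (\<lambda>n. \<integral>\<^sup>+x. ennreal (f n x) \<partial>q t)"
    by (rule nn_integral_liminf) (use fm in \<open>simp add: Dt\<close>)
  also have "\<dots> \<le> liminf (\<lambda>n. ennreal (R1\<^sup>2 * m0 + L * m0 * e n))"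
  proof (intro Liminf_mono always_eventually allI)
    fix n
    obtain C where C: "\<And>x. \<bar>f n x\<bar> \<le> C" using test_function_bounded[OF tf[of n]] by metis
    have "integrable (q t) (f n)"
      by (rule integrable_bounded_radon[OF \<mu> fm]) (use C in simp)
    then have "(\<integral>\<^sup>+x. ennreal (f n x) \<partial>q t) = ennreal (\<integral>x. f n x \<partial>q t)"
      by (rule nn_integral_eq_integral) (simp add: f_eq)
    then show "(\<integral>\<^sup>+x. ennreal (f n x) \<partial>q t) \<le> ennreal (R1\<^sup>2 * m0 + L * m0 * e n)"
      using le[of n] by (simp add: ennreal_leI)
  qed
  also have "\<dots> = ennreal (R1\<^sup>2 * m0)"
  proof (rule lim_imp_Liminf)
    have "(\<lambda>n. R1\<^sup>2 * m0 + L * m0 * e n) \<longlonglongrightarrow> R1\<^sup>2 * m0 + L * m0 * 0"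
      by (intro tendsto_intros e0)
    then show "(\<lambda>n. ennreal (R1\<^sup>2 * m0 + L * m0 * e n)) \<longlonglongrightarrow> ennreal (R1\<^sup>2 * m0)"
      by (intro tendsto_ennrealI) simp
  qed simp
  finally have nn: "(\<integral>\<^sup>+x. ennreal ((norm (x - c))\<^sup>2) \<partial>q t) \<le> ennreal (R1\<^sup>2 * m0)" .
  have sm: "(\<lambda>x. (norm (x - c))\<^sup>2) \<in> borel_measurable (q t)" unfolding Dt by measurable
  show int: "integrable (q t) (\<lambda>x. (norm (x - c))\<^sup>2)"
    using le_less_trans[OF nn] sm by (intro integrableI_nonneg) auto
  show "(\<integral>x. (norm (x - c))\<^sup>2 \<partial>q t) \<le> R1\<^sup>2 * m0"
    using nn nn_integral_eq_integral[OF int] by (simp add: ennreal_le_iff mass_nonneg)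
qed

text \<open>
  The cutoff of a linear function at scale \<open>n\<close> has a gradient with Lipschitz constant of order
  \<open>1 / n\<close>, so its symmetrized flux vanishes in the limit. The second moment justifies passing to
  the limit in the integrals at fixed times.
\<close>

theorem centre_conserved:
  assumes t: "t \<ge> 0" shows "(\<integral>x. (x - c) \<bullet> e \<partial>q t) = 0"
proof -
  define f1 :: "real^2 \<Rightarrow> real" where "f1 z = (z \<bullet> e) * bump z" for z
  have test: "test_function f1"
    unfolding f1_def[abs_def] by (rule test_function_times_bump[OF smooth_bounded_linear[OF bounded_linear_inner_left]])
  obtain L where L: "L > 0" "\<And>x. norm (grad f1 x) \<le> L"
    "\<And>x y. norm (grad f1 x - grad f1 y) \<le> L * norm (x - y)"
    using test_function_grad_bounds[OF test] by metis
  define f where "f n = rescaled c (real (Suc n)) n f1" for n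
  have f_eq: "f n x = ((x - c) \<bullet> e) * bump ((x - c) /\<^sub>R real (Suc n))" for n x
    by (simp add: f_def rescaled_def f1_def)
  have tf: "test_function (f n)" for n unfolding f_def by (rule test_function_rescaled[OF test])
  have gr: "grad (f n) x = grad f1 ((x - c) /\<^sub>R real (Suc n))" for n x
    unfolding f_def grad_rescaled[OF test] by simp
  have gm: "grad (f n) \<in> borel_measurable borel" for n
    by (intro borel_measurable_continuous_onI continuous_on_grad test_functionD(1) tf)
  have gb: "norm (grad (f n) x) \<le> L" for n x unfolding gr by (rule L)
  have flux: "\<bar>flux (grad (f n)) (q s)\<bar> \<le> L / real (Suc n) * m0 * m0" if s: "s \<ge> 0" for n s
  proof -
    have "\<bar>flux (grad (f n)) (q s)\<bar> \<le> L / real (Suc n) * measure (q s) UNIV * measure (q s) UNIV"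
    proof (rule flux_le_symmetric[OF radon[OF s] gm gb])
      fix x y
      let ?E = "(grad (f n) x - grad (f n) y) \<bullet> K (x - y)"
      have eq: "(x - c) /\<^sub>R real (Suc n) - (y - c) /\<^sub>R real (Suc n) = (x - y) /\<^sub>R real (Suc n)"
        by (simp add: scaleR_diff_right[symmetric] del: of_nat_Suc)
      have "\<bar>?E\<bar> \<le> norm (grad (f n) x - grad (f n) y) * norm (K (x - y))" by (rule Cauchy_Schwarz_ineq2)
      also have "\<dots> \<le> (L * norm ((x - y) /\<^sub>R real (Suc n))) * norm (K (x - y))"
        unfolding gr eq[symmetric] by (intro mult_right_mono L) auto
      also have "\<dots> = L / real (Suc n) * (norm (x - y) * norm (K (x - y)))"
        unfolding norm_divide_Suc by simp
      also have "\<dots> \<le> L / real (Suc n) * 1"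
        using L(1) by (intro mult_left_mono K_decay) auto
      also have "\<dots> \<le> L / real (Suc n) * 2"
        using L(1) by (intro mult_left_mono) auto
      finally show "\<bar>?E\<bar> \<le> L / real (Suc n) * (indicator UNIV x * indicator UNIV y + indicator UNIV x * indicator UNIV y)"
        by simp
    qed (use L(1) in auto)
    then show ?thesis using mass_conserved[OF s] by (simp add: mass_def)
  qed
  have lim: "(\<lambda>n. \<integral>x. f n x \<partial>q s) \<longlonglongrightarrow> (\<integral>x. (x - c) \<bullet> e \<partial>q s)" if s: "s \<ge> 0" for s
  proof -
    note \<mu> = radon[OF s] and Ds = bounded_radon_measureD[OF radon[OF s]]
    interpret finite_measure "q s" by (rule Ds)
    show ?thesis
    proof (rule integral_dominated_convergence[where w = "\<lambda>x. norm e * (1 + (norm (x - c))\<^sup>2)"])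
      show "(\<lambda>x. (x - c) \<bullet> e) \<in> borel_measurable (q s)" unfolding Ds by measurable
      show "f n \<in> borel_measurable (q s)" for n
        unfolding Ds by (rule smooth_measurable[OF test_functionD(1)[OF tf]])
      show "integrable (q s) (\<lambda>x. norm e * (1 + (norm (x - c))\<^sup>2))"
        by (intro integrable_mult_right Bochner_Integration.integrable_add integrable_const second_moment s)
      have "(\<lambda>n. f n x) \<longlonglongrightarrow> ((x - c) \<bullet> e) * 1" for x
        unfolding f_eq by (intro tendsto_mult tendsto_const rescaled_bump_tendsto)
      then show "AE x in q s. (\<lambda>n. f n x) \<longlonglongrightarrow> (x - c) \<bullet> e" by simp
      have "\<bar>f n x\<bar> \<le> norm e * (1 + (norm (x - c))\<^sup>2)" for n x
      proof -
        have "\<bar>f n x\<bar> \<le> (norm (x - c) * norm e) * 1"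
          unfolding f_eq abs_mult by (intro mult_mono Cauchy_Schwarz_ineq2) auto
        also have "\<dots> \<le> ((1 + (norm (x - c))\<^sup>2) * norm e) * 1"
          by (intro mult_right_mono le_one_plus_square) auto
        finally show ?thesis by (simp add: mult.commute)
      qed
      then show "AE x in q s. norm (f n x) \<le> norm e * (1 + (norm (x - c))\<^sup>2)" for n by simp
    qed
  qed
  have change: "\<bar>(\<integral>x. f n x \<partial>q t) - (\<integral>x. f n x \<partial>q 0)\<bar> \<le> L * m0 * m0 * t / real (Suc n)" for n
  proof -
    have "\<bar>LINT s|lborel. indicator {0..t} s * flux (grad (f n)) (q s)\<bar> \<le> L / real (Suc n) * m0 * m0 * (t - 0)"
      using t flux L(1) mass_nonneg[of "q 0"] by (intro abs_integral_Icc_le) auto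
    then show ?thesis using integral_test_function_evolution[OF tf t, of n] by simp
  qed
  have "(\<lambda>n. (\<integral>x. f n x \<partial>q t) - (\<integral>x. f n x \<partial>q 0)) \<longlonglongrightarrow> 0"
  proof (rule Lim_null_comparison)
    show "\<forall>\<^sub>F n in sequentially. norm ((\<integral>x. f n x \<partial>q t) - (\<integral>x. f n x \<partial>q 0)) \<le> L * m0 * m0 * t / real (Suc n)"
      unfolding real_norm_def by (intro always_eventually allI change)
    show "(\<lambda>n. L * m0 * m0 * t / real (Suc n)) \<longlonglongrightarrow> 0"
      by (rule LIMSEQ_Suc[OF lim_const_over_n])
  qed
  moreover have "(\<lambda>n. (\<integral>x. f n x \<partial>q t) - (\<integral>x. f n x \<partial>q 0)) \<longlonglongrightarrow> (\<integral>x. (x - c) \<bullet> e \<partial>q t) - (\<integral>x. (x - c) \<bullet> e \<partial>q 0)"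
    by (intro tendsto_diff lim) (use t in auto)
  ultimately have "(\<integral>x. (x - c) \<bullet> e \<partial>q t) - (\<integral>x. (x - c) \<bullet> e \<partial>q 0) = 0"
    using LIMSEQ_unique by blast
  then show ?thesis using initially_centred by simp
qed

text \<open>
  The function \<open>1 - outer_weight\<close> has compact support, so it is a test function, and the
  conserved mass converts its evolution into that of the outer weight. The weight lies between
  the indicators of the regions outside \<open>r + h\<close> and outside \<open>r\<close>, and the latter carries no mass
  initially.
\<close>

theorem tail_evolution:
  assumes t: "t \<ge> 0" and ann: "annulus r h b" and R1r: "R1 \<le> r"
    and flux: "\<And>s. s \<in> {0..t} \<Longrightarrow> \<bar>flux (outer_grad c r h) (q s)\<bar> \<le> \<beta> * tail c r (q s)"
  shows "tail c (r + h) (q t) \<le> \<beta> * (LINT s|lborel. indicator {0..t} s * tail c r (q s))"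
proof -
  interpret annulus c r h b by (rule ann)
  let ?W = "outer_weight c r h" and ?g = "outer_grad c r h"
  note g = outer_grad_measurable norm_outer_grad
  have Wm: "?W \<in> borel_measurable borel"
    using borel_measurable_diff[OF borel_measurable_const[of 1] smooth_measurable[OF test_functionD(1)[OF test_function_inner]]]
    by simp
  have W01: "norm (?W x) \<le> 1" for x by (simp add: outer_weight_def)
  have W: "(\<integral>x. ?W x \<partial>q s) = m0 - (\<integral>x. 1 - ?W x \<partial>q s)"
    and Wlow: "tail c (r + h) (q s) \<le> (\<integral>x. ?W x \<partial>q s)" and Wup: "(\<integral>x. ?W x \<partial>q s) \<le> tail c r (q s)"
    if s: "s \<ge> 0" for s
  proof -
    note \<mu> = radon[OF s] and Ds = bounded_radon_measureD[OF radon[OF s]]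
    interpret finite_measure "q s" by (rule Ds)
    have i: "integrable (q s) ?W" by (rule integrable_bounded_radon[OF \<mu> Wm W01])
    show "(\<integral>x. ?W x \<partial>q s) = m0 - (\<integral>x. 1 - ?W x \<partial>q s)"
      using i mass_conserved[OF s] by (simp add: mass_def Ds)
    have P: "{x. \<rho> < norm (x - c)} \<in> sets (q s)" for \<rho> by (simp add: Ds)
    have ii: "integrable (q s) (indicator {x. \<rho> < norm (x - c)} :: _ \<Rightarrow> real)" for \<rho>
      using P by (intro integrable_real_indicator) (auto simp: emeasure_eq_measure)
    have t_eq: "tail c \<rho> (q s) = (\<integral>x. indicator {x. \<rho> < norm (x - c)} x \<partial>q s)" for \<rho>
      using P by (simp add: tail_def)
    show "tail c (r + h) (q s) \<le> (\<integral>x. ?W x \<partial>q s)" "(\<integral>x. ?W x \<partial>q s) \<le> tail c r (q s)"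
      unfolding t_eq by (intro integral_mono ii i outer_weight_bounds)+
  qed
  have tail0: "tail c r (q 0) = 0"
  proof -
    have "tail c R1 (q 0) = 0" using initially_confined by (simp add: tail_def measure_def)
    then show ?thesis using tail_antimono[OF radon R1r, of 0 c] tail_nonneg[of c r "q 0"] by simp
  qed
  have neg: "flux (grad (\<lambda>x. 1 - ?W x)) \<mu> = - flux ?g \<mu>" for \<mu>
    by (simp add: flux_def grad_inner)
  have "tail c (r + h) (q t) \<le> m0 - (\<integral>x. 1 - ?W x \<partial>q t)" using W[OF t] Wlow[OF t] by simp
  also have "\<dots> = (\<integral>x. ?W x \<partial>q 0) + (LINT s|lborel. indicator {0..t} s * flux ?g (q s))"
    using integral_test_function_evolution[OF test_function_inner t] W[of 0] by (simp add: neg)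
  also have "\<dots> \<le> (LINT s|lborel. indicator {0..t} s * flux ?g (q s))"
    using Wup[of 0] tail0 by simp
  also have "\<dots> \<le> (LINT s|lborel. \<beta> * (indicator {0..t} s * tail c r (q s)))"
  proof (rule integral_mono[OF flux_integrable[OF g] integrable_mult_right[OF tail_integrable]])
    show "indicator {0..t} s * flux ?g (q s) \<le> \<beta> * (indicator {0..t} s * tail c r (q s))" for s
      using flux[of s] by (auto simp: indicator_def)
  qed
  finally show ?thesis by simp
qed

end

section \<open>Iteration over annuli\<close>

lemma power_div_fact_le_exp:
  fixes x :: real
  assumes "0 \<le> x" shows "x ^ n / fact n \<le> exp x"
proof -
  have "(\<Sum>k\<in>{n}. x ^ k /\<^sub>R fact k) \<le> (\<Sum>k. x ^ k /\<^sub>R fact k)"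
    by (rule sum_le_suminf[OF summable_exp_generic]) (use assms in auto)
  then show ?thesis by (simp add: exp_def divide_inverse mult.commute)
qed

lemma power_div_fact_le:
  fixes x :: real
  assumes "0 \<le> x" "n > 0" shows "x ^ n / fact n \<le> (x * exp 1 / real n) ^ n"
proof -
  have "x ^ n / fact n = (x / real n) ^ n * (real n ^ n / fact n)"
    using assms(2) by (simp add: power_divide)
  also have "\<dots> \<le> (x / real n) ^ n * exp (real n)"
    using assms(1) by (intro mult_left_mono power_div_fact_le_exp) auto
  also have "exp (real n) = exp 1 ^ n" using exp_of_nat_mult[of n "1::real"] by simp
  finally show ?thesis by (simp add: power_mult_distrib power_divide)
qed

context confined_flow
begin

text \<open>
  Each annulus of width \<open>h\<close> contributes one more integration in time.
\<close>

lemma tail_iteration: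
  assumes t: "t \<ge> 0" and r: "R1 \<le> r" and h: "0 < h" "h \<le> r" and \<beta>: "0 \<le> \<beta>"
    and b: "0 < b" "\<And>s. \<bar>step' s\<bar> \<le> b" "\<And>s s'. \<bar>step' s - step' s'\<bar> \<le> b * \<bar>s - s'\<bar>"
    and flux: "\<And>\<rho> s. r \<le> \<rho> \<Longrightarrow> s \<in> {0..t} \<Longrightarrow> \<bar>flux (outer_grad c \<rho> h) (q s)\<bar> \<le> \<beta> * tail c \<rho> (q s)"
    and s: "s \<in> {0..t}"
  shows "tail c (r + real j * h) (q s) \<le> m0 * ((\<beta> * s) ^ j / fact j)"
  using s
proof (induction j arbitrary: s)
  case 0
  then show ?case using tail_le_m0[of s r] by simp
next
  case (Suc j)
  define \<rho> where "\<rho> = r + real j * h"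
  have \<rho>: "r \<le> \<rho>" using h by (simp add: \<rho>_def)
  have ann: "annulus \<rho> h b" by unfold_locales (use \<rho> r R1 h b in auto)
  have "tail c (\<rho> + h) (q s) \<le> \<beta> * (LINT \<sigma>|lborel. indicator {0..s} \<sigma> * tail c \<rho> (q \<sigma>))"
    using Suc.prems r \<rho> by (intro tail_evolution[OF _ ann]) (auto intro!: flux)
  also have "\<dots> \<le> \<beta> * (LINT \<sigma>|lborel. m0 * \<beta> ^ j / fact j * (\<sigma> ^ j * indicator {0..s} \<sigma>))"
  proof (intro mult_left_mono \<beta> integral_mono[OF tail_integrable])
    show "integrable lborel (\<lambda>\<sigma>. m0 * \<beta> ^ j / fact j * (\<sigma> ^ j * indicator {0..s} \<sigma>))"
      using borel_integrable_atLeastAtMost'[of 0 s "\<lambda>\<sigma>. \<sigma> ^ j"]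
      by (intro integrable_mult_right) (simp add: set_integrable_def mult.commute continuous_intros)
    show "indicator {0..s} \<sigma> * tail c \<rho> (q \<sigma>) \<le> m0 * \<beta> ^ j / fact j * (\<sigma> ^ j * indicator {0..s} \<sigma>)" for \<sigma>
      using Suc.IH[of \<sigma>] Suc.prems by (auto simp: indicator_def \<rho>_def power_mult_distrib)
  qed
  also have "\<dots> = \<beta> * (m0 * \<beta> ^ j / fact j * (s ^ Suc j / real (Suc j)))"
    using integral_power[of 0 s j] Suc.prems by simp
  also have "\<dots> = m0 * ((\<beta> * s) ^ Suc j / fact (Suc j))"
    by (simp add: power_mult_distrib mult_ac)
  finally show ?case by (simp add: \<rho>_def algebra_simps)
qed

text \<open>
  With \<open>n\<close> annuli of width \<open>r / (4n)\<close> the last radius is \<open>5r/4\<close> for every \<open>n\<close>, which remains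
  free to be chosen.
\<close>

lemma tail_iterated:
  assumes t: "t \<ge> 0" and r: "R1 \<le> r" and n: "n > 0" and \<beta>: "0 \<le> \<beta>"
    and b: "0 < b" "\<And>s. \<bar>step' s\<bar> \<le> b" "\<And>s s'. \<bar>step' s - step' s'\<bar> \<le> b * \<bar>s - s'\<bar>"
    and flux: "\<And>\<rho> s. r \<le> \<rho> \<Longrightarrow> s \<in> {0..t} \<Longrightarrow>
      \<bar>flux (outer_grad c \<rho> (r / (4 * real n))) (q s)\<bar> \<le> \<beta> * tail c \<rho> (q s)"
  shows "tail c (5 * r / 4) (q t) \<le> m0 * (\<beta> * t * exp 1 / real n) ^ n"
proof -
  have r0: "r > 0" using r R1 by linarith
  have h: "0 < r / (4 * real n)" "r / (4 * real n) \<le> r"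
    using r0 n by (auto simp: field_simps)
  have "tail c (r + real n * (r / (4 * real n))) (q t) \<le> m0 * ((\<beta> * t) ^ n / fact n)"
    by (rule tail_iteration[OF t r h \<beta> b flux]) (use t in auto)
  moreover have eq: "r + real n * (r / (4 * real n)) = 5 * r / 4" using n by (simp add: field_simps)
  moreover have "m0 * ((\<beta> * t) ^ n / fact n) \<le> m0 * (\<beta> * t * exp 1 / real n) ^ n"
    using \<beta> t n by (intro mult_left_mono power_div_fact_le mass_nonneg) auto
  ultimately show ?thesis unfolding eq by (meson order_trans)
qed

end

context vortex_kernel
begin

text \<open>
  The constants of the successive estimates depend on the solution through the initial radius
  \<open>R\<close> and the mass \<open>m\<close> only, \<open>R\<^sup>2 m\<close> being the bound for the moment of inertia. In the notation
  of the introduction, \<open>decay_const\<close> is the \<open>a\<close> in the exponential bound of the tail.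
\<close>

definition far_const :: "real \<Rightarrow> real \<Rightarrow> real" where
  "far_const R m = (9 * D + 8) * (m + 2 * (R\<^sup>2 * m))"

definition decay_const :: "real \<Rightarrow> real \<Rightarrow> real \<Rightarrow> real" where
  "decay_const b R m = 16 * (exp 1)\<^sup>2 * (b * (far_const R m + 20 * (R\<^sup>2 * m)) + 1)"

definition tail_const :: "real \<Rightarrow> real \<Rightarrow> real \<Rightarrow> real" where
  "tail_const b R m = m * exp 1 * (2 * decay_const b R m / R) * (125 / 8)"

definition speed_const :: "real \<Rightarrow> real \<Rightarrow> real \<Rightarrow> real" where
  "speed_const b R m = b * far_const R m + 2 * b * B * tail_const b R m"

definition spread_const :: "real \<Rightarrow> real \<Rightarrow> real \<Rightarrow> real" where
  "spread_const b R m = 5 / 2 * (1 + 2 * decay_const b R m) + 8 * exp 1 * speed_const b R m"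

lemma const_nonneg:
  assumes "0 < b" "0 < R" "0 \<le> m"
  shows "0 \<le> far_const R m" "0 < decay_const b R m" "0 \<le> tail_const b R m" "0 \<le> speed_const b R m"
    "5 / 2 \<le> spread_const b R m"
proof -
  show 1: "0 \<le> far_const R m" using assms D_nonneg by (simp add: far_const_def)
  then show 2: "0 < decay_const b R m" using assms by (simp add: decay_const_def add_nonneg_pos)
  then show 3: "0 \<le> tail_const b R m" using assms by (simp add: tail_const_def)
  then show 4: "0 \<le> speed_const b R m" using 1 assms B_nonneg by (simp add: speed_const_def)
  then have "0 \<le> 8 * exp 1 * speed_const b R m" by simp
  then show "5 / 2 \<le> spread_const b R m" using 2 unfolding spread_const_def by argo
qed

end

context confined_flow
begin

context
  fixes b :: real
  assumes b: "0 < b" "\<And>s. \<bar>step' s\<bar> \<le> b" "\<And>s s'. \<bar>step' s - step' s'\<bar> \<le> b * \<bar>s - s'\<bar>"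
begin

lemmas const = const_nonneg[OF b(1) R1 mass_nonneg[of "q 0"]]

abbreviation a0 :: real where "a0 \<equiv> decay_const b R1 m0"

lemma annulusI: "0 < r \<Longrightarrow> 0 < h \<Longrightarrow> h \<le> r \<Longrightarrow> annulus r h b"
  by unfold_locales (use b in auto)

lemma flux_bounds:
  assumes s: "s \<ge> 0" and \<rho>: "0 < h" "h \<le> \<rho>"
  shows "\<bar>flux (outer_grad c \<rho> h) (q s)\<bar> \<le> b * (far_const R1 m0 + 20 * (R1\<^sup>2 * m0)) / (h\<^sup>2 * \<rho>\<^sup>2) * tail c \<rho> (q s)"
    and "\<bar>flux (outer_grad c \<rho> h) (q s)\<bar> \<le> (b * far_const R1 m0 / (h * \<rho> ^ 3) + 2 * b * B / h * tail c (\<rho> / 2) (q s)) * tail c \<rho> (q s)"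
proof -
  have ann: "annulus \<rho> h b" using \<rho> by (intro annulusI) auto
  show "\<bar>flux (outer_grad c \<rho> h) (q s)\<bar> \<le> b * (far_const R1 m0 + 20 * (R1\<^sup>2 * m0)) / (h\<^sup>2 * \<rho>\<^sup>2) * tail c \<rho> (q s)"
    and "\<bar>flux (outer_grad c \<rho> h) (q s)\<bar> \<le> (b * far_const R1 m0 / (h * \<rho> ^ 3) + 2 * b * B / h * tail c (\<rho> / 2) (q s)) * tail c \<rho> (q s)"
    using flux_annulus[OF radon[OF s] ann second_moment[OF s] centre_conserved[OF s]]
    unfolding far_const_def mass_conserved[OF s] by blast+
qed

text \<open>
  With \<open>n\<close> the integer part of \<open>r\<^sup>4 / (a t)\<close>, the base of the \<open>n\<close>-th power in \<open>tail_iterated\<close> is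
  at most \<open>1 / e\<close>. The additional \<open>1\<close> in the exponent accounts for rounding, and covers \<open>n = 0\<close>.
\<close>

lemma tail_exponential:
  assumes t: "t > 0" and r: "R1 \<le> r"
  shows "tail c (5 * r / 4) (q t) \<le> m0 * exp (1 - r ^ 4 / (a0 * t))"
proof -
  define C1 where "C1 = b * (far_const R1 m0 + 20 * (R1\<^sup>2 * m0))"
  have C1: "0 \<le> C1" using const(1) b(1) mass_nonneg[of "q 0"] by (simp add: C1_def)
  have a0: "a0 = 16 * (exp 1)\<^sup>2 * (C1 + 1)" by (simp add: decay_const_def C1_def)
  have r0: "r > 0" using r R1 by linarith
  have at: "0 < a0 * t" using const(2) t by simp
  define x where "x = r ^ 4 / (a0 * t)"
  have x: "x > 0" using r0 at by (simp add: x_def)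
  define n where "n = nat \<lfloor>x\<rfloor>"
  have n: "real n \<le> x" "x < real n + 1" using x by (auto simp: n_def)
  show ?thesis
  proof (cases "n = 0")
    case True
    have "tail c (5 * r / 4) (q t) \<le> m0 * 1" using tail_le_m0 t by simp
    also have "\<dots> \<le> m0 * exp (1 - x)" using True n by (intro mult_left_mono mass_nonneg) auto
    finally show ?thesis by (simp add: x_def)
  next
    case False
    then have npos: "n > 0" by simp
    define h where "h = r / (4 * real n)"
    have h: "0 < h" "h \<le> r" using r0 npos by (auto simp: h_def field_simps)
    define \<beta> where "\<beta> = C1 / (h\<^sup>2 * r\<^sup>2)"
    have \<beta>: "0 \<le> \<beta>" using C1 by (simp add: \<beta>_def)
    have "tail c (5 * r / 4) (q t) \<le> m0 * (\<beta> * t * exp 1 / real n) ^ n"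
    proof (rule tail_iterated[OF less_imp_le[OF t] r npos \<beta> b])
      fix \<rho> s assume \<rho>: "r \<le> \<rho>" and s: "s \<in> {0..t}"
      have "\<bar>flux (outer_grad c \<rho> h) (q s)\<bar> \<le> C1 / (h\<^sup>2 * \<rho>\<^sup>2) * tail c \<rho> (q s)"
        unfolding C1_def using s h \<rho> by (intro flux_bounds) auto
      also have "\<dots> \<le> \<beta> * tail c \<rho> (q s)"
        unfolding \<beta>_def using C1 h \<rho> r0
        by (intro mult_right_mono divide_left_mono mult_left_mono power_mono) (auto simp: tail_nonneg)
      finally show "\<bar>flux (outer_grad c \<rho> (r / (4 * real n))) (q s)\<bar> \<le> \<beta> * tail c \<rho> (q s)"
        by (simp add: h_def)
    qed
    also have "\<beta> * t * exp 1 / real n = 16 * C1 * exp 1 * t / r ^ 4 * real n"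
      using npos r0 by (simp add: \<beta>_def h_def field_simps power2_eq_square power4_eq_xxxx)
    also have "m0 * (16 * C1 * exp 1 * t / r ^ 4 * real n) ^ n \<le> m0 * exp (-1) ^ n"
    proof (intro mult_left_mono power_mono mass_nonneg)
      have "16 * C1 * exp 1 * t / r ^ 4 * real n \<le> 16 * C1 * exp 1 * t / r ^ 4 * x"
        using n(1) C1 t r0 by (intro mult_left_mono) auto
      also have "\<dots> = 16 * C1 * exp 1 / a0" using r0 t by (simp add: x_def)
      also have "\<dots> = C1 / (C1 + 1) * exp (-1)"
      proof -
        have cancel: "16 * C * e / (16 * e\<^sup>2 * d) = C / d * inverse e" if "e > 0" "d > 0" for C e d :: real
          using that by (simp add: power2_eq_square field_simps)
        show ?thesis unfolding a0 exp_minus by (rule cancel) (use C1 in auto)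
      qed
      also have "\<dots> \<le> 1 * exp (-1)" using C1 by (intro mult_right_mono) auto
      finally show "16 * C1 * exp 1 * t / r ^ 4 * real n \<le> exp (-1)" by simp
      show "0 \<le> 16 * C1 * exp 1 * t / r ^ 4 * real n" using C1 t r0 by simp
    qed
    also have "exp (-1) ^ n = exp (- real n)" using exp_of_nat_mult[of n "-1::real"] by simp
    also have "m0 * exp (- real n) \<le> m0 * exp (1 - x)"
      using n by (intro mult_left_mono mass_nonneg) auto
    finally show ?thesis by (simp add: x_def)
  qed
qed

text \<open>
  Write \<open>y = r\<^sup>4 / (a t)\<close>. The assumption says \<open>2 + t \<le> exp (y/2)\<close>, so
  \<open>r\<^sup>4 exp (-y) = a t y exp (-y) \<le> a y exp (-y/2) \<le> 2 a\<close>.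
\<close>

lemma tail_cubic:
  assumes t: "t \<ge> 0" and r: "R1 \<le> r" and large: "2 * a0 * (t * ln (2 + t)) \<le> r ^ 4"
  shows "tail c (5 * r / 4) (q t) \<le> m0 * exp 1 * (2 * a0 / R1) / r ^ 3"
proof (cases "t = 0")
  case True
  have "tail c R1 (q 0) = 0" using initially_confined by (simp add: tail_def measure_def)
  moreover have "R1 \<le> 5 * r / 4" using r R1 by simp
  ultimately have "tail c (5 * r / 4) (q t) \<le> 0"
    using tail_antimono[OF radon[of 0], of R1 "5 * r / 4" c] True by simp
  also have "0 \<le> m0 * exp 1 * (2 * a0 / R1) / r ^ 3"
    using mass_nonneg const(2) R1 r by simp
  finally show ?thesis .
next
  case False
  then have tp: "t > 0" using t by simp
  have r0: "r > 0" using r R1 by linarith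
  note a = const(2)
  define y where "y = r ^ 4 / (a0 * t)"
  have y: "y > 0" using r0 a tp by (simp add: y_def)
  have "2 * ln (2 + t) \<le> y"
    using large a tp by (simp add: y_def pos_le_divide_eq mult_ac)
  then have "exp (ln (2 + t)) \<le> exp (y / 2)" by simp
  then have te: "t \<le> exp (y / 2)" using tp by simp
  have r4: "r ^ 4 = a0 * t * y" using a tp by (simp add: y_def)
  have "r ^ 4 * exp (- y) = a0 * (t * (y * exp (- y)))" by (simp add: r4)
  also have "\<dots> \<le> a0 * (exp (y / 2) * (y * exp (- y)))"
    using te a y by (intro mult_left_mono mult_right_mono) auto
  also have "\<dots> = 2 * a0 * (y / 2 * exp (- (y / 2)))"
  proof -
    have "exp (y / 2) * exp (- y) = exp (- (y / 2))" by (simp add: exp_add[symmetric])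
    then show ?thesis by (simp add: mult.left_commute)
  qed
  also have "\<dots> \<le> 2 * a0 * 1"
  proof (intro mult_left_mono)
    have "y / 2 \<le> exp (y / 2)" using exp_ge_add_one_self[of "y / 2"] by linarith
    then have "y / 2 * exp (- (y / 2)) \<le> exp (y / 2) * exp (- (y / 2))" by (intro mult_right_mono) auto
    then show "y / 2 * exp (- (y / 2)) \<le> 1" by (simp add: exp_add[symmetric])
  qed (use a in simp)
  finally have e: "exp (- y) \<le> 2 * a0 / r ^ 4" using r0 by (simp add: field_simps)
  have "exp (1 - y) = exp 1 * exp (- y)" by (simp add: exp_add[symmetric])
  also have "\<dots> \<le> exp 1 * (2 * a0 / r ^ 4)" using e by (intro mult_left_mono) auto
  also have "2 * a0 / r ^ 4 \<le> 2 * a0 / (R1 * r ^ 3)"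
  proof (intro divide_left_mono)
    have "R1 * r ^ 3 \<le> r * r ^ 3" using r r0 by (intro mult_right_mono) auto
    also have "\<dots> = r ^ 4" by (simp add: power4_eq_xxxx power3_eq_cube)
    finally show "R1 * r ^ 3 \<le> r ^ 4" .
  qed (use a r0 R1 in auto)
  finally have "exp (1 - y) \<le> exp 1 * (2 * a0 / (R1 * r ^ 3))" by simp
  then have "m0 * exp (1 - y) \<le> m0 * (exp 1 * (2 * a0 / (R1 * r ^ 3)))"
    by (intro mult_left_mono mass_nonneg)
  then show ?thesis using tail_exponential[OF tp r] by (simp add: y_def)
qed

text \<open>
  At all times up to \<open>t\<close> the tail beyond \<open>r/2 = 5/4 * (2r/5)\<close> is of order \<open>1 / r ^ 3\<close> by
  \<open>tail_cubic\<close>. Hence each annulus is crossed at a speed of order \<open>1 / r ^ 3\<close>, and the mass that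
  gets through all \<open>n\<close> of them is at most \<open>m0 * x ^ n\<close> with a base \<open>x < 1\<close> that does not depend
  on \<open>n\<close>.
\<close>

lemma tail_vanishes:
  assumes t: "t \<ge> 0" and r: "5 / 2 * R1 \<le> r"
    and large: "2 * a0 * (t * ln (2 + t)) \<le> (2 * r / 5) ^ 4"
    and fast: "4 * exp 1 * speed_const b R1 m0 * t < r ^ 4"
  shows "tail c (5 * r / 4) (q t) = 0"
proof -
  define C3 where "C3 = tail_const b R1 m0"
  define C2 where "C2 = speed_const b R1 m0"
  have C2: "0 \<le> C2" using const(4) by (simp add: C2_def)
  have r0: "r > 0" "R1 \<le> r" using r R1 by auto
  have half: "tail c (r / 2) (q s) \<le> C3 / r ^ 3" if s: "s \<in> {0..t}" for s
  proof -
    have "s * ln (2 + s) \<le> t * ln (2 + t)" using s by (intro mult_mono) auto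
    then have "2 * a0 * (s * ln (2 + s)) \<le> 2 * a0 * (t * ln (2 + t))"
      using const(2) by (intro mult_left_mono) auto
    then have "2 * a0 * (s * ln (2 + s)) \<le> (2 * r / 5) ^ 4" using large by (rule order_trans)
    then have "tail c (5 * (2 * r / 5) / 4) (q s) \<le> m0 * exp 1 * (2 * a0 / R1) / (2 * r / 5) ^ 3"
      using s r by (intro tail_cubic) auto
    also have "\<dots> = C3 / r ^ 3" using r0 by (simp add: C3_def tail_const_def power_divide power_mult_distrib)
    finally show ?thesis by simp
  qed
  define x where "x = 4 * exp 1 * C2 * t / r ^ 4"
  have x: "0 \<le> x" "x < 1" using C2 t fast r0 by (auto simp: x_def C2_def)
  have le: "tail c (5 * r / 4) (q t) \<le> m0 * x ^ n" if n: "n > 0" for n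
  proof -
    define h where "h = r / (4 * real n)"
    have h: "0 < h" "h \<le> r" using r0 n by (auto simp: h_def field_simps)
    define \<beta> where "\<beta> = C2 / (h * r ^ 3)"
    have \<beta>: "0 \<le> \<beta>" using C2 h r0 by (simp add: \<beta>_def)
    have "tail c (5 * r / 4) (q t) \<le> m0 * (\<beta> * t * exp 1 / real n) ^ n"
    proof (rule tail_iterated[OF t r0(2) n \<beta> b])
      fix \<rho> s assume \<rho>: "r \<le> \<rho>" and s: "s \<in> {0..t}"
      have "\<bar>flux (outer_grad c \<rho> h) (q s)\<bar>
          \<le> (b * far_const R1 m0 / (h * \<rho> ^ 3) + 2 * b * B / h * tail c (\<rho> / 2) (q s)) * tail c \<rho> (q s)"
        using s h \<rho> by (intro flux_bounds) auto
      also have "\<dots> \<le> \<beta> * tail c \<rho> (q s)"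
      proof (intro mult_right_mono tail_nonneg)
        have "b * far_const R1 m0 / (h * \<rho> ^ 3) \<le> b * far_const R1 m0 / (h * r ^ 3)"
          using \<rho> h r0 b(1) const(1) by (intro divide_left_mono mult_left_mono power_mono) auto
        moreover have "tail c (\<rho> / 2) (q s) \<le> C3 / r ^ 3"
          using half[OF s] tail_antimono[OF radon[of s], of "r / 2" "\<rho> / 2" c] \<rho> s by auto
        then have "2 * b * B / h * tail c (\<rho> / 2) (q s) \<le> 2 * b * B / h * (C3 / r ^ 3)"
          using b(1) B_nonneg h by (intro mult_left_mono) auto
        ultimately have "b * far_const R1 m0 / (h * \<rho> ^ 3) + 2 * b * B / h * tail c (\<rho> / 2) (q s)
            \<le> b * far_const R1 m0 / (h * r ^ 3) + 2 * b * B / h * (C3 / r ^ 3)" by (rule add_mono)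
        also have "\<dots> = \<beta>"
          by (simp add: \<beta>_def C2_def speed_const_def C3_def add_divide_distrib)
        finally show "b * far_const R1 m0 / (h * \<rho> ^ 3) + 2 * b * B / h * tail c (\<rho> / 2) (q s) \<le> \<beta>" .
      qed
      finally show "\<bar>flux (outer_grad c \<rho> (r / (4 * real n))) (q s)\<bar> \<le> \<beta> * tail c \<rho> (q s)"
        by (simp add: h_def)
    qed
    also have "\<beta> * t * exp 1 / real n = x"
      using n r0 by (simp add: \<beta>_def h_def x_def power4_eq_xxxx power3_eq_cube mult_ac)
    finally show ?thesis .
  qed
  have "(\<lambda>n. m0 * x ^ n) \<longlonglongrightarrow> m0 * 0"
    using x by (intro tendsto_mult tendsto_const LIMSEQ_realpow_zero)
  then have "tail c (5 * r / 4) (q t) \<le> m0 * 0"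
    by (rule LIMSEQ_le_const) (use le in \<open>auto intro!: exI[of _ 1]\<close>)
  then show ?thesis using tail_nonneg[of c "5 * r / 4" "q t"] by simp
qed

text \<open>
  The constant \<open>spread_const\<close> is large enough that \<open>r = 5/2 R1 + S w\<close> satisfies both
  requirements of \<open>tail_vanishes\<close>; the one without logarithm follows from \<open>ln (2 + t) \<ge> 1/2\<close>.
\<close>

lemma tail_vanishes_beyond_spread:
  assumes t: "t \<ge> 0"
  defines "w \<equiv> (t * ln (2 + t)) powr (1 / 4)"
  shows "tail c (5 / 4 * (5 / 2 * R1 + spread_const b R1 m0 * w)) (q t) = 0"
proof -
  define S where "S = spread_const b R1 m0"
  define r where "r = 5 / 2 * R1 + S * w"
  have a: "0 < a0" by (rule const)
  have C2: "0 \<le> speed_const b R1 m0" by (rule const)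
  have S: "1 + 2 * a0 \<le> 2 * S / 5" "1 \<le> S" "8 * exp 1 * speed_const b R1 m0 \<le> S"
  proof -
    define p where "p = 8 * exp 1 * speed_const b R1 m0"
    have p: "0 \<le> p" "S = 5 / 2 * (1 + 2 * a0) + p"
      using C2 by (simp_all add: S_def spread_const_def p_def)
    have arith: "1 + 2 * a \<le> 2 * s / 5 \<and> 1 \<le> s \<and> p \<le> s" if "s = 5 / 2 * (1 + 2 * a) + p" "0 < a" for s a
      using that p(1) by (simp add: field_simps)
    from arith[OF p(2) a]
    show "1 + 2 * a0 \<le> 2 * S / 5" "1 \<le> S" "8 * exp 1 * speed_const b R1 m0 \<le> S"
      unfolding p_def by blast+
  qed
  have u: "0 \<le> t * ln (2 + t)" using t by simp
  have w0: "0 \<le> w" by (simp add: w_def)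
  have w4: "w ^ 4 = t * ln (2 + t)"
  proof (cases "t * ln (2 + t) = 0")
    case False
    then have "0 < t * ln (2 + t)" using u by linarith
    have "(u powr (1 / 4)) ^ 4 = u" if "0 < u" for u :: real
    proof -
      have "(u powr (1 / 4)) ^ 4 = (u powr (1 / 4)) powr real 4"
        using that by (intro powr_realpow[symmetric]) simp
      then show ?thesis using that by (simp add: powr_powr)
    qed
    from this[OF \<open>0 < t * ln (2 + t)\<close>] show ?thesis by (simp only: w_def)
  next
    case True
    then have "w = 0" unfolding w_def by (simp only: powr_0)
    then show ?thesis using True by simp
  qed
  have Sw: "0 \<le> S * w" using S(2) w0 by simp
  have r: "5 / 2 * R1 \<le> r" "S * w \<le> r" "0 \<le> S * w" "S * w < r" using Sw R1 by (auto simp: r_def)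
  have "2 * a0 * (t * ln (2 + t)) \<le> (2 * S / 5) ^ 4 * w ^ 4"
  proof -
    have "2 * a0 \<le> 1 + 2 * a0" by simp
    also have "\<dots> \<le> (1 + 2 * a0) ^ 4" using a by (intro self_le_power) auto
    also have "\<dots> \<le> (2 * S / 5) ^ 4" using S(1) a by (intro power_mono) auto
    finally show ?thesis unfolding w4[symmetric] by (intro mult_right_mono) auto
  qed
  also have "\<dots> = (2 * (S * w) / 5) ^ 4" by (simp add: power_mult_distrib power_divide)
  also have "\<dots> \<le> (2 * r / 5) ^ 4" using r by (intro power_mono) auto
  finally have large: "2 * a0 * (t * ln (2 + t)) \<le> (2 * r / 5) ^ 4" .
  have ln2: "1 / 2 \<le> ln (2 + t)"
  proof -
    have "exp (1 / 2 :: real) \<le> 2"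
    proof -
      have "exp (1 / 2 :: real) ^ 2 = exp 1" by (simp add: exp_of_nat_mult[symmetric])
      also have "\<dots> \<le> 2 ^ 2" using exp_le by simp
      finally show ?thesis by (rule power2_le_imp_le) simp
    qed
    then show ?thesis using t by (subst ln_ge_iff) auto
  qed
  have "4 * exp 1 * speed_const b R1 m0 * t = 8 * exp 1 * speed_const b R1 m0 * (t * (1 / 2))" by simp
  also have "\<dots> \<le> S * (t * ln (2 + t))"
    using S t ln2 C2 by (intro mult_mono mult_left_mono) auto
  also have "\<dots> \<le> S ^ 4 * w ^ 4"
    unfolding w4[symmetric] using S(2) by (intro mult_right_mono self_le_power) auto
  also have "\<dots> = (S * w) ^ 4" by (simp add: power_mult_distrib)
  also have "\<dots> < r ^ 4" using r by (intro power_strict_mono) auto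
  finally have fast: "4 * exp 1 * speed_const b R1 m0 * t < r ^ 4" .
  from tail_vanishes[OF t r(1) large fast] show ?thesis by (simp add: r_def S_def)
qed

end

end

section \<open>Growth of the support\<close>

text \<open>
  The complement is a union of open null sets, of which countably many suffice.
\<close>

lemma null_outside_support:
  fixes \<mu> :: "'a::euclidean_space measure"
  assumes \<mu>: "bounded_radon_measure \<mu>" and C: "closed C" "measure_support \<mu> \<subseteq> C"
  shows "emeasure \<mu> (- C) = 0"
proof -
  define \<F> where "\<F> = {U. open U \<and> emeasure \<mu> U = 0}"
  have cover: "- C \<subseteq> \<Union>\<F>" using C(2) by (auto simp: measure_support_def \<F>_def)
  obtain \<G> where \<G>: "\<G> \<subseteq> \<F>" "countable \<G>" "\<Union>\<G> = \<Union>\<F>"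
    using Lindelof[of \<F>] by (auto simp: \<F>_def)
  have "U \<in> null_sets \<mu>" if "U \<in> \<G>" for U
    using that \<G>(1) bounded_radon_measureD(2)[OF \<mu>] by (auto simp: \<F>_def null_sets_def)
  then have "\<Union>\<G> \<in> null_sets \<mu>" using \<G>(2) null_sets_UN'[of \<G> "\<lambda>U. U" \<mu>] by auto
  moreover have "- C \<in> sets \<mu>" using C(1) bounded_radon_measureD(2)[OF \<mu>] by auto
  moreover have "- C \<subseteq> \<Union>\<G>" using cover \<G>(3) by simp
  ultimately have "- C \<in> null_sets \<mu>" by (rule null_sets_subset)
  then show ?thesis by (simp add: null_sets_def)
qed

lemma support_subset_closed:
  assumes "closed C" "emeasure \<mu> (- C) = 0" shows "measure_support \<mu> \<subseteq> C"
  using assms by (auto simp: measure_support_def)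

context helmholtz
begin

text \<open>
  The estimates are carried out about the centre of mass, which lies within \<open>R0\<close> of the origin,
  with initial radius \<open>2 R0\<close>. For a measure of mass zero the division by the mass yields the
  centre \<open>0\<close>, which serves as well.
\<close>

theorem support_growth:
  "\<exists>C :: real \<Rightarrow> real \<Rightarrow> real. (\<forall>R0 m. C R0 m > 0) \<and>
    (\<forall>q0 R0 q t. bounded_radon_measure q0 \<longrightarrow> R0 > 0 \<longrightarrow> measure_support q0 \<subseteq> cball 0 R0 \<longrightarrow>
       weak_solution G q0 q \<longrightarrow> t \<ge> 0 \<longrightarrow>
       measure_support (q t) \<subseteq> cball 0 (8 * R0 + C R0 (mass q0) * (t * ln (2 + t)) powr (1/4)))"
proof -
  obtain k B D where "vortex_kernel (filtered_kernel G) k B D" using filtered_kernel_vortex_kernel by blast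
  then interpret vortex_kernel "filtered_kernel G" k B D .
  obtain b where b: "b > 0" "\<And>s. \<bar>step' s\<bar> \<le> b" "\<And>s. \<bar>step'' s\<bar> \<le> b"
    "\<And>s s'. \<bar>step' s - step' s'\<bar> \<le> b * \<bar>s - s'\<bar>"
    using step_derivative_bounds by metis
  define C where "C R0 m = (if R0 > 0 \<and> m \<ge> 0 then 5 / 4 * spread_const b (2 * R0) m else 1)" for R0 m
  have "C R0 m > 0" for R0 m
    using const_nonneg(5)[OF b(1), of "2 * R0" m] by (auto simp: C_def)
  moreover have "measure_support (q t) \<subseteq> cball 0 (8 * R0 + C R0 (mass q0) * (t * ln (2 + t)) powr (1/4))"
    if q0: "bounded_radon_measure q0" and R0: "R0 > 0" and supp: "measure_support q0 \<subseteq> cball 0 R0"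
      and sol: "weak_solution G q0 q" and t: "t \<ge> 0" for q0 R0 q t
  proof -
    note D0 = bounded_radon_measureD[OF q0]
    interpret Q0: finite_measure q0 by (rule D0)
    have init: "q 0 = q0" using sol by (simp add: weak_solution_def)
    interpret vortex_flow "filtered_kernel G" k B D q
    proof unfold_locales
      show "bounded_radon_measure (q t)" if "t \<ge> 0" for t using sol that by (simp add: weak_solution_def)
      show "locally_bounded_compactly_supported q" "weak_star_continuous q"
        using sol by (simp_all add: weak_solution_def)
      show "(LINT t:{0..}|lborel. (LINT x|q t.
            frechet_derivative \<phi> (at (x, t)) (0, 1)
          + frechet_derivative \<phi> (at (x, t)) (LINT y|q t. filtered_kernel G (x - y), 0)))
        + (LINT x|q 0. \<phi> (x, 0)) = 0" if "test_function \<phi>" for \<phi>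
        using sol that unfolding weak_solution_def velocity_def init by blast
    qed
    define c where "c = first_moment q0 /\<^sub>R mass q0"
    have null: "emeasure q0 (- cball 0 R0) = 0" by (rule null_outside_support[OF q0 closed_cball supp])
    then have "- cball 0 R0 \<in> null_sets q0" using D0 by (simp add: null_sets_def)
    from AE_not_in[OF this] have ae: "AE x in q0. norm x \<le> R0" by eventually_elim simp
    have idm: "(\<lambda>x. x) \<in> borel_measurable q0" unfolding D0 by simp
    have int: "integrable q0 (\<lambda>x. x)" by (rule Q0.integrable_const_bound[OF ae idm])
    have "norm (first_moment q0) \<le> (\<integral>x. norm x \<partial>q0)"
      unfolding first_moment_def by (rule integral_norm_bound)
    also have "\<dots> \<le> (\<integral>x. R0 \<partial>q0)" by (rule integral_mono_AE[OF integrable_norm[OF int] _ ae]) simp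
    also have "\<dots> = R0 * mass q0" by (simp add: mass_def D0)
    finally have fm: "norm (first_moment q0) \<le> R0 * mass q0" .
    have cb: "norm c \<le> R0"
    proof (cases "mass q0 = 0")
      case False
      then have "mass q0 > 0" using mass_nonneg[of q0] by simp
      then show ?thesis using fm by (simp add: c_def divide_inverse_commute[symmetric] pos_divide_le_eq)
    qed (use R0 in \<open>simp add: c_def\<close>)
    have mc: "first_moment q0 = mass q0 *\<^sub>R c" using fm by (cases "mass q0 = 0") (auto simp: c_def)
    interpret confined_flow "filtered_kernel G" k B D q c "2 * R0"
    proof unfold_locales
      show "2 * R0 > 0" using R0 by simp
      have "{x. 2 * R0 < norm (x - c)} \<subseteq> - cball 0 R0"
      proof
        fix x assume "x \<in> {x. 2 * R0 < norm (x - c)}"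
        then show "x \<in> - cball 0 R0" using norm_triangle_ineq4[of x c] cb by simp
      qed
      moreover have "- cball 0 R0 \<in> sets q0" unfolding D0 by simp
      ultimately have "emeasure q0 {x. 2 * R0 < norm (x - c)} \<le> emeasure q0 (- cball 0 R0)" by (rule emeasure_mono)
      then show "emeasure (q 0) {x. 2 * R0 < norm (x - c)} = 0" by (simp add: init null)
      fix e
      have "(\<integral>x. (x - c) \<bullet> e \<partial>q0) = (\<integral>x. x \<bullet> e \<partial>q0) - (\<integral>x. c \<bullet> e \<partial>q0)"
        using integrable_inner_left[OF int, of e] by (simp add: inner_diff_left)
      also have "(\<integral>x. x \<bullet> e \<partial>q0) = first_moment q0 \<bullet> e"
        using integral_inner_left[OF int, of e] by (simp add: first_moment_def)
      also have "(\<integral>x. c \<bullet> e \<partial>q0) = mass q0 * (c \<bullet> e)" by (simp add: mass_def D0)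
      finally show "(\<integral>x. (x - c) \<bullet> e \<partial>q 0) = 0" by (simp add: init mc)
    qed
    define w where "w = (t * ln (2 + t)) powr (1/4)"
    \<comment> \<open>The disc around \<open>c\<close> that holds the support has radius \<open>25/4 R0\<close> plus the growth.\<close>
    define S where "S = spread_const b (2 * R0) (mass q0)"
    define \<rho> where "\<rho> = 5 / 4 * (5 / 2 * (2 * R0) + S * w)"
    have "tail c \<rho> (q t) = 0"
      using tail_vanishes_beyond_spread[OF b(1,2,4) t] by (simp add: \<rho>_def S_def w_def init)
    then have "emeasure (q t) {x. \<rho> < norm (x - c)} = 0"
      using finite_measure.emeasure_eq_measure[OF bounded_radon_measureD(1)[OF radon[OF t]]] by (simp add: tail_def)
    moreover have "- cball c \<rho> = {x. \<rho> < norm (x - c)}" by (auto simp: dist_norm norm_minus_commute)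
    ultimately have "measure_support (q t) \<subseteq> cball c \<rho>" by (intro support_subset_closed) auto
    also have "\<dots> \<subseteq> cball 0 (8 * R0 + C R0 (mass q0) * w)"
    proof
      fix x assume "x \<in> cball c \<rho>"
      then have "norm (x - c) \<le> \<rho>" by (simp add: dist_norm norm_minus_commute)
      then have "norm x \<le> R0 + \<rho>" using norm_triangle_sub[of x c] cb by linarith
      also have "\<dots> \<le> 8 * R0 + 5 / 4 * S * w" using R0 by (simp add: \<rho>_def algebra_simps)
      also have "5 / 4 * S = C R0 (mass q0)" using R0 mass_nonneg by (simp add: C_def S_def)
      finally show "x \<in> cball 0 (8 * R0 + C R0 (mass q0) * w)" by simp
    qed
    finally show ?thesis by (simp add: w_def)
  qed
  ultimately show ?thesis by blast
qed

end

theorem theorem1: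
  fixes \<alpha> :: real and G :: "real^2 \<Rightarrow> real"
  assumes "\<alpha> > 0" and "helmholtz_kernel \<alpha> G"
  shows "\<exists>C :: real \<Rightarrow> real \<Rightarrow> real^2 \<Rightarrow> real \<Rightarrow> real.
    (\<forall>R0 m c I. C R0 m c I > 0) \<and>
    (\<forall>(q0 :: (real^2) measure) (R0 :: real) (q :: real \<Rightarrow> (real^2) measure).
       bounded_radon_measure q0 \<longrightarrow> compact (measure_support q0) \<longrightarrow>
       R0 > 0 \<longrightarrow> measure_support q0 \<subseteq> cball 0 R0 \<longrightarrow>
       weak_solution G q0 q \<longrightarrow>
       (\<forall>t\<ge>0. measure_support (q t) \<subseteq>
          cball 0 (8 * R0 + C R0 (mass q0) (first_moment q0) (moment_of_inertia q0)
                            * (t * ln (2 + t)) powr (1/4))))"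
proof -
  interpret helmholtz \<alpha> G using assms by unfold_locales
  obtain C :: "real \<Rightarrow> real \<Rightarrow> real" where C: "\<And>R0 m. C R0 m > 0"
    "\<And>q0 R0 q t. bounded_radon_measure q0 \<Longrightarrow> R0 > 0 \<Longrightarrow> measure_support q0 \<subseteq> cball 0 R0 \<Longrightarrow>
       weak_solution G q0 q \<Longrightarrow> t \<ge> 0 \<Longrightarrow>
       measure_support (q t) \<subseteq> cball 0 (8 * R0 + C R0 (mass q0) * (t * ln (2 + t)) powr (1/4))"
    using support_growth by blast
  show ?thesis
    by (rule exI[of _ "\<lambda>R0 m _ _. C R0 m"]) (intro conjI allI impI C)
qed

end
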